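(* Let $m\ge2$, $n=2m-1$, $I=[0,1]$, and consider the scaled kernel $$\hat{\mathcal{H}}:=\frac{1}{\mathrm{Vol}(M^{2m-1})}\frac{2}{(2m-1)!(m-1)!}\,\mathcal{H}.$$ Then $\hat{\mathcal{H}}(\cdot,t)\in\Pi^{2m-1}_0$ for every $t\in I^{m-1}$. Moreover, let $\{p_j,\ j=1,\dots,2m-2\}$ be a basis of $\Pi^{2m-1}_0$ and consider the resulting expansion of $\hat{\mathcal{H}}(\cdot,t)$ in this basis for each $t\in I^{m-1}$: $$\hat{\mathcal{H}}(t_*,t)=\sum_{j=1}^{2m-2}h_j(t)\,p_j(t_* ),\qquad (t_*,t)\in I\times I^{m-1}.$$ Then $\{\Sigma p_j,\ j=1,\dots,2m-2\}$ and $\{h_j,\ j=1,\dots,2m-2\}$ form an $L^2(I^{m-1})$ biorthogonal system, that is, $$\int_{I^{m-1}}h_j\,\Sigma p_k=\delta_{jk},\qquad j,k=1,\dots,2m-2 .$$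
   Context: $\Pi^{n}_0$ is the space of real polynomials $\phi$ of degree at most $n$ with $\phi(0)=\phi(1)=0$. For $\phi:I\to\mathbb{R}$, $(\Sigma\phi)(t):=\sum_{j=1}^{m-1}\phi(t_j)$, $t\in I^{m-1}$. $M^n\subset\mathbb{R}^n$ is the set of vectors $(\mathbb{E}_{t\sim\mu}[t^i])_{i=1}^n$ as $\mu$ ranges over Borel probability measures on $[0,1]$, and $\mathrm{Vol}$ is $n$-dimensional Lebesgue measure. With $\Delta_N(t):=\prod_{1\le j<k\le N}(t_k-t_j)$, for $t_*\in I$, $t\in I^{m-1}$, $$\mathcal{J}^c_{ol}(t_*,t):=t_*\prod_{j=1}^{m-1}(t_j-t_* )^2\prod_{j=1}^{m-1}t_j^2\cdot\Delta_{m-1}^4(t),\quad \mathcal{J}^c_{ou}(t_*,t):=(1-t_* )\prod_{j=1}^{m-1}(t_j-t_* )^2\prod_{j=1}^{m-1}(1-t_j)^2\cdot\Delta_{m-1}^4(t),$$ $$\mathcal{J}^p_{ou}(t):=\prod_{j=1}^{m-1}t_j^2(1-t_j)^2\cdot\Delta_{m-1}^4(t)\ \bigl(=\mathcal{J}^c_{ou}(0,t)\bigr),\qquad \mathcal{H}(t_*,t):=\mathcal{J}^p_{ou}(t)-\mathcal{J}^c_{ol}(t_*,t)-\mathcal{J}^c_{ou}(t_*,t).$$ *)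

theory Defs
  imports "HOL-Probability.Probability" "HOL-Computational_Algebra.Polynomial"
begin

text \<open>
  Points of \<open>\<real>\<^sup>k\<close> are extensional functions on the index set \<open>{1..k}\<close>, so that the
  dimension may depend on a natural number.
\<close>

definition lborel_dim :: "nat \<Rightarrow> (nat \<Rightarrow> real) measure" where
  "lborel_dim k = (\<Pi>\<^sub>M i\<in>{1..k}. lborel)"

definition unit_cube :: "nat \<Rightarrow> (nat \<Rightarrow> real) set" where
  "unit_cube k = (\<Pi>\<^sub>E i\<in>{1..k}. {0..1})"

text \<open>
  Membership in \<open>L\<^sup>2(A)\<close>, for a function of which only the values on \<open>A\<close> matter.
\<close>

definition square_integrable_on :: "'a measure \<Rightarrow> 'a set \<Rightarrow> ('a \<Rightarrow> real) \<Rightarrow> bool" where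
  "square_integrable_on M A f \<longleftrightarrow>
     set_borel_measurable M A f \<and> set_integrable M A (\<lambda>x. (f x)\<^sup>2)"

text \<open>
  The moment space is compact, hence a Borel set, so \<open>lborel_dim n\<close> assigns to it
  its Lebesgue measure.
\<close>

definition moment_space :: "nat \<Rightarrow> (nat \<Rightarrow> real) set" where
  "moment_space n =
     {(\<lambda>i\<in>{1..n}. LINT t|\<mu>. t ^ i) | \<mu> :: real measure.
        prob_space \<mu> \<and> sets \<mu> = sets (restrict_space borel {0..1})}"

definition Vol :: "nat \<Rightarrow> (nat \<Rightarrow> real) set \<Rightarrow> real" where
  "Vol n A = measure (lborel_dim n) A"

definition Pi0 :: "nat \<Rightarrow> real poly set" where
  "Pi0 n = {\<phi>. degree \<phi> \<le> n \<and> poly \<phi> 0 = 0 \<and> poly \<phi> 1 = 0}"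

global_interpretation poly_vs: vector_space "smult :: real \<Rightarrow> real poly \<Rightarrow> real poly"
  by unfold_locales (simp_all add: smult_add_right smult_add_left)

definition Sigma_op :: "nat \<Rightarrow> (real \<Rightarrow> real) \<Rightarrow> (nat \<Rightarrow> real) \<Rightarrow> real" where
  "Sigma_op m \<phi> t = (\<Sum>j=1..m-1. \<phi> (t j))"

definition vandermonde_prod :: "nat \<Rightarrow> (nat \<Rightarrow> real) \<Rightarrow> real" where
  "vandermonde_prod N t = (\<Prod>k=1..N. \<Prod>j=1..<k. t k - t j)"

definition J_c_ol :: "nat \<Rightarrow> real \<Rightarrow> (nat \<Rightarrow> real) \<Rightarrow> real" where
  "J_c_ol m s t = s * (\<Prod>j=1..m-1. (t j - s)\<^sup>2) * (\<Prod>j=1..m-1. (t j)\<^sup>2)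
                    * vandermonde_prod (m-1) t ^ 4"

definition J_c_ou :: "nat \<Rightarrow> real \<Rightarrow> (nat \<Rightarrow> real) \<Rightarrow> real" where
  "J_c_ou m s t = (1 - s) * (\<Prod>j=1..m-1. (t j - s)\<^sup>2) * (\<Prod>j=1..m-1. (1 - t j)\<^sup>2)
                    * vandermonde_prod (m-1) t ^ 4"

definition J_p_ou :: "nat \<Rightarrow> (nat \<Rightarrow> real) \<Rightarrow> real" where
  "J_p_ou m t = (\<Prod>j=1..m-1. (t j)\<^sup>2 * (1 - t j)\<^sup>2) * vandermonde_prod (m-1) t ^ 4"

definition H_kernel :: "nat \<Rightarrow> real \<Rightarrow> (nat \<Rightarrow> real) \<Rightarrow> real" where
  "H_kernel m s t = J_p_ou m t - J_c_ol m s t - J_c_ou m s t"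

definition H_hat :: "nat \<Rightarrow> real \<Rightarrow> (nat \<Rightarrow> real) \<Rightarrow> real" where
  "H_hat m s t =
     1 / Vol (2*m-1) (moment_space (2*m-1)) * (2 / (fact (2*m-1) * fact (m-1)))
       * H_kernel m s t"

end

theory Submission
  imports Defs "HOL-Computational_Algebra.Polynomial_Factorial" "HOL-Computational_Algebra.Field_as_Ring"
    "HOL-Computational_Algebra.Formal_Power_Series"
begin

text \<open>
Write \<open>N = m - 1\<close> and let \<open>W(t)\<close> be \<open>\<J>\<^sup>p\<^sub>o\<^sub>u(t)\<close>. Everything follows from one reproducing
identity: \<open>\<integral> H_hat(s, t) (\<Sigma>\<phi>)(t) dt = \<phi>(s)\<close> for every \<open>\<phi>\<close> in \<open>Pi0 (2N + 1)\<close>. Inserting the expansion of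
the kernel and \<open>\<phi> = p\<^sub>k\<close> gives \<open>\<Sum>\<^sub>j (\<integral> h\<^sub>j \<Sigma>p\<^sub>k) p\<^sub>j = p\<^sub>k\<close>, and independence of the basis reads off the
biorthogonality relations.

The identity up to a constant (\<open>reproducing_identity\<close>) is Hermite interpolation combined with
integration by parts. Interpolating \<open>\<phi>\<close> at \<open>s\<close> from its values at the simple nodes 0 and 1
and from values and derivatives at the double nodes \<open>t\<^sub>j\<close>, and multiplying by \<open>W\<close>, gives

 \<open>W(t) \<phi>(s) = \<phi>(0) \<J>\<^sup>c\<^sub>o\<^sub>u(s, t) + \<phi>(1) \<J>\<^sup>c\<^sub>o\<^sub>l(s, t) + \<Sum>\<^sub>j (a\<^sub>j \<phi>(t\<^sub>j) + b\<^sub>j \<phi>'(t\<^sub>j))\<close>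

with polynomials \<open>a\<^sub>j\<close>, \<open>b\<^sub>j\<close> in \<open>s\<close> and \<open>t\<close>. The point is that \<open>a\<^sub>j\<close> is minus the partial derivative of
\<open>b\<^sub>j\<close> with respect to \<open>t\<^sub>j\<close>, and that \<open>b\<^sub>j\<close> vanishes for \<open>t\<^sub>j\<close> equal to 0 or 1. Taking \<open>\<phi> = 1\<close> shows that the
kernel \<open>H\<close> equals \<open>\<Sum>\<^sub>j a\<^sub>j\<close>, a divergence. Integrating by parts, \<open>\<integral> H \<Sigma>\<phi> = \<Sum>\<^sub>j \<integral> b\<^sub>j \<phi>'(t\<^sub>j)\<close>, while
the interpolation formula itself integrates to \<open>\<phi>(s) \<integral> W = 2 \<Sum>\<^sub>j \<integral> b\<^sub>j \<phi>'(t\<^sub>j)\<close> if \<open>\<phi>(0) = \<phi>(1) = 0\<close>.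

It remains to see that \<open>\<integral> W = (m - 1)! (2m - 1)! Vol(M\<^sup>2\<^sup>m\<^sup>-\<^sup>1)\<close>. Both sides are evaluated in terms of
\<open>B\<^sub>k = \<integral> (x (1 - x))\<^sup>k dx\<close> over the unit interval. For the left side (\<open>selberg_integral\<close>, a
case of Selberg's integral) the coefficient of \<open>s\<^sup>2\<^sup>N\<^sup>+\<^sup>1\<close> in the interpolation formula, with \<open>\<phi>'\<close> a shifted Legendre
polynomial of degree \<open>2N\<close>, yields a recursion in \<open>N\<close>: orthogonality leaves only the leading
coefficient of the polynomial that \<open>\<phi>'\<close> is integrated against, and this one is constant.

The volume (\<open>Vol_moment_space\<close>) is \<open>B\<^sub>0 \<cdots> B\<^sub>n\<^sub>-\<^sub>1\<close>, because the slice of the moment space \<open>M\<^sup>n\<close> with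
first moment \<open>p\<close> is the image of \<open>M\<^sup>n\<^sup>-\<^sup>1\<close> under a triangular polynomial map whose diagonal derivatives all equal
\<open>p (1 - p)\<close>. In terms of the generating functions \<open>C\<close> and \<open>D\<close> of the moments this map is the
Moebius transformation \<open>C = (p D + 1 - p) / (p (1 - X) D + 1 - p)\<close>. To see that it maps moment
sequences to moment sequences in both directions, these are described by four
Hankel matrices being positive semidefinite (\<open>hausdorff_moment_problem\<close>), and the Moebius transformation is factored
into steps \<open>G = 1 / (1 - X A)\<close>. Reading \<open>G\<close> as the renewal sequence with step weights \<open>A\<close>, cutting at the
step that straddles a given time exhibits the Hankel matrix of \<open>G\<close> as a congruence
transform of that of \<open>A\<close>, so each step merely permutes the conditions (\<open>hausdorff_moebius\<close>).
\<close>

section \<open>Hermite interpolation with double nodes\<close>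

definition double_nodes :: "nat set \<Rightarrow> (nat \<Rightarrow> real) \<Rightarrow> real poly" where
  "double_nodes I t = (\<Prod>k\<in>I. [:- t k, 1:]\<^sup>2)"

definition node_poly :: "nat set \<Rightarrow> (nat \<Rightarrow> real) \<Rightarrow> real poly" where
  "node_poly I t = [:0, 1, -1:] * double_nodes I t"

text \<open>
Over ordered pairs, so that every squared difference occurs twice. This form makes sense for any
finite index set and has no preferred order, which allows a node to be removed.
\<close>
definition vandermonde4 :: "nat set \<Rightarrow> (nat \<Rightarrow> real) \<Rightarrow> real" where
  "vandermonde4 I t = (\<Prod>j\<in>I. \<Prod>k\<in>I - {j}. (t j - t k)\<^sup>2)"

definition principal_weight :: "nat set \<Rightarrow> (nat \<Rightarrow> real) \<Rightarrow> real" where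
  "principal_weight I t = (\<Prod>j\<in>I. (t j)\<^sup>2 * (1 - t j)\<^sup>2) * vandermonde4 I t"

lemma poly_double_nodes: "poly (double_nodes I t) x = (\<Prod>k\<in>I. (x - t k)\<^sup>2)"
  by (simp add: double_nodes_def poly_prod algebra_simps)

lemma poly_node_poly: "poly (node_poly I t) x = x * (1 - x) * (\<Prod>k\<in>I. (x - t k)\<^sup>2)"
  by (simp add: node_poly_def poly_double_nodes algebra_simps)

lemma vandermonde4_remove:
  assumes "finite I" "j \<in> I"
  shows "vandermonde4 I t = vandermonde4 (I - {j}) t * (\<Prod>k\<in>I - {j}. (t j - t k)\<^sup>2)\<^sup>2"
proof -
  have "(\<Prod>k\<in>I - {i}. (t i - t k)\<^sup>2) = (\<Prod>k\<in>I - {j} - {i}. (t i - t k)\<^sup>2) * (t j - t i)\<^sup>2"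
    if "i \<in> I - {j}" for i
  proof -
    have "I - {i} - {j} = I - {j} - {i}" by auto
    then show ?thesis
      using assms that prod.remove[of "I - {i}" j "\<lambda>k. (t i - t k)\<^sup>2"]
      by (simp add: power2_commute mult.commute)
  qed
  then have "(\<Prod>i\<in>I - {j}. \<Prod>k\<in>I - {i}. (t i - t k)\<^sup>2)
      = (\<Prod>i\<in>I - {j}. (\<Prod>k\<in>I - {j} - {i}. (t i - t k)\<^sup>2) * (t j - t i)\<^sup>2)"
    by (intro prod.cong) auto
  also have "\<dots> = vandermonde4 (I - {j}) t * (\<Prod>i\<in>I - {j}. (t j - t i)\<^sup>2)"
    by (simp add: vandermonde4_def prod.distrib)
  finally show ?thesis
    using prod.remove[OF assms, of "\<lambda>i. \<Prod>k\<in>I - {i}. (t i - t k)\<^sup>2"]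
    by (simp add: vandermonde4_def power2_eq_square)
qed

text \<open>
The recursive structure behind both the interpolation formula and the evaluation of the weight integral: as a
function of one node, the weight is the square of the node polynomial of the remaining ones.
\<close>
lemma principal_weight_remove:
  assumes "finite I" "j \<in> I"
  shows "principal_weight I t = principal_weight (I - {j}) t * (poly (node_poly (I - {j}) t) (t j))\<^sup>2"
  using prod.remove[OF assms, of "\<lambda>j. (t j)\<^sup>2 * (1 - t j)\<^sup>2"]
  by (simp add: principal_weight_def vandermonde4_remove[OF assms] poly_node_poly power2_eq_square mult_ac)

lemma degree_double_nodes: "finite I \<Longrightarrow> degree (double_nodes I t) = 2 * card I"
proof -
  assume "finite I"
  have "degree (double_nodes I t) = (\<Sum>k\<in>I. degree ([:- t k, 1:]\<^sup>2))"
    unfolding double_nodes_def by (rule degree_prod_sum_eq) simp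
  then show ?thesis by (simp only: degree_linear_power) simp
qed

lemma lead_coeff_double_nodes: "lead_coeff (double_nodes I t) = 1"
  by (simp add: double_nodes_def lead_coeff_prod lead_coeff_power)

lemma degree_node_poly: "finite I \<Longrightarrow> degree (node_poly I t) = 2 * card I + 2"
proof -
  assume "finite I"
  moreover have "double_nodes I t \<noteq> 0" using lead_coeff_double_nodes[of I t] by auto
  ultimately show ?thesis
    unfolding node_poly_def by (subst degree_mult_eq) (simp_all add: degree_double_nodes)
qed

lemma lead_coeff_node_poly: "lead_coeff (node_poly I t) = -1"
  unfolding node_poly_def lead_coeff_mult lead_coeff_double_nodes by simp

lemma square_linear_dvd_iff:
  fixes D :: "real poly"
  shows "[:-a, 1:]\<^sup>2 dvd D \<longleftrightarrow> poly D a = 0 \<and> poly (pderiv D) a = 0"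
proof -
  define L :: "real poly" where "L = [:-a, 1:]"
  have L: "poly L a = 0" "pderiv L = 1" by (simp_all add: L_def pderiv_pCons)
  have root: "\<exists>E. F = L * E" if "poly F a = 0" for F :: "real poly"
    using that poly_eq_0_iff_dvd unfolding L_def dvd_def by blast
  have "L\<^sup>2 dvd D \<longleftrightarrow> poly D a = 0 \<and> poly (pderiv D) a = 0"
  proof
    assume "L\<^sup>2 dvd D"
    then obtain E where "D = L\<^sup>2 * E" by (rule dvdE)
    then have "D = L * (L * E)" by (simp add: power2_eq_square mult.assoc)
    then show "poly D a = 0 \<and> poly (pderiv D) a = 0"
      by (simp add: pderiv_mult L)
  next
    assume *: "poly D a = 0 \<and> poly (pderiv D) a = 0"
    then obtain E where E: "D = L * E" using root by blast
    with * have "poly E a = 0" by (simp add: pderiv_mult L)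
    then obtain F where "E = L * F" using root by blast
    with E show "L\<^sup>2 dvd D" by (simp add: power2_eq_square mult.assoc[symmetric])
  qed
  then show ?thesis by (simp add: L_def)
qed

lemma coprime_linear:
  fixes a b :: real
  assumes "a \<noteq> b"
  shows "coprime [:-a, 1:] [:-b, 1:]"
proof (rule coprimeI)
  fix c assume "c dvd [:-a, 1:]" "c dvd [:-b, 1:]"
  then have "c dvd [:-a, 1:] - [:-b, 1:]" by (rule dvd_diff)
  then have "c dvd [:b - a:]" by simp
  moreover have "is_unit [:b - a:]" using assms by (simp add: is_unit_triv)
  ultimately show "is_unit c" by (rule dvd_trans)
qed

lemma coprime_double_nodes:
  assumes "finite I" "a \<notin> t ` I"
  shows "coprime [:-a, 1:] (double_nodes I t)"
  unfolding double_nodes_def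
proof (rule prod_coprime_right)
  fix k assume "k \<in> I"
  then have "coprime [:-a, 1:] [:- t k, 1:]" using assms by (intro coprime_linear) auto
  then show "coprime [:-a, 1:] ([:- t k, 1:]\<^sup>2)" by (subst coprime_power_right_iff) auto
qed

text \<open>
Powers of distinct linear factors are coprime, so divisibility can be checked node by node.
\<close>
lemma double_nodes_dvd:
  assumes "finite I" "inj_on t I" "\<And>j. j \<in> I \<Longrightarrow> [:- t j, 1:]\<^sup>2 dvd D"
  shows "double_nodes I t dvd D"
  using assms
proof (induction I rule: finite_induct)
  case empty
  then show ?case by (simp add: double_nodes_def)
next
  case (insert j I)
  have "t j \<notin> t ` I" using insert.prems insert.hyps by auto
  then have "coprime ([:- t j, 1:]\<^sup>2) (double_nodes I t)"
    using coprime_double_nodes[OF insert.hyps(1)] by (subst coprime_power_left_iff) auto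
  moreover have "double_nodes (insert j I) t = [:- t j, 1:]\<^sup>2 * double_nodes I t"
    using insert.hyps by (simp add: double_nodes_def)
  ultimately show ?case
    using insert by (metis divides_mult inj_on_insert insertCI)
qed

text \<open>
Both sides, as polynomials in the evaluation point, have degree at most \<open>2 * card I + 1\<close> and agree at 0, at 1 and to
second order at each \<open>t j\<close>; the difference then has more zeros than its degree allows. Multiplying by
the weight has cleared all denominators of the usual Hermite basis polynomials.
\<close>
lemma hermite_interpolation:
  assumes I: "finite I" "inj_on t I" "\<And>j. j \<in> I \<Longrightarrow> t j \<noteq> 0 \<and> t j \<noteq> 1"
    and deg: "degree \<phi> \<le> 2 * card I + 1"
  shows "smult (principal_weight I t) \<phi> =
    smult (poly \<phi> 0 * ((\<Prod>j\<in>I. (1 - t j)\<^sup>2) * vandermonde4 I t)) ([:1, -1:] * double_nodes I t) +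
    smult (poly \<phi> 1 * ((\<Prod>j\<in>I. (t j)\<^sup>2) * vandermonde4 I t)) ([:0, 1:] * double_nodes I t) +
    (\<Sum>j\<in>I. smult (principal_weight (I - {j}) t) (node_poly (I - {j}) t *
       ([:- t j, 1:] * [:poly (pderiv \<phi>) (t j) * poly (node_poly (I - {j}) t) (t j)
            - poly \<phi> (t j) * poly (pderiv (node_poly (I - {j}) t)) (t j):]
        + [:poly \<phi> (t j) * poly (node_poly (I - {j}) t) (t j):])))"
    (is "?L = ?A + ?B + (\<Sum>j\<in>I. ?T j)")
proof -
  define D where "D = ?L - (?A + ?B + (\<Sum>j\<in>I. ?T j))"
  have degT: "degree (?T j) \<le> 2 * card I + 1" if "j \<in> I" for j
  proof -
    have c: "card I > 0" using that I(1) card_gt_0_iff by blast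
    have 1: "degree ([:- t j, 1:] * [:u:] + [:v:]) \<le> 1" for u v :: real
      by (intro degree_add_le) (auto intro!: order.trans[OF degree_mult_le])
    have "degree (node_poly (I - {j}) t) = 2 * card I"
      using I(1) that c by (simp add: degree_node_poly)
    then show ?thesis
      by (intro order.trans[OF degree_smult_le] order.trans[OF degree_mult_le])
        (use 1 in \<open>auto intro: add_mono\<close>)
  qed
  have dD: "degree D \<le> 2 * card I + 1"
  proof -
    have l: "degree ([:a, b:] * double_nodes I t) \<le> 2 * card I + 1" for a b
      by (rule order.trans[OF degree_mult_le])
        (use degree_double_nodes[OF I(1), of t] in \<open>auto intro!: order.trans[OF degree_pCons_le]\<close>)
    have "degree ?L \<le> 2 * card I + 1" "degree ?A \<le> 2 * card I + 1" "degree ?B \<le> 2 * card I + 1"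
      by (rule order.trans[OF degree_smult_le deg] order.trans[OF degree_smult_le l])+
    moreover have "degree (\<Sum>j\<in>I. ?T j) \<le> 2 * card I + 1"
      by (rule degree_sum_le[OF I(1)]) (rule degT)
    ultimately show ?thesis unfolding D_def by (intro degree_diff_le degree_add_le)
  qed
  have dn0: "poly (double_nodes J t) (t i) = 0 \<and> poly (pderiv (double_nodes J t)) (t i) = 0"
    if "finite J" "i \<in> J" for i J
  proof -
    have "[:- t i, 1:]\<^sup>2 dvd double_nodes J t"
      using that unfolding double_nodes_def by (meson dvd_prodI)
    then show ?thesis using square_linear_dvd_iff by blast
  qed
  have sq: "[:- t i, 1:]\<^sup>2 dvd D" if i: "i \<in> I" for i
  proof -
    let ?P = "node_poly (I - {i}) t"
    have AB: "[:- t i, 1:]\<^sup>2 dvd ?A + ?B"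
      using I(1) i unfolding double_nodes_def
      by (intro dvd_add dvd_smult dvd_mult) (meson dvd_prodI)+
    have off: "[:- t i, 1:]\<^sup>2 dvd ?T j" if "j \<in> I - {i}" for j
    proof -
      have "[:- t i, 1:]\<^sup>2 dvd double_nodes (I - {j}) t"
        using I(1) i that unfolding double_nodes_def
        by (metis DiffD1 DiffD2 DiffI dvd_prodI finite_Diff singletonD singletonI)
      then show ?thesis unfolding node_poly_def by (meson dvd_mult dvd_mult2 dvd_smult)
    qed
    have "[:- t i, 1:]\<^sup>2 dvd ?L - ?T i"
    proof -
      define L where "L = [:- t i, 1:]"
      have L: "poly L (t i) = 0" "pderiv L = 1" by (simp_all add: L_def pderiv_pCons)
      have "poly (?L - ?T i) (t i) = 0 \<and> poly (pderiv (?L - ?T i)) (t i) = 0"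
        unfolding L_def[symmetric]
        by (simp add: L pderiv_diff pderiv_smult pderiv_mult pderiv_add pderiv_pCons
          principal_weight_remove[OF I(1) i] del: mult_pCons_right) (simp add: power2_eq_square right_diff_distrib left_diff_distrib)
      then show ?thesis using square_linear_dvd_iff by blast
    qed
    moreover have "D = (?L - ?T i) - (?A + ?B) - (\<Sum>j\<in>I - {i}. ?T j)"
    proof -
      have "l - (a + b + (x + s)) = (l - x) - (a + b) - s" for l a b x s :: "real poly" by simp
      then show ?thesis unfolding D_def sum.remove[OF I(1) i] .
    qed
    moreover have "[:- t i, 1:]\<^sup>2 dvd (\<Sum>j\<in>I - {i}. ?T j)"
      by (rule dvd_sum) (rule off)
    ultimately show ?thesis
      using dvd_diff[OF dvd_diff[OF _ AB]] by simp
  qed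
  have D0: "poly D 0 = 0" and D1: "poly D 1 = 0"
    unfolding D_def
    by (simp_all add: poly_sum poly_node_poly poly_double_nodes principal_weight_def prod.distrib power2_commute)
  have "double_nodes I t dvd D" using double_nodes_dvd[OF I(1,2) sq] .
  moreover have "coprime [:0, 1:] (double_nodes I t)" "coprime [:-1, 1:] (double_nodes I t)"
    using coprime_double_nodes[OF I(1), of 0 t] coprime_double_nodes[OF I(1), of 1 t] I(3) by force+
  moreover have "[:0, 1:] dvd D" "[:-1, 1:] dvd D"
    using D0 D1 poly_eq_0_iff_dvd[of D 0] poly_eq_0_iff_dvd[of D 1] by simp_all
  moreover have "coprime [:0, 1:] [:-1, 1::real:]" using coprime_linear[of 0 1] by simp
  moreover from calculation have "coprime [:0, 1:] ([:-1, 1:] * double_nodes I t)"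
    unfolding coprime_mult_right_iff by blast
  ultimately have "[:0, 1:] * ([:-1, 1:] * double_nodes I t) dvd D"
    by (blast intro: divides_mult)
  moreover have "degree ([:0, 1:] * ([:-1, 1:] * double_nodes I t)) = 2 * card I + 2"
  proof -
    have nz: "double_nodes I t \<noteq> 0" using lead_coeff_double_nodes[of I t] by auto
    have "degree (a * (b * double_nodes I t)) = degree a + (degree b + degree (double_nodes I t))"
      if "a \<noteq> 0" "b \<noteq> 0" for a b
      using that nz by (simp add: degree_mult_eq)
    from this[of "[:0, 1:]" "[:-1, 1:]"] show ?thesis
      by (simp add: degree_double_nodes[OF I(1)] del: mult_pCons_left)
  qed
  ultimately have "D = 0" using dD by (metis Suc_n_not_le_n add_2_eq_Suc' Suc_eq_plus1 dvd_imp_degree_le order.trans)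
  then show ?thesis by (simp add: D_def)
qed

section \<open>Integration over the unit cube\<close>

abbreviation lborel_prod :: "nat set \<Rightarrow> (nat \<Rightarrow> real) measure" where
  "lborel_prod I \<equiv> Pi\<^sub>M I (\<lambda>_. lborel)"

abbreviation unit_box :: "nat set \<Rightarrow> (nat \<Rightarrow> real) set" where
  "unit_box I \<equiv> Pi\<^sub>E I (\<lambda>_. {0..1})"

interpretation lborel_prod: product_sigma_finite "\<lambda>_ :: nat. lborel :: real measure"
  by standard

text \<open>
A class of functions that is closed under the algebraic operations below and whose members are integrable over the
unit cube; every integrand of the development is a polynomial in the coordinates and belongs to it.
\<close>
definition cube_bounded :: "nat set \<Rightarrow> ((nat \<Rightarrow> real) \<Rightarrow> real) \<Rightarrow> bool" where
  "cube_bounded I f \<longleftrightarrow> f \<in> borel_measurable (lborel_prod I) \<and> (\<exists>B. \<forall>t\<in>unit_box I. \<bar>f t\<bar> \<le> B)"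

lemma cube_bounded_measurable: "cube_bounded I f \<Longrightarrow> f \<in> borel_measurable (lborel_prod I)" by (simp add: cube_bounded_def)

lemma cube_bounded_const [simp, intro]: "cube_bounded I (\<lambda>_. c)" by (auto simp: cube_bounded_def)

lemma cube_bounded_component [intro]: "j \<in> I \<Longrightarrow> cube_bounded I (\<lambda>t. t j)"
  unfolding cube_bounded_def by (auto intro!: exI[of _ 1] simp: PiE_iff)

lemma cube_bounded_add [intro]:
  assumes "cube_bounded I f" "cube_bounded I g"
  shows "cube_bounded I (\<lambda>t. f t + g t)"
proof -
  obtain B C where BC: "\<forall>t\<in>unit_box I. \<bar>f t\<bar> \<le> B" "\<forall>t\<in>unit_box I. \<bar>g t\<bar> \<le> C"
    using assms by (auto simp: cube_bounded_def)
  have "\<forall>t\<in>unit_box I. \<bar>f t + g t\<bar> \<le> B + C"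
    using BC by (auto intro!: order.trans[OF abs_triangle_ineq] add_mono)
  then show ?thesis using assms by (auto simp: cube_bounded_def)
qed

lemma cube_bounded_mult [intro]:
  assumes "cube_bounded I f" "cube_bounded I g"
  shows "cube_bounded I (\<lambda>t. f t * g t)"
proof -
  obtain B C where BC: "\<forall>t\<in>unit_box I. \<bar>f t\<bar> \<le> B" "\<forall>t\<in>unit_box I. \<bar>g t\<bar> \<le> C"
    using assms by (auto simp: cube_bounded_def)
  have "\<bar>f t * g t\<bar> \<le> \<bar>B\<bar> * \<bar>C\<bar>" if "t \<in> unit_box I" for t
    unfolding abs_mult using bspec[OF BC(1) that] bspec[OF BC(2) that] by (intro mult_mono) auto
  then show ?thesis using assms by (auto simp: cube_bounded_def)
qed

lemma cube_bounded_minus [intro]: "cube_bounded I f \<Longrightarrow> cube_bounded I (\<lambda>t. - f t)"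
  using cube_bounded_mult[OF cube_bounded_const[of I "-1"], of f] by simp

lemma cube_bounded_diff [intro]: "cube_bounded I f \<Longrightarrow> cube_bounded I g \<Longrightarrow> cube_bounded I (\<lambda>t. f t - g t)"
  using cube_bounded_add[OF _ cube_bounded_minus, of I f g] by simp

lemma cube_bounded_power [intro]: "cube_bounded I f \<Longrightarrow> cube_bounded I (\<lambda>t. f t ^ n)"
  by (induction n) auto

lemma cube_bounded_sum [intro]: "(\<And>k. k \<in> A \<Longrightarrow> cube_bounded I (f k)) \<Longrightarrow> cube_bounded I (\<lambda>t. \<Sum>k\<in>A. f k t)"
  by (induction A rule: infinite_finite_induct) auto

lemma cube_bounded_prod [intro]: "(\<And>k. k \<in> A \<Longrightarrow> cube_bounded I (f k)) \<Longrightarrow> cube_bounded I (\<lambda>t. \<Prod>k\<in>A. f k t)"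
  by (induction A rule: infinite_finite_induct) auto

definition cube_bounded_poly :: "nat set \<Rightarrow> ((nat \<Rightarrow> real) \<Rightarrow> real poly) \<Rightarrow> bool" where
  "cube_bounded_poly I R \<longleftrightarrow> (\<forall>i. cube_bounded I (\<lambda>t. coeff (R t) i)) \<and> (\<exists>d. \<forall>t. degree (R t) \<le> d)"

lemma cube_bounded_poly_eval [intro]:
  assumes "cube_bounded_poly I R" "cube_bounded I x"
  shows "cube_bounded I (\<lambda>t. poly (R t) (x t))"
proof -
  obtain d where d: "\<And>t. degree (R t) \<le> d" using assms(1) by (auto simp: cube_bounded_poly_def)
  have "poly (R t) (x t) = (\<Sum>i\<le>d. coeff (R t) i * x t ^ i)" for t
    unfolding poly_altdef using d[of t] by (intro sum.mono_neutral_left) (auto simp: coeff_eq_0)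
  then show ?thesis
    using assms by (auto simp: cube_bounded_poly_def intro!: cube_bounded_sum cube_bounded_mult cube_bounded_power)
qed

lemma cube_bounded_poly_const [simp, intro]: "cube_bounded_poly I (\<lambda>_. P)" by (auto simp: cube_bounded_poly_def)

lemma cube_bounded_poly_mult [intro]:
  assumes "cube_bounded_poly I R" "cube_bounded_poly I S"
  shows "cube_bounded_poly I (\<lambda>t. R t * S t)"
proof -
  obtain d e where "\<And>t. degree (R t) \<le> d" "\<And>t. degree (S t) \<le> e"
    using assms by (auto simp: cube_bounded_poly_def)
  then have "degree (R t * S t) \<le> d + e" for t
    by (meson add_mono degree_mult_le order.trans)
  moreover have "cube_bounded I (\<lambda>t. coeff (R t * S t) i)" for i
    unfolding coeff_mult using assms by (auto simp: cube_bounded_poly_def intro!: cube_bounded_sum cube_bounded_mult)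
  ultimately show ?thesis by (auto simp: cube_bounded_poly_def)
qed

lemma cube_bounded_poly_pCons [intro]:
  assumes "cube_bounded I a" "cube_bounded_poly I R"
  shows "cube_bounded_poly I (\<lambda>t. pCons (a t) (R t))"
proof -
  obtain d where d: "\<And>t. degree (R t) \<le> d" using assms by (auto simp: cube_bounded_poly_def)
  have "degree (pCons (a t) (R t)) \<le> Suc d" for t
    using degree_pCons_le[of "a t" "R t"] d[of t] by simp
  moreover have "cube_bounded I (\<lambda>t. coeff (pCons (a t) (R t)) i)" for i
    using assms by (cases i) (auto simp: cube_bounded_poly_def)
  ultimately show ?thesis unfolding cube_bounded_poly_def by blast
qed

lemma cube_bounded_poly_prod [intro]: "(\<And>k. k \<in> A \<Longrightarrow> cube_bounded_poly I (R k)) \<Longrightarrow> cube_bounded_poly I (\<lambda>t. \<Prod>k\<in>A. R k t)"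
  by (induction A rule: infinite_finite_induct) auto

lemma cube_bounded_poly_pderiv [intro]:
  assumes "cube_bounded_poly I R"
  shows "cube_bounded_poly I (\<lambda>t. pderiv (R t))"
proof -
  obtain d where d: "\<And>t. degree (R t) \<le> d" using assms by (auto simp: cube_bounded_poly_def)
  have "degree (pderiv (R t)) \<le> d" for t
    unfolding degree_pderiv by (rule order.trans[OF diff_le_self d])
  moreover have "cube_bounded I (\<lambda>t. coeff (pderiv (R t)) i)" for i
    unfolding coeff_pderiv using assms by (auto simp: cube_bounded_poly_def)
  ultimately show ?thesis by (auto simp: cube_bounded_poly_def)
qed

lemma cube_bounded_double_nodes [intro]: "J \<subseteq> I \<Longrightarrow> cube_bounded_poly I (double_nodes J)"
  unfolding double_nodes_def[abs_def] power2_eq_square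
  by (intro cube_bounded_poly_prod cube_bounded_poly_mult cube_bounded_poly_pCons cube_bounded_poly_const cube_bounded_minus cube_bounded_component cube_bounded_const) auto

lemma cube_bounded_node_poly [intro]: "J \<subseteq> I \<Longrightarrow> cube_bounded_poly I (node_poly J)"
  unfolding node_poly_def[abs_def] by (intro cube_bounded_poly_mult cube_bounded_poly_const cube_bounded_double_nodes)

lemma cube_bounded_vandermonde4 [intro]: "J \<subseteq> I \<Longrightarrow> cube_bounded I (vandermonde4 J)"
  unfolding vandermonde4_def[abs_def] by (auto intro!: cube_bounded_prod cube_bounded_power cube_bounded_diff)

lemma cube_bounded_principal_weight [intro]: "J \<subseteq> I \<Longrightarrow> cube_bounded I (principal_weight J)"
  unfolding principal_weight_def[abs_def] by (auto intro!: cube_bounded_mult cube_bounded_prod cube_bounded_power cube_bounded_diff)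

definition cube_integral :: "nat set \<Rightarrow> ((nat \<Rightarrow> real) \<Rightarrow> real) \<Rightarrow> real" where
  "cube_integral I f = (LINT t:unit_box I|lborel_prod I. f t)"

lemma cube_sets [measurable]: "finite I \<Longrightarrow> unit_box I \<in> sets (lborel_prod I)"
  by (intro sets_PiM_I_finite) auto

lemma emeasure_cube: "finite I \<Longrightarrow> emeasure (lborel_prod I) (unit_box I) = 1"
  by (subst lborel_prod.emeasure_PiM) auto

lemma cube_bounded_set_integrable:
  assumes "finite I" "cube_bounded I f"
  shows "set_integrable (lborel_prod I) (unit_box I) f"
proof -
  obtain B where B: "\<forall>t\<in>unit_box I. \<bar>f t\<bar> \<le> B" using assms by (auto simp: cube_bounded_def)
  have "integrable (lborel_prod I) (\<lambda>t. indicator (unit_box I) t *\<^sub>R f t)"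
  proof (rule integrableI_bounded_set[where A="unit_box I" and B=B])
    show "emeasure (lborel_prod I) (unit_box I) < \<infinity>" using assms by (simp add: emeasure_cube)
    show "(\<lambda>t. indicator (unit_box I) t *\<^sub>R f t) \<in> borel_measurable (lborel_prod I)"
      using assms cube_bounded_measurable[OF assms(2)] by (intro borel_measurable_scaleR borel_measurable_indicator) auto
  qed (use assms B in \<open>auto simp: indicator_def\<close>)
  then show ?thesis by (simp add: set_integrable_def)
qed

lemma cube_integral_add: "finite I \<Longrightarrow> cube_bounded I f \<Longrightarrow> cube_bounded I g \<Longrightarrow> cube_integral I (\<lambda>t. f t + g t) = cube_integral I f + cube_integral I g"
  unfolding cube_integral_def by (intro set_integral_add cube_bounded_set_integrable)

lemma cube_integral_diff: "finite I \<Longrightarrow> cube_bounded I f \<Longrightarrow> cube_bounded I g \<Longrightarrow> cube_integral I (\<lambda>t. f t - g t) = cube_integral I f - cube_integral I g"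
  unfolding cube_integral_def by (intro set_integral_diff cube_bounded_set_integrable)

lemma cube_integral_cmult: "cube_integral I (\<lambda>t. c * f t) = c * cube_integral I f"
  unfolding cube_integral_def by simp

lemma cube_integral_sum:
  assumes "finite I" "\<And>k. k \<in> A \<Longrightarrow> cube_bounded I (f k)"
  shows "cube_integral I (\<lambda>t. \<Sum>k\<in>A. f k t) = (\<Sum>k\<in>A. cube_integral I (f k))"
  using assms(2)
proof (induction A rule: infinite_finite_induct)
  case (insert x F)
  then show ?case using assms(1) by (simp add: cube_integral_add cube_bounded_sum)
qed (simp_all add: cube_integral_def)

lemma cube_integral_fubini:
  assumes I: "finite I" "j \<notin> I" and f: "cube_bounded (insert j I) f"
  shows "cube_integral (insert j I) f = cube_integral I (\<lambda>t. LINT x:{0..1}|lborel. f (t(j := x)))"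
proof -
  have ind: "indicator (unit_box (insert j I)) (t(j := x)) = indicator (unit_box I) t * (indicator {0..1} x :: real)"
    if "t \<in> space (lborel_prod I)" for t x
    using that I by (auto simp: indicator_def space_PiM PiE_iff extensional_def fun_upd_def)
  have "cube_integral (insert j I) f = (LINT t|lborel_prod I. LINT x|lborel. indicator (unit_box (insert j I)) (t(j := x)) *\<^sub>R f (t(j := x)))"
    unfolding cube_integral_def set_lebesgue_integral_def
    using cube_bounded_set_integrable[OF _ f] I by (intro lborel_prod.product_integral_insert) (auto simp: set_integrable_def)
  also have "\<dots> = cube_integral I (\<lambda>t. LINT x:{0..1}|lborel. f (t(j := x)))"
    unfolding cube_integral_def set_lebesgue_integral_def
    by (intro Bochner_Integration.integral_cong refl) (simp add: ind mult.assoc)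
  finally show ?thesis .
qed

lemma lborel_integral_pderiv:
  fixes P :: "real poly"
  shows "(LINT x:{0..1}|lborel. poly (pderiv P) x) = poly P 1 - poly P 0"
  unfolding set_lebesgue_integral_def real_scaleR_def
  using integral_FTC_Icc_real[of 0 1 "poly P" "poly (pderiv P)"]
  by (simp add: poly_DERIV mult.commute)

text \<open>
The form of integration by parts that is needed: a derivative in one coordinate
integrates to 0 as soon as the function vanishes on the two faces.
\<close>
lemma cube_integral_boundary:
  assumes I: "finite I" "j \<in> I"
    and c: "cube_bounded I c" "\<And>t x. c (t(j := x)) = c t"
    and R: "cube_bounded_poly I R" "\<And>t x. R (t(j := x)) = R t" "\<And>t. poly (R t) 0 = 0" "\<And>t. poly (R t) 1 = 0"
  shows "cube_integral I (\<lambda>t. c t * poly (pderiv (R t)) (t j)) = 0"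
proof -
  have e: "I = insert j (I - {j})" using I by auto
  have "cube_bounded I (\<lambda>t. c t * poly (pderiv (R t)) (t j))" using I c(1) R(1)
    by (intro cube_bounded_mult cube_bounded_poly_eval cube_bounded_poly_pderiv cube_bounded_component)
  then have "cube_integral I (\<lambda>t. c t * poly (pderiv (R t)) (t j))
      = cube_integral (I - {j}) (\<lambda>t. LINT x:{0..1}|lborel. c t * poly (pderiv (R t)) x)"
    using cube_integral_fubini[of "I - {j}" j "\<lambda>t. c t * poly (pderiv (R t)) (t j)"] I e by (simp add: c(2) R(2))
  also have "\<dots> = 0" by (simp add: lborel_integral_pderiv R cube_integral_def)
  finally show ?thesis .
qed

text \<open>
The interpolation formula requires nodes different from 0 and 1. The exceptional nodes form a null set.
\<close>
lemma AE_component_neq: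
  assumes "finite I"
  shows "AE t in lborel_prod I. \<forall>j\<in>I. t j \<noteq> a"
  unfolding AE_finite_all[OF assms]
proof
  fix j assume j: "j \<in> I"
  let ?N = "Pi\<^sub>E I (\<lambda>i. if i = j then {a} else UNIV) :: (nat \<Rightarrow> real) set"
  have "emeasure (lborel_prod I) ?N = (\<Prod>i\<in>I. emeasure lborel (if i = j then {a} else UNIV))"
    using assms by (intro lborel_prod.emeasure_PiM) auto
  also have "\<dots> = 0" using assms j by (intro prod_zero) (auto intro!: bexI[of _ j])
  finally have "?N \<in> null_sets (lborel_prod I)" using assms by (intro null_setsI sets_PiM_I_finite) auto
  then show "AE t in lborel_prod I. t j \<noteq> a"
    by (rule AE_I') (auto simp: space_PiM PiE_iff extensional_def)
qed

lemma cube_integral_cong_AE: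
  assumes "finite I" "cube_bounded I f" "cube_bounded I g" "\<And>t. (\<forall>j\<in>I. t j \<noteq> 0 \<and> t j \<noteq> 1) \<Longrightarrow> f t = g t"
  shows "cube_integral I f = cube_integral I g"
  unfolding cube_integral_def set_lebesgue_integral_def
proof (rule integral_cong_AE)
  show "AE t in lborel_prod I. indicator (unit_box I) t *\<^sub>R f t = indicator (unit_box I) t *\<^sub>R g t"
    using AE_component_neq[OF assms(1), of 0] AE_component_neq[OF assms(1), of 1]
    by eventually_elim (use assms(4) in auto)
qed (use cube_bounded_set_integrable[OF assms(1)] assms in \<open>auto simp: set_integrable_def dest: borel_measurable_integrable\<close>)

section \<open>The reproducing identity up to a constant\<close>

lemma vandermonde4_eq_0:
  assumes "finite I" "i \<in> I" "i' \<in> I" "i \<noteq> i'" "t i = t i'"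
  shows "vandermonde4 I t = 0"
proof -
  have z: "(\<Prod>k\<in>I - {i}. (t i - t k)\<^sup>2) = 0"
    using assms by (subst prod_zero_iff) (auto intro!: bexI[of _ i'])
  show ?thesis
    unfolding vandermonde4_def prod_zero_iff[OF assms(1)] by (rule bexI[where x = i]) (rule z, rule assms(2))
qed

text \<open>
If two nodes coincide, every term of the interpolation formula vanishes: either the Vandermonde
factor of the remaining nodes is 0, or the remaining node polynomial has a double zero. Hence the formula, proved for distinct
nodes, persists.
\<close>
lemma collision_vanish:
  assumes "finite I" "\<not> inj_on t I" "j \<in> I"
  shows "principal_weight (I - {j}) t * poly (node_poly (I - {j}) t) (t j) = 0"
    and "principal_weight (I - {j}) t * poly (pderiv (node_poly (I - {j}) t)) (t j) = 0"
    and "vandermonde4 I t = 0"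
proof -
  obtain i i' where i: "i \<in> I" "i' \<in> I" "i \<noteq> i'" "t i = t i'"
    using assms(2) by (auto simp: inj_on_def)
  show "vandermonde4 I t = 0" using vandermonde4_eq_0[OF assms(1) i] .
  have "principal_weight (I - {j}) t = 0 \<or> (\<exists>k\<in>I - {j}. t k = t j)"
  proof (cases "j = i \<or> j = i'")
    case True
    then show ?thesis using i by (metis DiffI singletonD)
  next
    case False
    then have "vandermonde4 (I - {j}) t = 0" using i assms(1) by (intro vandermonde4_eq_0[of _ i i']) auto
    then show ?thesis by (simp add: principal_weight_def)
  qed
  moreover have "poly (node_poly (I - {j}) t) (t j) = 0 \<and> poly (pderiv (node_poly (I - {j}) t)) (t j) = 0"
    if "k \<in> I - {j}" "t k = t j" for k
  proof -
    have "[:- t k, 1:]\<^sup>2 dvd double_nodes (I - {j}) t"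
      using that(1) assms(1) unfolding double_nodes_def by (intro dvd_prodI) auto
    then have "[:- t k, 1:]\<^sup>2 dvd node_poly (I - {j}) t" unfolding node_poly_def by (rule dvd_mult)
    then show ?thesis using that(2) square_linear_dvd_iff by metis
  qed
  ultimately show "principal_weight (I - {j}) t * poly (node_poly (I - {j}) t) (t j) = 0"
    and "principal_weight (I - {j}) t * poly (pderiv (node_poly (I - {j}) t)) (t j) = 0" by auto
qed

definition kernel_with_0 :: "nat set \<Rightarrow> real \<Rightarrow> (nat \<Rightarrow> real) \<Rightarrow> real" where
  "kernel_with_0 I s t = s * (\<Prod>j\<in>I. (s - t j)\<^sup>2) * (\<Prod>j\<in>I. (t j)\<^sup>2) * vandermonde4 I t"

definition kernel_with_1 :: "nat set \<Rightarrow> real \<Rightarrow> (nat \<Rightarrow> real) \<Rightarrow> real" where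
  "kernel_with_1 I s t = (1 - s) * (\<Prod>j\<in>I. (s - t j)\<^sup>2) * (\<Prod>j\<in>I. (1 - t j)\<^sup>2) * vandermonde4 I t"

text \<open>
The coefficient of \<open>\<phi>' (t j)\<close> in the interpolation formula.
\<close>
definition deriv_kernel :: "nat set \<Rightarrow> nat \<Rightarrow> real \<Rightarrow> (nat \<Rightarrow> real) \<Rightarrow> real" where
  "deriv_kernel I j s t = principal_weight (I - {j}) t * poly (node_poly (I - {j}) t) s
     * ((s - t j) * poly (node_poly (I - {j}) t) (t j))"

text \<open>
The coefficient of \<open>\<phi> (t j)\<close> in the interpolation formula; it is minus the derivative of \<open>deriv_kernel\<close> with
respect to the node \<open>t j\<close>.
\<close>
definition value_kernel :: "nat set \<Rightarrow> nat \<Rightarrow> real \<Rightarrow> (nat \<Rightarrow> real) \<Rightarrow> real" where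
  "value_kernel I j s t = principal_weight (I - {j}) t * poly (node_poly (I - {j}) t) s
     * (poly (node_poly (I - {j}) t) (t j) - (s - t j) * poly (pderiv (node_poly (I - {j}) t)) (t j))"

lemma hermite_pointwise:
  assumes I: "finite I" "\<forall>j\<in>I. t j \<noteq> 0 \<and> t j \<noteq> 1"
    and deg: "degree \<phi> \<le> 2 * card I + 1"
  shows "principal_weight I t * poly \<phi> s = poly \<phi> 0 * kernel_with_1 I s t + poly \<phi> 1 * kernel_with_0 I s t
      + (\<Sum>j\<in>I. value_kernel I j s t * poly \<phi> (t j) + deriv_kernel I j s t * poly (pderiv \<phi>) (t j))"
proof (cases "inj_on t I")
  case True
  note H = hermite_interpolation[OF I(1) True _ deg]
  have "poly (smult (principal_weight I t) \<phi>) s = poly \<phi> 0 * kernel_with_1 I s t + poly \<phi> 1 * kernel_with_0 I s t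
      + (\<Sum>j\<in>I. value_kernel I j s t * poly \<phi> (t j) + deriv_kernel I j s t * poly (pderiv \<phi>) (t j))"
    apply (subst H)
    subgoal using I(2) by blast
    unfolding poly_add poly_smult poly_sum poly_mult poly_double_nodes
  proof (intro arg_cong2[where f="(+)"] sum.cong refl, goal_cases)
    case (3 j)
    then show ?case by (simp add: value_kernel_def deriv_kernel_def algebra_simps)
  qed (simp_all add: kernel_with_1_def kernel_with_0_def)
  then show ?thesis by simp
next
  case False
  have "value_kernel I j s t = 0" "deriv_kernel I j s t = 0" if "j \<in> I" for j
    using collision_vanish[OF I(1) False that] by (auto simp: value_kernel_def deriv_kernel_def)
  moreover have "I \<noteq> {}" using False by auto
  then have "vandermonde4 I t = 0" using collision_vanish(3)[OF I(1) False] by blast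
  ultimately show ?thesis by (simp add: principal_weight_def kernel_with_1_def kernel_with_0_def)
qed

text \<open>
The interpolation formula compared in the top coefficient of the evaluation point, where it no longer depends on that point.
\<close>
lemma hermite_lead_coeff:
  assumes I: "finite I" "\<forall>j\<in>I. t j \<noteq> 0 \<and> t j \<noteq> 1" "I \<noteq> {}"
    and \<phi>: "degree \<phi> \<le> 2 * card I + 1" "poly \<phi> 0 = 0" "poly \<phi> 1 = 0"
  shows "coeff \<phi> (2 * card I + 1) * principal_weight I t = (\<Sum>j\<in>I. principal_weight (I - {j}) t *
      (poly \<phi> (t j) * poly (pderiv (node_poly (I - {j}) t)) (t j)
        - poly (pderiv \<phi>) (t j) * poly (node_poly (I - {j}) t) (t j)))"
proof (cases "inj_on t I")
  case True
  have top: "coeff (smult a (node_poly (I - {j}) t * ([:b, 1:] * [:u:] + [:v:]))) (2 * card I + 1) = - (a * u)"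
    if "j \<in> I" for j a b u v
  proof -
    have "card I > 0" using that I(1) card_gt_0_iff by blast
    then have d: "degree (node_poly (I - {j}) t) = 2 * card I"
      using degree_node_poly[of "I - {j}" t] I(1) that by simp
    have l: "[:b, 1:] * [:u:] + [:v:] = [:b * u + v, u:]" by simp
    show ?thesis unfolding l
      using lead_coeff_node_poly[of "I - {j}" t] by (simp add: d coeff_eq_0)
  qed
  have "coeff (smult (principal_weight I t) \<phi>) (2 * card I + 1) = (\<Sum>j\<in>I. principal_weight (I - {j}) t *
      (poly \<phi> (t j) * poly (pderiv (node_poly (I - {j}) t)) (t j)
        - poly (pderiv \<phi>) (t j) * poly (node_poly (I - {j}) t) (t j)))"
    apply (subst hermite_interpolation[OF I(1) True _ \<phi>(1)])
    subgoal using I(2) by blast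
    unfolding coeff_add coeff_sum \<phi>(2,3)
    by (simp only: mult_zero_left smult_0_left coeff_0 add_0_left)
       (intro sum.cong refl, subst top, simp_all add: algebra_simps)
  then show ?thesis by (simp add: mult.commute)
next
  case False
  have z: "principal_weight (I - {j}) t *
      (poly \<phi> (t j) * poly (pderiv (node_poly (I - {j}) t)) (t j)
        - poly (pderiv \<phi>) (t j) * poly (node_poly (I - {j}) t) (t j)) = 0" if "j \<in> I" for j
    using collision_vanish[OF I(1) False that] by auto
  have "vandermonde4 I t = 0" using collision_vanish(3)[OF I(1) False] I(3) by blast
  then have "principal_weight I t = 0" by (simp add: principal_weight_def)
  then show ?thesis by (simp only: mult_zero_right) (rule sum.neutral[symmetric], use z in blast)
qed

lemma vandermonde4_update: "j \<notin> J \<Longrightarrow> vandermonde4 J (t(j := x)) = vandermonde4 J t"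
  unfolding vandermonde4_def by (intro prod.cong refl) (auto intro!: prod.cong)

lemma principal_weight_update: "j \<notin> J \<Longrightarrow> principal_weight J (t(j := x)) = principal_weight J t"
  unfolding principal_weight_def by (auto simp: vandermonde4_update intro!: prod.cong arg_cong2[where f="(*)"])

lemma node_poly_update: "j \<notin> J \<Longrightarrow> node_poly J (t(j := x)) = node_poly J t"
proof -
  assume "j \<notin> J"
  then have "double_nodes J (t(j := x)) = double_nodes J t"
    unfolding double_nodes_def by (intro prod.cong) auto
  then show ?thesis by (simp only: node_poly_def)
qed

lemma poly_node_poly_01 [simp]: "poly (node_poly J t) 0 = 0" "poly (node_poly J t) 1 = 0"
  by (simp_all add: poly_node_poly)

lemmas cube_bounded_intros = cube_bounded_mult cube_bounded_add cube_bounded_diff cube_bounded_sum cube_bounded_power cube_bounded_poly_eval cube_bounded_poly_pderiv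
  cube_bounded_node_poly cube_bounded_principal_weight cube_bounded_component cube_bounded_const cube_bounded_poly_const cube_bounded_prod cube_bounded_vandermonde4

lemma cube_bounded_value_kernel: "finite I \<Longrightarrow> j \<in> I \<Longrightarrow> cube_bounded I (value_kernel I j s)"
  unfolding value_kernel_def[abs_def] by (intro cube_bounded_intros) auto

lemma cube_bounded_deriv_kernel: "finite I \<Longrightarrow> j \<in> I \<Longrightarrow> cube_bounded I (deriv_kernel I j s)"
  unfolding deriv_kernel_def[abs_def] by (intro cube_bounded_intros) auto

lemma cube_bounded_kernel_with_0: "cube_bounded I (kernel_with_0 I s)"
  unfolding kernel_with_0_def[abs_def] by (intro cube_bounded_intros) auto

lemma cube_bounded_kernel_with_1: "cube_bounded I (kernel_with_1 I s)"
  unfolding kernel_with_1_def[abs_def] by (intro cube_bounded_intros) auto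

text \<open>
Here \<open>\<phi> (t i)\<close> is constant in the coordinate \<open>t j\<close>, so the integrand is a derivative in this coordinate.
\<close>
lemma cube_integral_value_kernel_other:
  assumes I: "finite I" "j \<in> I" "i \<in> I" "i \<noteq> j"
  shows "cube_integral I (\<lambda>t. value_kernel I j s t * poly \<phi> (t i)) = 0"
proof -
  let ?c = "\<lambda>t. - principal_weight (I - {j}) t * poly (node_poly (I - {j}) t) s * poly \<phi> (t i)"
  let ?R = "\<lambda>t. [:s, -1:] * node_poly (I - {j}) t"
  have "cube_integral I (\<lambda>t. ?c t * poly (pderiv (?R t)) (t j)) = 0"
  proof (rule cube_integral_boundary[OF I(1,2)])
    show "cube_bounded I ?c" using I by (intro cube_bounded_intros cube_bounded_minus) auto
    show "cube_bounded_poly I ?R" by (intro cube_bounded_poly_mult cube_bounded_poly_const cube_bounded_node_poly) auto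
  qed (use I in \<open>simp_all add: principal_weight_update node_poly_update del: mult_pCons_left\<close>)
  moreover have "?c t * poly (pderiv (?R t)) (t j) = value_kernel I j s t * poly \<phi> (t i)" for t
    unfolding pderiv_mult by (simp add: value_kernel_def pderiv_pCons algebra_simps)
  ultimately show ?thesis by simp
qed

text \<open>
Integration by parts in \<open>t j\<close>: the difference of the two integrands is minus the derivative of \<open>deriv_kernel * \<phi> (t j)\<close>.
\<close>
lemma cube_integral_value_kernel_self:
  assumes I: "finite I" "j \<in> I"
  shows "cube_integral I (\<lambda>t. value_kernel I j s t * poly \<phi> (t j)) = cube_integral I (\<lambda>t. deriv_kernel I j s t * poly (pderiv \<phi>) (t j))"
proof -
  let ?c = "\<lambda>t. - principal_weight (I - {j}) t * poly (node_poly (I - {j}) t) s"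
  let ?R = "\<lambda>t. [:s, -1:] * (node_poly (I - {j}) t * \<phi>)"
  have "cube_integral I (\<lambda>t. ?c t * poly (pderiv (?R t)) (t j)) = 0"
  proof (rule cube_integral_boundary[OF I(1,2)])
    show "cube_bounded I ?c" using I by (intro cube_bounded_intros cube_bounded_minus) auto
    show "cube_bounded_poly I ?R" by (intro cube_bounded_poly_mult cube_bounded_poly_const cube_bounded_node_poly) auto
  qed (use I in \<open>simp_all add: principal_weight_update node_poly_update del: mult_pCons_left\<close>)
  moreover have "?c t * poly (pderiv (?R t)) (t j)
      = value_kernel I j s t * poly \<phi> (t j) - deriv_kernel I j s t * poly (pderiv \<phi>) (t j)" for t
    unfolding pderiv_mult by (simp add: value_kernel_def deriv_kernel_def pderiv_pCons algebra_simps)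
  ultimately have "cube_integral I (\<lambda>t. value_kernel I j s t * poly \<phi> (t j) - deriv_kernel I j s t * poly (pderiv \<phi>) (t j)) = 0"
    by simp
  moreover have "cube_bounded I (\<lambda>t. value_kernel I j s t * poly \<phi> (t j))" "cube_bounded I (\<lambda>t. deriv_kernel I j s t * poly (pderiv \<phi>) (t j))"
    using I by (intro cube_bounded_intros cube_bounded_value_kernel cube_bounded_deriv_kernel; simp)+
  ultimately show ?thesis using cube_integral_diff[OF I(1)] by simp
qed

text \<open>
By the interpolation formula for \<open>\<phi> = 1\<close> the kernel is the sum of the \<open>value_kernel\<close>. Integration
by parts turns its integral against \<open>\<Sum>i. \<phi> (t i)\<close> into \<open>S = \<Sum>i. \<integral> deriv_kernel i * \<phi>' (t i)\<close>, and the interpolation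
formula for \<open>\<phi>\<close> gives \<open>\<phi> s * \<integral> W = 2 * S\<close>, since value and derivative terms contribute equally.
\<close>
theorem reproducing_identity:
  assumes I: "finite I"
    and \<phi>: "degree \<phi> \<le> 2 * card I + 1" "poly \<phi> 0 = 0" "poly \<phi> 1 = 0"
  shows "cube_integral I (\<lambda>t. (principal_weight I t - kernel_with_0 I s t - kernel_with_1 I s t) * (\<Sum>i\<in>I. poly \<phi> (t i)))
    = poly \<phi> s / 2 * cube_integral I (principal_weight I)"
proof -
  have na: "cube_bounded I (\<lambda>t. value_kernel I k s t * poly \<psi> (t i))" and nb: "cube_bounded I (\<lambda>t. deriv_kernel I k s t * poly \<psi> (t i))"
    if "k \<in> I" "i \<in> I" for k i \<psi>
    using I that by (intro cube_bounded_intros cube_bounded_value_kernel cube_bounded_deriv_kernel; simp)+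
  have n1: "cube_bounded I (\<lambda>t. (principal_weight I t - kernel_with_0 I s t - kernel_with_1 I s t) * (\<Sum>i\<in>I. poly \<phi> (t i)))"
    by (intro cube_bounded_intros cube_bounded_kernel_with_0 cube_bounded_kernel_with_1) auto
  have n2: "cube_bounded I (\<lambda>t. \<Sum>i\<in>I. \<Sum>k\<in>I. value_kernel I k s t * poly \<phi> (t i))"
    by (intro cube_bounded_sum na)
  have "cube_integral I (\<lambda>t. (principal_weight I t - kernel_with_0 I s t - kernel_with_1 I s t) * (\<Sum>i\<in>I. poly \<phi> (t i)))
      = cube_integral I (\<lambda>t. \<Sum>i\<in>I. \<Sum>k\<in>I. value_kernel I k s t * poly \<phi> (t i))"
  proof (rule cube_integral_cong_AE[OF I n1 n2])
    fix t :: "nat \<Rightarrow> real" assume t: "\<forall>j\<in>I. t j \<noteq> 0 \<and> t j \<noteq> 1"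
    have "principal_weight I t - kernel_with_0 I s t - kernel_with_1 I s t = (\<Sum>k\<in>I. value_kernel I k s t)"
      using hermite_pointwise[OF I t, of 1 s] by (simp add: pderiv_1)
    then show "(principal_weight I t - kernel_with_0 I s t - kernel_with_1 I s t) * (\<Sum>i\<in>I. poly \<phi> (t i))
        = (\<Sum>i\<in>I. \<Sum>k\<in>I. value_kernel I k s t * poly \<phi> (t i))"
      by (simp add: sum_product) (rule sum.swap)
  qed
  also have "\<dots> = (\<Sum>i\<in>I. cube_integral I (\<lambda>t. \<Sum>k\<in>I. value_kernel I k s t * poly \<phi> (t i)))"
    by (intro cube_integral_sum I cube_bounded_sum na)
  also have "\<dots> = (\<Sum>i\<in>I. \<Sum>k\<in>I. cube_integral I (\<lambda>t. value_kernel I k s t * poly \<phi> (t i)))"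
    by (intro sum.cong refl cube_integral_sum I na)
  also have "\<dots> = (\<Sum>i\<in>I. cube_integral I (\<lambda>t. deriv_kernel I i s t * poly (pderiv \<phi>) (t i)))"
  proof (rule sum.cong[OF refl])
    fix i assume i: "i \<in> I"
    have "(\<Sum>k\<in>I. cube_integral I (\<lambda>t. value_kernel I k s t * poly \<phi> (t i))) = (\<Sum>k\<in>I. if k = i then cube_integral I (\<lambda>t. deriv_kernel I i s t * poly (pderiv \<phi>) (t i)) else 0)"
      using I i by (intro sum.cong refl) (auto simp: cube_integral_value_kernel_other cube_integral_value_kernel_self)
    then show "(\<Sum>k\<in>I. cube_integral I (\<lambda>t. value_kernel I k s t * poly \<phi> (t i))) = cube_integral I (\<lambda>t. deriv_kernel I i s t * poly (pderiv \<phi>) (t i))"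
      using I i by simp
  qed
  finally have 1: "cube_integral I (\<lambda>t. (principal_weight I t - kernel_with_0 I s t - kernel_with_1 I s t) * (\<Sum>i\<in>I. poly \<phi> (t i)))
    = (\<Sum>i\<in>I. cube_integral I (\<lambda>t. deriv_kernel I i s t * poly (pderiv \<phi>) (t i)))" .
  have "poly \<phi> s * cube_integral I (principal_weight I) = cube_integral I (\<lambda>t. poly \<phi> s * principal_weight I t)" by (simp add: cube_integral_cmult)
  also have "\<dots> = cube_integral I (\<lambda>t. \<Sum>i\<in>I. value_kernel I i s t * poly \<phi> (t i) + deriv_kernel I i s t * poly (pderiv \<phi>) (t i))"
    by (rule cube_integral_cong_AE[OF I])
      (use hermite_pointwise[OF I _ \<phi>(1), of _ s] \<phi>(2,3) in \<open>auto intro!: cube_bounded_intros na nb cube_bounded_value_kernel cube_bounded_deriv_kernel I simp: mult.commute\<close>)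
  also have "\<dots> = (\<Sum>i\<in>I. cube_integral I (\<lambda>t. value_kernel I i s t * poly \<phi> (t i)) + cube_integral I (\<lambda>t. deriv_kernel I i s t * poly (pderiv \<phi>) (t i)))"
    using I na nb by (subst cube_integral_sum) (auto simp: cube_integral_add intro!: cube_bounded_add)
  also have "\<dots> = 2 * (\<Sum>i\<in>I. cube_integral I (\<lambda>t. deriv_kernel I i s t * poly (pderiv \<phi>) (t i)))"
    using I by (simp add: cube_integral_value_kernel_self sum_distrib_left)
  finally show ?thesis using 1 by simp
qed

section \<open>A Selberg integral\<close>

definition poly_integral :: "real poly \<Rightarrow> real" where
  "poly_integral P = (LINT x:{0..1}|lborel. poly P x)"

lemma poly_integral_add: "poly_integral (P + Q) = poly_integral P + poly_integral Q"
proof -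
  have "set_integrable lborel {0..1} (poly P)" for P :: "real poly"
    by (rule borel_integrable_atLeastAtMost') (intro continuous_intros)
  from set_integral_add(2)[OF this this, of P Q] show ?thesis by (simp add: poly_integral_def)
qed

lemma poly_integral_smult: "poly_integral (smult c P) = c * poly_integral P"
  by (simp add: poly_integral_def)

lemma poly_integral_pderiv: "poly_integral (pderiv P) = poly P 1 - poly P 0"
  unfolding poly_integral_def by (rule lborel_integral_pderiv)

lemma poly_integral_parts:
  assumes "poly (F * G) 0 = 0" "poly (F * G) 1 = 0"
  shows "poly_integral (pderiv F * G) = - poly_integral (F * pderiv G)"
proof -
  have "poly_integral (pderiv F * G) + poly_integral (F * pderiv G) = poly_integral (pderiv (F * G))"
    unfolding poly_integral_add[symmetric] by (simp add: pderiv_mult add.commute mult.commute)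
  also have "\<dots> = 0" unfolding poly_integral_pderiv assms by simp
  finally show ?thesis by simp
qed

text \<open>
Integration by parts lowers the exponent \<open>b\<close> and raises \<open>a\<close>.
\<close>
lemma poly_integral_beta: "poly_integral ([:0, 1:] ^ a * [:1, -1:] ^ b) = fact a * fact b / fact (a + b + 1)"
proof (induction b arbitrary: a)
  case 0
  have "pderiv (monom (1 / real (Suc a)) (Suc a)) = monom 1 a" by (simp add: pderiv_monom)
  then have d: "pderiv (monom (1 / real (Suc a)) (Suc a)) = [:0, 1:] ^ a" by (simp add: monom_altdef)
  have "poly_integral ([:0, 1:] ^ a) = 1 / real (Suc a)"
    unfolding d[symmetric] poly_integral_pderiv by (simp add: poly_monom)
  moreover have "fact a * fact 0 / fact (a + 0 + 1) = (1 / real (Suc a) :: real)"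
    by (simp del: of_nat_Suc)
  ultimately show ?case by simp
next
  case (Suc b)
  let ?F = "monom (1 / real (Suc a)) (Suc a)"
  have "pderiv ?F = monom 1 a" by (simp add: pderiv_monom)
  then have d: "pderiv ?F = [:0, 1:] ^ a" by (simp add: monom_altdef)
  have dG: "pderiv ([:1, -1:] ^ Suc b) = smult (- real (Suc b)) ([:1, -1 :: real:] ^ b)"
    unfolding pderiv_power_Suc by (simp add: pderiv_pCons)
  have m: "?F = smult (1 / real (Suc a)) ([:0, 1:] ^ Suc a)" by (simp add: monom_altdef)
  have "poly_integral ([:0, 1:] ^ a * [:1, -1:] ^ Suc b) = - poly_integral (?F * pderiv ([:1, -1:] ^ Suc b))"
    unfolding d[symmetric] by (rule poly_integral_parts) (simp_all add: poly_monom)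
  also have "?F * pderiv ([:1, -1:] ^ Suc b) = smult (- real (Suc b) / real (Suc a)) ([:0, 1:] ^ Suc a * [:1, -1:] ^ b)"
    unfolding dG m by (simp del: power_Suc)
  also have "- poly_integral (smult (- real (Suc b) / real (Suc a)) ([:0, 1:] ^ Suc a * [:1, -1:] ^ b))
      = real (Suc b) / real (Suc a) * (fact (Suc a) * fact b / fact (Suc a + b + 1))"
    unfolding poly_integral_smult Suc.IH by (simp only: minus_mult_left minus_divide_left minus_minus)
  also have "\<dots> = fact a * fact (Suc b) / fact (a + Suc b + 1)"
    by (simp add: field_simps del: of_nat_Suc)
  finally show ?case .
qed

lemma power_dvd_higher_pderiv:
  fixes w :: "real poly"
  shows "i \<le> n \<Longrightarrow> w ^ (n - i) dvd (pderiv ^^ i) (w ^ n)"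
proof (induction i)
  case (Suc i)
  then obtain g where g: "(pderiv ^^ i) (w ^ n) = w ^ Suc (n - Suc i) * g"
    by (auto simp: Suc_diff_Suc elim!: dvdE)
  have "(pderiv ^^ Suc i) (w ^ n) = w ^ Suc (n - Suc i) * pderiv g
      + g * (smult (of_nat (Suc (n - Suc i))) (w ^ (n - Suc i)) * pderiv w)"
    by (simp only: funpow.simps comp_apply g pderiv_mult pderiv_power_Suc)
  moreover have "w ^ (n - Suc i) dvd w ^ Suc (n - Suc i)" by simp
  ultimately show ?case
    by (metis dvd_add dvd_mult dvd_mult2 dvd_refl dvd_smult)
qed simp

lemma repeated_integration_by_parts:
  assumes "k \<le> n"
  defines "w \<equiv> [:0, 1, -1 :: real:]"
  shows "poly_integral ((pderiv ^^ k) (w ^ n) * G) = (-1) ^ k * poly_integral (w ^ n * (pderiv ^^ k) G)"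
  using assms(1)
proof (induction k arbitrary: G)
  case (Suc k)
  have "w ^ Suc (n - Suc k) dvd (pderiv ^^ k) (w ^ n)"
    using power_dvd_higher_pderiv[of k n w] Suc.prems by (simp add: Suc_diff_Suc del: power_Suc)
  moreover have "w dvd w ^ Suc (n - Suc k)" by simp
  ultimately have "w dvd (pderiv ^^ k) (w ^ n) * G" by (blast intro: dvd_mult2 dvd_trans)
  then obtain K where K: "(pderiv ^^ k) (w ^ n) * G = w * K" by (elim dvdE)
  then have 0: "poly ((pderiv ^^ k) (w ^ n) * G) x = 0" if "poly w x = 0" for x
    using that by (simp only: K poly_mult mult_zero_left)
  have "poly_integral ((pderiv ^^ Suc k) (w ^ n) * G) = - poly_integral ((pderiv ^^ k) (w ^ n) * pderiv G)"
    using poly_integral_parts[of "(pderiv ^^ k) (w ^ n)" G] 0[of 0] 0[of 1] by (simp add: w_def)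
  also have "\<dots> = (-1) ^ Suc k * poly_integral (w ^ n * (pderiv ^^ Suc k) G)"
    using Suc.IH[of "pderiv G"] Suc.prems by (simp add: funpow_swap1)
  finally show ?case .
qed simp

definition beta_value :: "nat \<Rightarrow> real" where
  "beta_value n = (fact n)\<^sup>2 / fact (2 * n + 1)"

lemma poly_integral_weight: "poly_integral ([:0, 1, -1:] ^ n) = beta_value n"
proof -
  have "[:0, 1, -1 :: real:] = [:0, 1:] * [:1, -1:]" by simp
  then have "[:0, 1, -1 :: real:] ^ n = [:0, 1:] ^ n * [:1, -1:] ^ n"
    by (simp only: power_mult_distrib)
  then show ?thesis unfolding beta_value_def by (simp only: poly_integral_beta power2_eq_square mult_2)
qed

text \<open>
The derivative is a multiple of the shifted Legendre polynomial of degree \<open>2 * N\<close>. Moving all the derivatives to \<open>P\<close> leaves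
only the leading coefficient of \<open>P\<close>.
\<close>
lemma rodrigues_orthogonality:
  assumes P: "degree P \<le> 2 * N"
  shows "poly_integral ((pderiv ^^ (2 * N)) ([:0, 1, -1:] ^ (2 * N)) * P) = fact (2 * N) * beta_value (2 * N) * coeff P (2 * N)"
proof -
  have "coeff ((pderiv ^^ (2 * N)) P) i = coeff [:fact (2 * N) * coeff P (2 * N):] i" for i
  proof (cases i)
    case 0
    then show ?thesis by (simp add: coeff_higher_pderiv pochhammer_fact)
  next
    case (Suc k)
    then show ?thesis using P by (simp add: coeff_higher_pderiv coeff_eq_0)
  qed
  then have P': "(pderiv ^^ (2 * N)) P = [:fact (2 * N) * coeff P (2 * N):]" by (intro poly_eqI)
  have c: "poly_integral (W * [:a:]) = a * poly_integral W" for W a using poly_integral_smult[of a W] by simp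
  show ?thesis unfolding repeated_integration_by_parts[OF order_refl] P' c poly_integral_weight by simp
qed

text \<open>
The top coefficient identity, integrated for the antiderivative \<open>\<phi>\<close> of a Legendre polynomial. Integration by parts reduces the
integrand to \<open>\<phi>' (t j)\<close> times the node polynomial of the other nodes. The latter has degree \<open>2 * N\<close> in \<open>t j\<close> and leading
coefficient \<open>-1\<close>, so orthogonality makes the integral over \<open>t j\<close> independent of the other nodes.
\<close>
lemma selberg_step:
  assumes I: "finite I" "I \<noteq> {}"
  defines "N \<equiv> card I"
  shows "fact (4 * N) / fact (2 * N + 1) * cube_integral I (principal_weight I)
    = 2 * (fact (2 * N) * beta_value (2 * N)) * (\<Sum>j\<in>I. cube_integral (I - {j}) (principal_weight (I - {j})))"
proof -
  define w where "w = [:0, 1, -1 :: real:]"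
  have N: "N \<ge> 1" using I by (simp add: N_def Suc_le_eq card_gt_0_iff)
  \<comment> \<open>By Rodrigues' formula this is an antiderivative of a multiple of the shifted Legendre polynomial; one factor of \<open>w\<close> survives.\<close>
  define \<phi> where "\<phi> = (pderiv ^^ (2 * N - 1)) (w ^ (2 * N))"
  have d\<phi>: "pderiv \<phi> = (pderiv ^^ (2 * N)) (w ^ (2 * N))"
    unfolding \<phi>_def using N by (cases N) auto
  have "w ^ (2 * N - (2 * N - 1)) dvd \<phi>"
    unfolding \<phi>_def by (rule power_dvd_higher_pderiv) simp
  moreover have "2 * N - (2 * N - 1) = 1" using N by simp
  ultimately have "w dvd \<phi>" by simp
  then have \<phi>01: "poly \<phi> 0 = 0" "poly \<phi> 1 = 0" by (auto elim!: dvdE simp: w_def)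
  have dw: "degree (w ^ (2 * N)) = 4 * N" by (simp add: degree_power_eq w_def)
  have lw: "coeff (w ^ (2 * N)) (4 * N) = 1"
    using lead_coeff_power[of w "2 * N"] unfolding dw by (simp add: w_def)
  have cf: "coeff \<phi> i = pochhammer (real (Suc i)) (2 * N - 1) * coeff (w ^ (2 * N)) (i + (2 * N - 1))" for i
    unfolding \<phi>_def coeff_higher_pderiv by simp
  have deg: "degree \<phi> \<le> 2 * N + 1"
    by (rule degree_le) (use N in \<open>auto simp: cf coeff_eq_0 dw\<close>)
  have "2 * N + 1 + (2 * N - 1) = 4 * N" using N by simp
  then have "coeff \<phi> (2 * N + 1) = pochhammer (real (Suc (2 * N + 1))) (2 * N - 1)"
    unfolding cf by (simp only: lw mult_1_right)
  also have "\<dots> = fact (4 * N) / fact (2 * N + 1)"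
  proof -
    have "2 * N + 1 + (2 * N - 1) = 4 * N" using N by simp
    then have "fact (4 * N) = fact (2 * N + 1) * pochhammer (real (Suc (2 * N + 1))) (2 * N - 1)"
      using pochhammer_product'[of "1::real" "2 * N + 1" "2 * N - 1"] by (simp only: pochhammer_fact of_nat_Suc)
    then show ?thesis
      by (simp only: nonzero_mult_div_cancel_left[OF fact_nonzero])
  qed
  finally have lead: "coeff \<phi> (2 * N + 1) = fact (4 * N) / fact (2 * N + 1)" .
  define F where "F j t = principal_weight (I - {j}) t * (poly (pderiv \<phi>) (t j) * poly (node_poly (I - {j}) t) (t j))" for j t
  define G where "G j t = principal_weight (I - {j}) t * (poly \<phi> (t j) * poly (pderiv (node_poly (I - {j}) t)) (t j))" for j t
  have nF: "cube_bounded I (F j)" and nG: "cube_bounded I (G j)" if "j \<in> I" for j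
    unfolding F_def[abs_def] G_def[abs_def] using that by (intro cube_bounded_intros; auto)+
  have GF: "cube_integral I (G j) = - cube_integral I (F j)" if j: "j \<in> I" for j
  proof -
    have "cube_integral I (\<lambda>t. principal_weight (I - {j}) t * poly (pderiv (\<phi> * node_poly (I - {j}) t)) (t j)) = 0"
      by (rule cube_integral_boundary[OF I(1) j])
        (auto intro!: cube_bounded_poly_mult cube_bounded_intros simp: principal_weight_update node_poly_update)
    moreover have "principal_weight (I - {j}) t * poly (pderiv (\<phi> * node_poly (I - {j}) t)) (t j) = G j t + F j t" for t
      by (simp add: F_def G_def pderiv_mult algebra_simps)
    ultimately show ?thesis using cube_integral_add[OF I(1) nG[OF j] nF[OF j]] by simp
  qed
  have Fint: "cube_integral I (F j) = - (fact (2 * N) * beta_value (2 * N)) * cube_integral (I - {j}) (principal_weight (I - {j}))" if j: "j \<in> I" for j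
  proof -
    have e: "insert j (I - {j}) = I" using j by auto
    have "cube_integral I (F j) = cube_integral (I - {j}) (\<lambda>t. LINT x:{0..1}|lborel. F j (t(j := x)))"
      using cube_integral_fubini[of "I - {j}" j "F j", unfolded e] I(1) nF[OF j] by simp
    also have "(\<lambda>t. LINT x:{0..1}|lborel. F j (t(j := x))) = (\<lambda>t. - (fact (2 * N) * beta_value (2 * N)) * principal_weight (I - {j}) t)"
    proof
      fix t
      have dn: "degree (node_poly (I - {j}) t) = 2 * N"
        using N j I(1) by (simp add: degree_node_poly N_def)
      have "(LINT x:{0..1}|lborel. F j (t(j := x))) = principal_weight (I - {j}) t * poly_integral (pderiv \<phi> * node_poly (I - {j}) t)"
        unfolding F_def poly_integral_def by (simp add: principal_weight_update node_poly_update set_lebesgue_integral_def)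
      also have "poly_integral (pderiv \<phi> * node_poly (I - {j}) t) = fact (2 * N) * beta_value (2 * N) * (-1)"
        unfolding d\<phi> w_def using rodrigues_orthogonality[of "node_poly (I - {j}) t" N] lead_coeff_node_poly[of "I - {j}" t]
        by (simp add: dn)
      finally show "(LINT x:{0..1}|lborel. F j (t(j := x))) = - (fact (2 * N) * beta_value (2 * N)) * principal_weight (I - {j}) t"
        by (simp add: mult_ac del: fun_upd_apply)
    qed
    finally show ?thesis by (simp only: cube_integral_cmult)
  qed
  have "fact (4 * N) / fact (2 * N + 1) * cube_integral I (principal_weight I) = cube_integral I (\<lambda>t. coeff \<phi> (2 * N + 1) * principal_weight I t)"
    by (simp only: cube_integral_cmult lead)
  also have "\<dots> = cube_integral I (\<lambda>t. \<Sum>j\<in>I. G j t - F j t)"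
  proof (rule cube_integral_cong_AE[OF I(1)])
    fix t :: "nat \<Rightarrow> real" assume t: "\<forall>j\<in>I. t j \<noteq> 0 \<and> t j \<noteq> 1"
    show "coeff \<phi> (2 * N + 1) * principal_weight I t = (\<Sum>j\<in>I. G j t - F j t)"
      unfolding N_def hermite_lead_coeff[OF I(1) t I(2) deg[unfolded N_def] \<phi>01] F_def G_def
      by (simp add: right_diff_distrib)
  qed (intro cube_bounded_intros nF nG; simp)+
  also have "\<dots> = (\<Sum>j\<in>I. cube_integral I (\<lambda>t. G j t - F j t))"
    by (intro cube_integral_sum I cube_bounded_diff nF nG)
  also have "\<dots> = (\<Sum>j\<in>I. 2 * (fact (2 * N) * beta_value (2 * N)) * cube_integral (I - {j}) (principal_weight (I - {j})))"
  proof (rule sum.cong[OF refl])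
    fix j assume j: "j \<in> I"
    show "cube_integral I (\<lambda>t. G j t - F j t) = 2 * (fact (2 * N) * beta_value (2 * N)) * cube_integral (I - {j}) (principal_weight (I - {j}))"
      unfolding cube_integral_diff[OF I(1) nG[OF j] nF[OF j]] GF[OF j] Fint[OF j] by simp
  qed
  finally show ?thesis by (simp only: sum_distrib_left)
qed

text \<open>
The value \<open>S\<^sub>N(3, 3, 2)\<close> of Selberg's integral, in the form that matches the volume of the moment space.
\<close>
theorem selberg_integral:
  assumes "finite I"
  shows "cube_integral I (principal_weight I) = fact (card I) * fact (2 * card I + 1) * (\<Prod>k<2 * card I + 1. beta_value k)"
  using assms
proof (induction "card I" arbitrary: I)
  case 0
  then have I: "I = {}" by simp
  have "cube_integral I (principal_weight I) = 1"
    unfolding I by (simp add: cube_integral_def principal_weight_def vandermonde4_def set_lebesgue_integral_def PiM_empty)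
  then show ?case by (simp add: I beta_value_def)
next
  case (Suc n)
  define N where "N = Suc n"
  have cI: "card I = N" using Suc.hyps(2) by (simp add: N_def)
  have ne: "I \<noteq> {}" using cI by (auto simp: N_def)
  define V where "V = (\<Prod>k<2 * n + 1. beta_value k)"
  have IH: "cube_integral (I - {j}) (principal_weight (I - {j})) = fact n * fact (2 * n + 1) * V" if "j \<in> I" for j
  proof -
    have c: "card (I - {j}) = n" using that cI Suc.prems by (simp add: N_def)
    then show ?thesis using Suc.hyps(1)[of "I - {j}"] Suc.prems by (simp add: V_def)
  qed
  have VN: "(\<Prod>k<2 * N + 1. beta_value k) = V * beta_value (2 * n + 1) * beta_value (2 * N)"
    by (simp add: V_def N_def mult_ac)
  have b: "beta_value (2 * n + 1) * real N * fact (4 * N) = (fact (2 * N))\<^sup>2"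
  proof -
    have f4: "(fact (4 * N) :: real) = real (4 * N) * fact (4 * n + 3)"
      using fact_Suc[of "4 * n + 3", where 'a=real] by (simp add: N_def algebra_simps)
    have f2: "(fact (2 * N) :: real) = real (2 * N) * fact (2 * n + 1)"
      using fact_Suc[of "2 * n + 1", where 'a=real] by (simp add: N_def algebra_simps)
    have e: "2 * (2 * n + 1) + 1 = 4 * n + 3" by simp
    show ?thesis unfolding beta_value_def f4 f2 e by (simp add: field_simps power2_eq_square)
  qed
  have h: "fact (4 * N) / fact (2 * N + 1) * cube_integral I (principal_weight I)
      = 2 * (fact (2 * N) * beta_value (2 * N)) * (real N * (fact n * fact (2 * n + 1) * V))"
    using selberg_step[OF Suc.prems ne] IH by (simp add: cI)
  have fN: "fact N = real N * (fact n :: real)" by (simp add: N_def)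
  have f2: "fact (2 * N) = 2 * real N * (fact (2 * n + 1) :: real)"
    using fact_Suc[of "2 * n + 1", where 'a=real] by (simp add: N_def algebra_simps)
  have "cube_integral I (principal_weight I) * (fact (4 * N) * real N)
      = fact (2 * N + 1) * real N * (fact (4 * N) / fact (2 * N + 1) * cube_integral I (principal_weight I))"
    by simp
  also have "\<dots> = fact (2 * N + 1) * (fact (2 * N) * beta_value (2 * N)) * fact N * V * fact (2 * N)"
    unfolding h fN f2 by (simp only: mult_ac)
  also have "\<dots> = fact (2 * N + 1) * beta_value (2 * N) * fact N * V * (beta_value (2 * n + 1) * real N * fact (4 * N))"
    unfolding b by (simp only: power2_eq_square mult_ac)
  also have "\<dots> = (fact N * fact (2 * N + 1) * (V * beta_value (2 * n + 1) * beta_value (2 * N))) * (fact (4 * N) * real N)"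
    by (simp only: mult_ac)
  finally have "cube_integral I (principal_weight I) = fact N * fact (2 * N + 1) * (V * beta_value (2 * n + 1) * beta_value (2 * N))"
    by (simp add: N_def)
  then show ?case unfolding cI VN .
qed

section \<open>Renewal sequences and positive semidefiniteness\<close>

definition psd_hankel :: "(nat \<Rightarrow> real) \<Rightarrow> bool" where
  "psd_hankel s \<longleftrightarrow> (\<forall>n x. 0 \<le> (\<Sum>i\<le>n. \<Sum>j\<le>n. s (i + j) * x i * x j))"

lemma psd_scale: "c > 0 \<Longrightarrow> psd_hankel (\<lambda>n. c * s n) \<longleftrightarrow> psd_hankel s"
proof -
  assume c: "c > 0"
  have "(\<Sum>i\<le>n. \<Sum>j\<le>n. c * s (i + j) * x i * x j) = c * (\<Sum>i\<le>n. \<Sum>j\<le>n. s (i + j) * x i * x j)"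
    for n and x :: "nat \<Rightarrow> real"
    by (simp add: sum_distrib_left mult.assoc)
  then show ?thesis using c by (simp add: psd_hankel_def zero_le_mult_iff)
qed

locale renewal =
  fixes g A :: "nat \<Rightarrow> real"
  assumes g0: "g 0 = 1" and gSuc: "\<And>n. g (Suc n) = (\<Sum>k\<le>n. A k * g (n - k))"
begin

text \<open>
Think of \<open>g n\<close> as the weight of all ways to write \<open>n\<close> as a sum of steps, a step of length \<open>k + 1\<close> having
weight \<open>A k\<close>. Exactly one step crosses from \<open>i\<close> to \<open>i + 1\<close>; it starts at \<open>a\<close>, and \<open>b\<close> is the length that
remains after its end.
\<close>
lemma split_crossing_step:
  "g (Suc (i + j)) = (\<Sum>a\<le>i. \<Sum>b\<le>j. g a * A ((i - a) + (j - b)) * g b)"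
proof (induction i arbitrary: j)
  case 0
  show ?case
    using gSuc[of j] sum.nat_diff_reindex[of "\<lambda>b. A b * g (j - b)" "Suc j"]
    by (simp add: g0 lessThan_Suc_atMost)
next
  case (Suc i)
  define S where "S = (\<Sum>a\<le>i. \<Sum>b\<le>j. g a * A (Suc ((i - a) + (j - b))) * g b)"
  have conv: "g (Suc n) = (\<Sum>b\<le>n. A (n - b) * g b)" for n
    using gSuc[of n] sum.nat_diff_reindex[of "\<lambda>b. A b * g (n - b)" "Suc n"]
    by (simp add: lessThan_Suc_atMost)
  have "(\<Sum>a\<le>i. \<Sum>b\<le>j. g a * A ((Suc i - a) + (j - b)) * g b) = S"
    unfolding S_def by (intro sum.cong refl) (auto simp: Suc_diff_le)
  moreover have "(\<Sum>b\<le>j. g (Suc i) * A ((Suc i - Suc i) + (j - b)) * g b) = g (Suc i) * g (Suc j)"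
    by (simp add: conv[of j] sum_distrib_left mult.assoc)
  ultimately have lhs: "(\<Sum>a\<le>Suc i. \<Sum>b\<le>j. g a * A ((Suc i - a) + (j - b)) * g b) = S + g (Suc i) * g (Suc j)"
    by simp
  have "(\<Sum>a\<le>i. \<Sum>b\<le>Suc j. g a * A ((i - a) + (Suc j - b)) * g b)
      = (\<Sum>a\<le>i. (\<Sum>b\<le>j. g a * A (Suc ((i - a) + (j - b))) * g b) + g a * A (i - a) * g (Suc j))"
    by (intro sum.cong refl) (auto simp: Suc_diff_le intro!: sum.cong)
  also have "\<dots> = S + g (Suc i) * g (Suc j)"
    by (simp add: S_def sum.distrib conv[of i] sum_distrib_left sum_distrib_right mult_ac)
  finally show ?case using Suc.IH[of "Suc j"] lhs by simp
qed

text \<open>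
The analogous decomposition at a time: either a step ends there, or one passes over it.
\<close>
lemma split_at_time:
  "g (Suc i + Suc j) = g (Suc i) * g (Suc j)
     + (\<Sum>a\<le>i. \<Sum>b\<le>j. g a * A (Suc ((i - a) + (j - b))) * g b)"
proof -
  have conv: "g (Suc j) = (\<Sum>b\<le>j. A (j - b) * g b)"
    using gSuc[of j] sum.nat_diff_reindex[of "\<lambda>b. A b * g (j - b)" "Suc j"]
    by (simp add: lessThan_Suc_atMost)
  have "g (Suc i + Suc j) = (\<Sum>a\<le>Suc i. \<Sum>b\<le>j. g a * A ((Suc i - a) + (j - b)) * g b)"
    using split_crossing_step[of "Suc i" j] by simp
  also have "\<dots> = (\<Sum>a\<le>i. \<Sum>b\<le>j. g a * A ((Suc i - a) + (j - b)) * g b) + g (Suc i) * g (Suc j)"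
    by (simp add: conv sum_distrib_left mult.assoc)
  also have "(\<Sum>a\<le>i. \<Sum>b\<le>j. g a * A ((Suc i - a) + (j - b)) * g b)
      = (\<Sum>a\<le>i. \<Sum>b\<le>j. g a * A (Suc ((i - a) + (j - b))) * g b)"
    by (intro sum.cong refl) (auto simp: Suc_diff_le)
  finally show ?thesis by simp
qed

text \<open>
The transposed triangular Toeplitz matrix of \<open>g\<close>, acting on vectors supported on \<open>{..n}\<close>.
\<close>
definition toeplitz :: "nat \<Rightarrow> (nat \<Rightarrow> real) \<Rightarrow> nat \<Rightarrow> real" where
  "toeplitz n x k = (\<Sum>i=k..n. x i * g (i - k))"

lemma toeplitz_adjoint:
  "(\<Sum>i\<le>n. x i * (\<Sum>a\<le>i. g a * F (i - a))) = (\<Sum>k\<le>n. F k * toeplitz n x k)"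
proof -
  have "(\<Sum>a\<le>i. g a * F (i - a)) = (\<Sum>k\<le>i. g (i - k) * F k)" for i
    using sum.nat_diff_reindex[of "\<lambda>a. g a * F (i - a)" "Suc i"]
    by (simp add: lessThan_Suc_atMost)
  then have "(\<Sum>i\<le>n. x i * (\<Sum>a\<le>i. g a * F (i - a))) = (\<Sum>i\<le>n. \<Sum>k\<le>i. x i * g (i - k) * F k)"
    by (simp add: sum_distrib_left mult.assoc)
  also have "\<dots> = (\<Sum>k\<le>n. \<Sum>i=k..n. x i * g (i - k) * F k)"
    by (subst sum.Sigma, simp, simp, subst sum.Sigma, simp, simp,
        rule sum.reindex_bij_witness[where i="\<lambda>(k,i). (i,k)" and j="\<lambda>(i,k). (k,i)"]) auto
  also have "\<dots> = (\<Sum>k\<le>n. F k * toeplitz n x k)"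
    by (simp add: toeplitz_def sum_distrib_left mult_ac)
  finally show ?thesis .
qed

text \<open>
The decompositions above express Hankel matrices of \<open>g\<close> as \<open>T H T\<^sup>t\<close> with \<open>H\<close> a Hankel matrix of \<open>A\<close>
and \<open>T\<close> the Toeplitz matrix of \<open>g\<close>.
\<close>
lemma hankel_congruence:
  "(\<Sum>i\<le>n. \<Sum>j\<le>n. (\<Sum>a\<le>i. \<Sum>b\<le>j. g a * B ((i - a) + (j - b)) * g b) * x i * x j)
     = (\<Sum>k\<le>n. \<Sum>l\<le>n. B (k + l) * toeplitz n x k * toeplitz n x l)"
proof -
  have "(\<Sum>i\<le>n. \<Sum>j\<le>n. (\<Sum>a\<le>i. \<Sum>b\<le>j. g a * B ((i - a) + (j - b)) * g b) * x i * x j)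
      = (\<Sum>i\<le>n. x i * (\<Sum>a\<le>i. g a * (\<Sum>j\<le>n. x j * (\<Sum>b\<le>j. g b * B ((i - a) + (j - b))))))"
  proof (rule sum.cong[OF refl])
    fix i
    let ?F = "\<lambda>a j. x j * (\<Sum>b\<le>j. g b * B ((i - a) + (j - b)))"
    have "(\<Sum>a\<le>i. \<Sum>b\<le>j. g a * B ((i - a) + (j - b)) * g b) * x i * x j
        = x i * (\<Sum>a\<le>i. g a * ?F a j)" for j
    proof -
      let ?S = "\<Sum>a\<le>i. \<Sum>b\<le>j. g a * B ((i - a) + (j - b)) * g b"
      have "(\<Sum>b\<le>j. g a * B ((i - a) + (j - b)) * g b) * x j = g a * ?F a j" for a
        by (simp add: sum_distrib_left sum_distrib_right mult_ac)
      then have "?S * x j = (\<Sum>a\<le>i. g a * ?F a j)"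
        by (subst sum_distrib_right) (simp only:)
      moreover have "?S * x i * x j = x i * (?S * x j)" by (simp only: mult_ac)
      ultimately show ?thesis by (simp only:)
    qed
    then have "(\<Sum>j\<le>n. (\<Sum>a\<le>i. \<Sum>b\<le>j. g a * B ((i - a) + (j - b)) * g b) * x i * x j)
        = x i * (\<Sum>j\<le>n. \<Sum>a\<le>i. g a * ?F a j)"
      by (simp only: sum_distrib_left)
    also have "(\<Sum>j\<le>n. \<Sum>a\<le>i. g a * ?F a j) = (\<Sum>a\<le>i. \<Sum>j\<le>n. g a * ?F a j)"
      by (rule sum.swap)
    also have "\<dots> = (\<Sum>a\<le>i. g a * (\<Sum>j\<le>n. ?F a j))" by (simp only: sum_distrib_left)
    finally show "(\<Sum>j\<le>n. (\<Sum>a\<le>i. \<Sum>b\<le>j. g a * B ((i - a) + (j - b)) * g b) * x i * x j)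
        = x i * (\<Sum>a\<le>i. g a * (\<Sum>j\<le>n. ?F a j))" .
  qed
  also have "\<dots> = (\<Sum>i\<le>n. x i * (\<Sum>a\<le>i. g a * (\<Sum>l\<le>n. B ((i - a) + l) * toeplitz n x l)))"
    using toeplitz_adjoint[where x=x and n=n and F="\<lambda>l. B (m + l)" for m] by (simp only:)
  also have "\<dots> = (\<Sum>k\<le>n. (\<Sum>l\<le>n. B (k + l) * toeplitz n x l) * toeplitz n x k)"
    by (rule toeplitz_adjoint)
  finally show ?thesis by (simp add: sum_distrib_left sum_distrib_right mult_ac)
qed

text \<open>
The Toeplitz matrix is unipotent because \<open>g 0 = 1\<close>; hence the congruence can be reversed.
\<close>
lemma toeplitz_surj: "\<exists>x. \<forall>k\<le>n. toeplitz n x k = y k"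
proof (induction n arbitrary: y)
  case 0
  show ?case by (rule exI[of _ y]) (simp add: toeplitz_def g0)
next
  case (Suc n)
  obtain x where x: "\<And>k. k \<le> n \<Longrightarrow> toeplitz n x k = y k - y (Suc n) * g (Suc n - k)"
    using Suc.IH[of "\<lambda>k. y k - y (Suc n) * g (Suc n - k)"] by blast
  have "toeplitz (Suc n) (x(Suc n := y (Suc n))) k = y k" if "k \<le> Suc n" for k
  proof (cases "k = Suc n")
    case True
    then show ?thesis by (simp add: toeplitz_def g0)
  next
    case False
    have "toeplitz (Suc n) (x(Suc n := y (Suc n))) k
        = (\<Sum>i=k..n. (x(Suc n := y (Suc n))) i * g (i - k)) + y (Suc n) * g (Suc n - k)"
      using that by (simp add: toeplitz_def)
    also have "(\<Sum>i=k..n. (x(Suc n := y (Suc n))) i * g (i - k)) = toeplitz n x k"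
      unfolding toeplitz_def by (intro sum.cong) auto
    finally show ?thesis using x[of k] False that by (simp del: fun_upd_apply)
  qed
  then show ?case by blast
qed

lemma psd_Suc_iff: "psd_hankel (\<lambda>n. g (Suc n)) \<longleftrightarrow> psd_hankel A"
proof -
  have q: "(\<Sum>i\<le>n. \<Sum>j\<le>n. g (Suc (i + j)) * x i * x j)
      = (\<Sum>k\<le>n. \<Sum>l\<le>n. A (k + l) * toeplitz n x k * toeplitz n x l)" for n x
    unfolding split_crossing_step by (rule hankel_congruence)
  show ?thesis
  proof
    assume g: "psd_hankel (\<lambda>n. g (Suc n))"
    show "psd_hankel A" unfolding psd_hankel_def
    proof (intro allI)
      fix n y
      obtain x where x: "\<And>k. k \<le> n \<Longrightarrow> toeplitz n x k = y k" using toeplitz_surj by blast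
      have e: "(\<Sum>k\<le>n. \<Sum>l\<le>n. A (k + l) * y k * y l)
          = (\<Sum>k\<le>n. \<Sum>l\<le>n. A (k + l) * toeplitz n x k * toeplitz n x l)"
        by (intro sum.cong refl) (simp add: x)
      show "0 \<le> (\<Sum>k\<le>n. \<Sum>l\<le>n. A (k + l) * y k * y l)"
        unfolding e q[symmetric] by (rule g[unfolded psd_hankel_def, rule_format])
    qed
  next
    assume A: "psd_hankel A"
    show "psd_hankel (\<lambda>n. g (Suc n))"
      unfolding psd_hankel_def q using A[unfolded psd_hankel_def] by blast
  qed
qed

text \<open>
Besides the congruence there is the rank one contribution of the paths that visit the cutting time. It is a
square, and the free entry \<open>x 0\<close> can be chosen to make it vanish.
\<close>
lemma psd_iff: "psd_hankel g \<longleftrightarrow> psd_hankel (\<lambda>n. A (Suc n))"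
proof -
  have q: "(\<Sum>i\<le>Suc n. \<Sum>j\<le>Suc n. g (i + j) * x i * x j)
      = (\<Sum>i\<le>Suc n. g i * x i)\<^sup>2
        + (\<Sum>k\<le>n. \<Sum>l\<le>n. A (Suc (k + l)) * toeplitz n (x \<circ> Suc) k * toeplitz n (x \<circ> Suc) l)" for n x
  proof -
    define e where "e i j = (g (i + j) - g i * g j) * x i * x j" for i j
    have "(\<Sum>i\<le>Suc n. \<Sum>j\<le>Suc n. e i j) = (\<Sum>i\<le>n. \<Sum>j\<le>n. e (Suc i) (Suc j))"
      unfolding sum.atMost_Suc_shift by (simp add: e_def g0)
    also have "\<dots> = (\<Sum>i\<le>n. \<Sum>j\<le>n. (\<Sum>a\<le>i. \<Sum>b\<le>j. g a * A (Suc ((i - a) + (j - b))) * g b)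
        * (x \<circ> Suc) i * (x \<circ> Suc) j)"
      by (intro sum.cong refl) (simp only: e_def split_at_time, simp)
    also have "\<dots> = (\<Sum>k\<le>n. \<Sum>l\<le>n. A (Suc (k + l)) * toeplitz n (x \<circ> Suc) k * toeplitz n (x \<circ> Suc) l)"
      by (rule hankel_congruence)
    finally have "(\<Sum>i\<le>Suc n. \<Sum>j\<le>Suc n. e i j) = \<dots>" .
    moreover have "(\<Sum>i\<le>Suc n. \<Sum>j\<le>Suc n. e i j) = (\<Sum>i\<le>Suc n. \<Sum>j\<le>Suc n. g (i + j) * x i * x j)
        - (\<Sum>i\<le>Suc n. \<Sum>j\<le>Suc n. (g i * x i) * (g j * x j))"
      unfolding e_def sum_subtractf[symmetric] by (intro sum.cong refl) (simp add: algebra_simps)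
    moreover have "(\<Sum>i\<le>Suc n. \<Sum>j\<le>Suc n. (g i * x i) * (g j * x j)) = (\<Sum>i\<le>Suc n. g i * x i)\<^sup>2"
      unfolding power2_eq_square sum_product ..
    ultimately show ?thesis by linarith
  qed
  show ?thesis
  proof
    assume g: "psd_hankel g"
    show "psd_hankel (\<lambda>n. A (Suc n))" unfolding psd_hankel_def
    proof (intro allI)
      fix n y
      obtain x where x: "\<And>k. k \<le> n \<Longrightarrow> toeplitz n x k = y k" using toeplitz_surj by blast
      \<comment> \<open>The entry at 0 is chosen so that the square in the quadratic form vanishes.\<close>
      define x' where "x' i = (case i of 0 \<Rightarrow> - (\<Sum>i\<le>n. g (Suc i) * x i) | Suc j \<Rightarrow> x j)" for i
      have x': "x' \<circ> Suc = x" by (auto simp: x'_def)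
      have z: "(\<Sum>i\<le>Suc n. g i * x' i) = 0"
        unfolding sum.atMost_Suc_shift by (simp add: x'_def g0)
      have e: "(\<Sum>k\<le>n. \<Sum>l\<le>n. A (Suc (k + l)) * y k * y l)
          = (\<Sum>k\<le>n. \<Sum>l\<le>n. A (Suc (k + l)) * toeplitz n x k * toeplitz n x l)"
        by (intro sum.cong refl) (simp add: x)
      have "(\<Sum>i\<le>Suc n. \<Sum>j\<le>Suc n. g (i + j) * x' i * x' j)
          = (\<Sum>k\<le>n. \<Sum>l\<le>n. A (Suc (k + l)) * y k * y l)"
        unfolding q z x' e by (simp only: power_zero_numeral add_0_left)
      moreover have "0 \<le> (\<Sum>i\<le>Suc n. \<Sum>j\<le>Suc n. g (i + j) * x' i * x' j)"
        by (rule g[unfolded psd_hankel_def, rule_format])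
      ultimately show "0 \<le> (\<Sum>k\<le>n. \<Sum>l\<le>n. A (Suc (k + l)) * y k * y l)"
        by (simp only:)
    qed
  next
    assume A: "psd_hankel (\<lambda>n. A (Suc n))"
    show "psd_hankel g" unfolding psd_hankel_def
    proof (intro allI)
      fix n x
      show "0 \<le> (\<Sum>i\<le>n. \<Sum>j\<le>n. g (i + j) * x i * x j)"
      proof (cases n)
        case 0
        then show ?thesis by (simp add: g0)
      next
        case (Suc m)
        have "0 \<le> (\<Sum>k\<le>m. \<Sum>l\<le>m. A (Suc (k + l)) * toeplitz m (x \<circ> Suc) k * toeplitz m (x \<circ> Suc) l)"
          by (rule A[unfolded psd_hankel_def, rule_format])
        then show ?thesis unfolding Suc q by (rule add_nonneg_nonneg[OF zero_le_power2])
      qed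
    qed
  qed
qed

end

lemma renewal_fps:
  assumes "G * (1 - fps_X * A) = 1"
  shows "renewal (fps_nth G) (fps_nth A)"
proof
  have G: "G = 1 + fps_X * (A * G)" using assms by (simp add: algebra_simps)
  show "fps_nth G 0 = 1" by (subst G) simp
  show "fps_nth G (Suc n) = (\<Sum>k\<le>n. fps_nth A k * fps_nth G (n - k))" for n
  proof -
    have "fps_nth G (Suc n) = fps_nth (A * G) n" by (subst G) simp
    then show ?thesis by (simp add: fps_mult_nth atLeast0AtMost)
  qed
qed

text \<open>
In terms of a representing measure on the unit interval: the quadratic forms \<open>\<integral> w f\<^sup>2\<close> for \<open>w\<close> equal to
\<open>1\<close>, \<open>t\<close>, \<open>1 - t\<close> and \<open>t * (1 - t)\<close> are nonnegative. All four are kept because renewal steps interchange them.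
\<close>
definition hausdorff_seq :: "(nat \<Rightarrow> real) \<Rightarrow> bool" where
  "hausdorff_seq c \<longleftrightarrow> c 0 = 1 \<and> psd_hankel c \<and> psd_hankel (\<lambda>n. c (Suc n)) \<and> psd_hankel (\<lambda>n. c n - c (Suc n))
     \<and> psd_hankel (\<lambda>n. c (Suc n) - c (Suc (Suc n)))"

text \<open>
The Moebius transformation factors as \<open>C = 1 / (1 - p X S)\<close> and \<open>S = 1 / (1 - q T)\<close>, where
\<open>D = 1 / (1 - T)\<close>.
\<close>
lemma moebius_algebra:
  fixes X P Q C D T S :: "'a::idom"
  assumes PQ: "P + Q = 1" and D: "D * (1 - T) = 1" and S: "S * (1 - Q * T) = 1"
    and rel: "(Q + P * (1 - X) * D) * (1 - (1 - X) * C) = Q * X"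
    and nz: "1 - X \<noteq> 0" "P * D + Q \<noteq> 0"
  shows "C * (1 - X * (P * S)) = 1"
proof -
  have Q: "Q = 1 - P" using PQ by (simp add: eq_diff_eq add.commute)
  have "(1 - X) * (C * (Q + P * (1 - X) * D)) = (1 - X) * (P * D + Q)"
    using rel unfolding Q by algebra
  then have C: "C * (Q + P * (1 - X) * D) = P * D + Q" using nz by simp
  have "(P * D + Q) * S = D"
    using D S unfolding Q by algebra
  moreover have "(P * D + Q) * (C * (1 - X * (P * S))) = C * (P * D + Q) - C * X * P * ((P * D + Q) * S)"
    by (simp add: algebra_simps)
  ultimately have "(P * D + Q) * (C * (1 - X * (P * S))) = C * (P * D + Q) - C * X * P * D"
    by (simp only:)
  also have "\<dots> = (P * D + Q) * 1"
    using C by algebra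
  finally show ?thesis using nz by (metis mult_left_cancel)
qed

text \<open>
Four renewal steps relate the two sequences. Writing \<open>q = 1 - p\<close>, one chain is \<open>C = 1 / (1 - p X \<sigma>)\<close>, \<open>\<sigma> = 1 / (1 - q X \<tau>)\<close>,
\<open>D = 1 / (1 - X \<tau>)\<close>; it identifies the conditions on \<open>C n\<close> and \<open>C (n + 1)\<close> with those on \<open>D (n + 1)\<close> and \<open>D n\<close>.
The other chain is \<open>\<beta> = 1 / (1 - X \<alpha>)\<close> for the scaled differences \<open>\<beta>\<close> of \<open>C\<close> and \<open>\<alpha>\<close> of \<open>D\<close>; it identifies the two
remaining conditions, again in exchanged order.
\<close>
lemma hausdorff_moebius:
  fixes C D :: "real fps"
  assumes p: "0 < p" "p < 1"
    and C0: "fps_nth C 0 = 1" and D0: "fps_nth D 0 = 1"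
    and rel: "(fps_const (1 - p) + fps_const p * (1 - fps_X) * D) * (1 - (1 - fps_X) * C)
               = fps_const (1 - p) * fps_X"
  shows "hausdorff_seq (fps_nth C) \<longleftrightarrow> hausdorff_seq (fps_nth D)"
proof -
  define q where "q = 1 - p"
  have q: "q > 0" using p by (simp add: q_def)
  have pq: "fps_const p + fps_const q = 1" by (simp add: q_def)
  define \<alpha> where "\<alpha> = Abs_fps (\<lambda>n. p * (fps_nth D n - fps_nth D (Suc n)))"
  define \<beta> where "\<beta> = Abs_fps (\<lambda>n. (1 / q) * (fps_nth C n - fps_nth C (Suc n)))"
  define \<tau> where "\<tau> = fps_shift 1 (1 - inverse D)"
  define \<sigma> where "\<sigma> = inverse (1 - fps_X * (fps_const q * \<tau>))"
  have shift: "fps_X * Abs_fps (\<lambda>n. fps_nth F n - fps_nth F (Suc n)) = 1 - (1 - fps_X) * F"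
    if "fps_nth F 0 = 1" for F :: "real fps"
    by (rule fps_ext) (use that in \<open>auto simp: left_diff_distrib split: nat.split\<close>)
  have "\<alpha> = fps_const p * Abs_fps (\<lambda>n. fps_nth D n - fps_nth D (Suc n))"
    unfolding \<alpha>_def by (rule fps_ext) simp
  then have \<alpha>: "fps_X * \<alpha> = fps_const p * (1 - (1 - fps_X) * D)"
    using shift[OF D0] by (simp add: mult.left_commute)
  have "fps_const q * \<beta> = Abs_fps (\<lambda>n. fps_nth C n - fps_nth C (Suc n))"
    unfolding \<beta>_def using q by (intro fps_ext) simp
  then have \<beta>: "fps_const q * fps_X * \<beta> = 1 - (1 - fps_X) * C"
    using shift[OF C0] by (simp add: mult_ac)
  have "fps_const q + fps_const p * (1 - fps_X) * D = (fps_const p + fps_const q) - fps_const p * (1 - (1 - fps_X) * D)"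
    by (simp only: right_diff_distrib mult.assoc mult_1_right) (simp del: fps_const_add)
  also have "\<dots> = 1 - fps_X * \<alpha>" unfolding \<alpha> pq ..
  finally have "fps_const q + fps_const p * (1 - fps_X) * D = 1 - fps_X * \<alpha>" .
  then have "(1 - fps_X * \<alpha>) * (fps_const q * fps_X * \<beta>) = fps_const q * fps_X"
    using rel unfolding \<beta> by (simp add: q_def)
  then have "fps_const q * fps_X * (\<beta> * (1 - fps_X * \<alpha>)) = fps_const q * fps_X * 1"
    by (simp add: mult_ac)
  then have rb: "\<beta> * (1 - fps_X * \<alpha>) = 1"
    using q by (subst (asm) mult_left_cancel) auto
  have "fps_X * \<tau> = 1 - inverse D"
    unfolding \<tau>_def by (rule fps_ext) (use D0 in \<open>auto split: nat.split\<close>)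
  then have rd: "D * (1 - fps_X * \<tau>) = 1"
    using D0 inverse_mult_eq_1'[of D] by simp
  have rs: "\<sigma> * (1 - fps_X * (fps_const q * \<tau>)) = 1"
    unfolding \<sigma>_def by (rule inverse_mult_eq_1) simp
  have "fps_nth (1 - fps_X :: real fps) 0 = 1" "fps_nth (fps_const p * D + fps_const q) 0 = 1"
    by (simp_all add: D0 q_def)
  then have nz: "1 - fps_X \<noteq> (0 :: real fps)" "fps_const p * D + fps_const q \<noteq> 0"
    by (metis fps_zero_nth zero_neq_one)+
  have "S * (1 - Y) = 1" if "S * (1 - Z) = 1" "Z = Y" for S Y Z :: "real fps" using that by simp
  then have rc: "C * (1 - fps_X * (fps_const p * \<sigma>)) = 1"
    by (intro moebius_algebra[OF pq rd _ _ nz])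
      (use rs rel in \<open>simp_all only: q_def mult.left_commute[of fps_X]\<close>)
  have nth_scale: "fps_nth (fps_const r * F) = (\<lambda>n. r * fps_nth F n)" for r and F :: "real fps"
    by (rule ext) simp
  have \<alpha>n: "fps_nth \<alpha> = (\<lambda>n. p * (fps_nth D n - fps_nth D (Suc n)))"
    and \<beta>n: "fps_nth \<beta> = (\<lambda>n. 1 / q * (fps_nth C n - fps_nth C (Suc n)))"
    by (auto simp: \<alpha>_def \<beta>_def)
  have iq: "1 / q > 0" using q by simp
  note C_\<sigma> = renewal.psd_Suc_iff[OF renewal_fps[OF rc], unfolded nth_scale psd_scale[OF p(1)]]
    renewal.psd_iff[OF renewal_fps[OF rc], unfolded nth_scale psd_scale[OF p(1)]]
  note \<sigma>_\<tau> = renewal.psd_Suc_iff[OF renewal_fps[OF rs], unfolded nth_scale psd_scale[OF q]]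
    renewal.psd_iff[OF renewal_fps[OF rs], unfolded nth_scale psd_scale[OF q]]
  note D_\<tau> = renewal.psd_Suc_iff[OF renewal_fps[OF rd]] renewal.psd_iff[OF renewal_fps[OF rd]]
  note \<beta>_\<alpha> = renewal.psd_Suc_iff[OF renewal_fps[OF rb], unfolded \<alpha>n \<beta>n psd_scale[OF p(1)] psd_scale[OF iq]]
    renewal.psd_iff[OF renewal_fps[OF rb], unfolded \<alpha>n \<beta>n psd_scale[OF p(1)] psd_scale[OF iq]]
  show ?thesis
    unfolding hausdorff_seq_def using C0 D0 C_\<sigma> \<sigma>_\<tau> D_\<tau> \<beta>_\<alpha> by blast
qed

section \<open>Positivity of moment sequences\<close>

definition moments :: "real measure \<Rightarrow> nat \<Rightarrow> real" where
  "moments \<mu> i = (LINT t|\<mu>. t ^ i)"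

lemma hausdorff_moments:
  assumes "prob_space \<mu>" and sets: "sets \<mu> = sets (restrict_space borel {0..1::real})"
  shows "hausdorff_seq (moments \<mu>)"
proof -
  interpret prob_space \<mu> by fact
  have space: "space \<mu> = {0..1}" using sets_eq_imp_space_eq[OF sets] by (simp add: space_restrict_space)
  have meas: "f \<in> borel_measurable \<mu>" if "f \<in> borel_measurable borel" for f :: "real \<Rightarrow> real"
    using measurable_restrict_space1[OF that] measurable_cong_sets[OF sets refl] by blast
  have int: "integrable \<mu> (\<lambda>t. t ^ i)" for i
  proof (rule integrable_const_bound[of _ 1])
    show "AE t in \<mu>. norm (t ^ i) \<le> 1"
      using power_le_one by (intro AE_I2) (auto simp: space power_abs)
  qed (auto intro!: meas)
  have quad: "(\<Sum>i\<le>n. \<Sum>j\<le>n. (LINT t|\<mu>. w t * t ^ (i + j)) * x i * x j) = (LINT t|\<mu>. w t * (\<Sum>i\<le>n. x i * t ^ i)\<^sup>2)"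
    if w: "\<And>k. integrable \<mu> (\<lambda>t. w t * t ^ k)" for w n and x :: "nat \<Rightarrow> real"
  proof -
    have e: "w t * (\<Sum>i\<le>n. x i * t ^ i)\<^sup>2 = (\<Sum>i\<le>n. \<Sum>j\<le>n. w t * t ^ (i + j) * (x i * x j))" for t
      by (simp add: power2_eq_square sum_product sum_distrib_left power_add mult_ac)
    have "(LINT t|\<mu>. w t * (\<Sum>i\<le>n. x i * t ^ i)\<^sup>2) = (\<Sum>i\<le>n. \<Sum>j\<le>n. LINT t|\<mu>. w t * t ^ (i + j) * (x i * x j))"
      unfolding e using w by (subst Bochner_Integration.integral_sum | (auto; fail) | intro sum.cong refl)+
    then show ?thesis by (simp add: mult.assoc[symmetric])
  qed
  have gen: "psd_hankel (\<lambda>n. LINT t|\<mu>. w t * t ^ n)"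
    if "\<And>k. integrable \<mu> (\<lambda>t. w t * t ^ k)" "\<And>t. t \<in> {0..1} \<Longrightarrow> w t \<ge> 0" for w
    unfolding psd_hankel_def quad[OF that(1)]
    using that(2) by (auto intro!: integral_nonneg_AE AE_I2 simp: space)
  have "psd_hankel (moments \<mu>)" using gen[of "\<lambda>_. 1"] int by (simp add: moments_def[abs_def])
  moreover have "psd_hankel (\<lambda>n. moments \<mu> (Suc n))"
    using gen[of "\<lambda>t. t"] int[of "Suc k" for k] by (simp add: moments_def)
  moreover have "psd_hankel (\<lambda>n. moments \<mu> n - moments \<mu> (Suc n))"
  proof -
    have e: "(1 - t) * t ^ k = t ^ k - t ^ Suc k" for t :: real and k by (simp add: algebra_simps)
    show ?thesis
      using gen[of "\<lambda>t. 1 - t"] unfolding e moments_def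
      by (simp add: int int[of "Suc k" for k, simplified])
  qed
  moreover have "psd_hankel (\<lambda>n. moments \<mu> (Suc n) - moments \<mu> (Suc (Suc n)))"
  proof -
    have e: "(t * (1 - t)) * t ^ k = t ^ Suc k - t ^ Suc (Suc k)" for t :: real and k by (simp add: algebra_simps)
    show ?thesis
      using gen[of "\<lambda>t. t * (1 - t)"] unfolding e moments_def
      by (simp add: int int[of "Suc k" for k, simplified] int[of "Suc (Suc k)" for k, simplified])
  qed
  ultimately show ?thesis by (simp add: hausdorff_seq_def moments_def[of _ 0] prob_space)
qed

definition moment_functional :: "(nat \<Rightarrow> real) \<Rightarrow> real poly \<Rightarrow> real" where
  "moment_functional c f = (\<Sum>i\<le>degree f. coeff f i * c i)"

lemma moment_functional_eq: "degree f \<le> n \<Longrightarrow> moment_functional c f = (\<Sum>i\<le>n. coeff f i * c i)"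
  unfolding moment_functional_def by (rule sum.mono_neutral_left) (auto simp: coeff_eq_0)

lemma moment_functional_add: "moment_functional c (f + g) = moment_functional c f + moment_functional c g"
proof -
  define n where "n = max (degree f) (degree g)"
  have "degree f \<le> n" "degree g \<le> n" "degree (f + g) \<le> n"
    using degree_add_le_max[of f g] by (auto simp: n_def)
  then show ?thesis by (simp add: moment_functional_eq[of _ n] sum.distrib algebra_simps)
qed

lemma moment_functional_smult: "moment_functional c (smult a f) = a * moment_functional c f"
  by (cases "a = 0") (simp_all add: moment_functional_def sum_distrib_left mult.assoc)

lemma moment_functional_0 [simp]: "moment_functional c 0 = 0" by (simp add: moment_functional_def)

lemma moment_functional_sum: "moment_functional c (sum f S) = (\<Sum>i\<in>S. moment_functional c (f i))"
  by (induction S rule: infinite_finite_induct) (simp_all add: moment_functional_add)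

lemma moment_functional_monom: "moment_functional c (monom a n) = a * c n"
  using moment_functional_eq[OF degree_monom_le, of c a n] by (simp add: if_distrib[of "\<lambda>z. z * _"] cong: if_cong)

lemma moment_functional_square: "moment_functional c (w * f\<^sup>2) = (\<Sum>i\<le>degree f. \<Sum>j\<le>degree f. moment_functional c (w * monom 1 (i + j)) * coeff f i * coeff f j)"
proof -
  have f: "f = (\<Sum>i\<le>degree f. monom (coeff f i) i)" by (rule poly_as_sum_of_monoms[symmetric])
  have "w * f\<^sup>2 = w * ((\<Sum>i\<le>degree f. monom (coeff f i) i) * (\<Sum>i\<le>degree f. monom (coeff f i) i))"
    unfolding power2_eq_square f[symmetric] ..
  also have "\<dots> = (\<Sum>i\<le>degree f. \<Sum>j\<le>degree f. w * (monom (coeff f i) i * monom (coeff f j) j))"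
    by (subst sum_product) (simp only: sum_distrib_left)
  also have "\<dots> = (\<Sum>i\<le>degree f. \<Sum>j\<le>degree f. smult (coeff f i * coeff f j) (w * monom 1 (i + j)))"
  proof (intro sum.cong refl)
    fix i j
    have "monom (coeff f i) i * monom (coeff f j) j = smult (coeff f i * coeff f j) (monom 1 (i + j))"
      by (simp add: mult_monom smult_monom)
    then show "w * (monom (coeff f i) i * monom (coeff f j) j) = smult (coeff f i * coeff f j) (w * monom 1 (i + j))"
      by simp
  qed
  finally show ?thesis by (simp add: moment_functional_sum moment_functional_smult mult_ac)
qed

text \<open>
Depending on the parities of \<open>a\<close> and \<open>b\<close>, the polynomial is a square times one of the four weights.
\<close>
lemma hausdorff_nonneg:
  assumes "hausdorff_seq c"
  shows "0 \<le> moment_functional c ([:0, 1:] ^ a * [:1, -1:] ^ b)"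
proof -
  have m: "moment_functional c (monom 1 k) = c k" for k by (simp add: moment_functional_monom)
  have m1: "moment_functional c ([:0,1:] * monom 1 k) = c (Suc k)" for k
    by (simp add: monom_Suc[symmetric] moment_functional_monom)
  have m2: "moment_functional c ([:1,-1:] * monom 1 k) = c k - c (Suc k)" for k
  proof -
    have "[:1,-1:] * monom 1 k = monom 1 k + smult (-1) (monom (1::real) (Suc k))" by (simp add: monom_Suc)
    then show ?thesis by (simp only: moment_functional_add moment_functional_smult m)
  qed
  have m3: "moment_functional c ([:0,1:] * [:1,-1:] * monom 1 k) = c (Suc k) - c (Suc (Suc k))" for k
  proof -
    have "[:0,1:] * [:1,-1:] * monom 1 k = monom 1 (Suc k) + smult (-1) (monom (1::real) (Suc (Suc k)))"
      by (simp add: monom_Suc)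
    then show ?thesis by (simp only: moment_functional_add moment_functional_smult m)
  qed
  have sq: "0 \<le> moment_functional c (w * f\<^sup>2)" if "psd_hankel (\<lambda>k. moment_functional c (w * monom 1 k))" for w f
    unfolding moment_functional_square using that by (simp add: psd_hankel_def)
  define f where "f = [:0, 1:] ^ (a div 2) * [:1, -1::real:] ^ (b div 2)"
  have par: "[:0, 1:] ^ a * [:1, -1::real:] ^ b = (if even a then 1 else [:0,1:]) * (if even b then 1 else [:1,-1:]) * f\<^sup>2"
  proof -
    have sp: "z ^ n = (if even n then 1 else z) * (z ^ (n div 2))\<^sup>2" for z :: "real poly" and n
      by (cases "even n") (auto elim!: evenE oddE simp: power_mult[symmetric] mult.commute)
    show ?thesis unfolding f_def power_mult_distrib sp[of "[:0, 1:]" a] sp[of "[:1, -1:]" b]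
      by (simp only: mult_ac)
  qed
  have psds: "psd_hankel c" "psd_hankel (\<lambda>n. c (Suc n))" "psd_hankel (\<lambda>n. c n - c (Suc n))" "psd_hankel (\<lambda>n. c (Suc n) - c (Suc (Suc n)))"
    using assms by (auto simp: hausdorff_seq_def)
  show ?thesis unfolding par
    by (rule sq, cases "even a"; cases "even b"; simp only: if_True if_False mult_1_left mult_1_right m m1 m2 m3 psds)
qed

text \<open>
The Bernstein operator reproduces the power \<open>x\<^sup>j\<close> exactly if the sample \<open>(k / n)\<^sup>j\<close> is replaced by a ratio of
falling factorials: the binomial coefficient absorbs the ratio, and the binomial theorem sums the rest.
\<close>
lemma bernstein_falling:
  fixes n j :: nat
  assumes "j \<le> n"
  shows "(\<Sum>k\<le>n. smult (real (n choose k) * (\<Prod>i<j. (real k - real i) / (real n - real i)))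
      ([:0, 1:] ^ k * [:1, -1:] ^ (n - k))) = [:0, 1:] ^ j"
proof -
  have coef: "real (n choose k) * (\<Prod>i<j. (real k - real i) / (real n - real i))
      = (if j \<le> k then real ((n - j) choose (k - j)) else 0)" if "k \<le> n" for k
    using assms that
  proof (induction j)
    case 0
    then show ?case by simp
  next
    case (Suc j)
    show ?case
    proof (cases "j \<le> k")
      case True
      have "real (n choose k) * (\<Prod>i<Suc j. (real k - real i) / (real n - real i))
          = real ((n - j) choose (k - j)) * (real k - real j) / (real n - real j)"
        using Suc True by (simp add: mult.assoc[symmetric])
      also have "\<dots> = (if Suc j \<le> k then real ((n - Suc j) choose (k - Suc j)) else 0)"
      proof (cases "j = k")
        case False
        then obtain k' where k': "k = j + Suc k'" using True by (metis le_Suc_ex not0_implies_Suc add_0_right)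
        obtain n' where n': "n = j + Suc n'" using Suc.prems by (metis le_Suc_ex add_Suc_shift)
        have "Suc k' * (Suc n' choose Suc k') = Suc n' * (n' choose k')" by (rule Suc_times_binomial)
        then have "real (Suc k') * real (Suc n' choose Suc k') = real (Suc n') * real (n' choose k')"
          by (metis of_nat_mult)
        then show ?thesis unfolding k' n' by (simp add: field_simps del: binomial_Suc_Suc)
      qed simp
      finally show ?thesis .
    next
      case False
      then show ?thesis using Suc by simp
    qed
  qed
  have "(\<Sum>k\<le>n. smult (real (n choose k) * (\<Prod>i<j. (real k - real i) / (real n - real i)))
      ([:0, 1:] ^ k * [:1, -1:] ^ (n - k)))
      = (\<Sum>k\<in>{j..n}. smult (real ((n - j) choose (k - j))) ([:0, 1:] ^ k * [:1, -1:] ^ (n - k)))"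
    by (rule sum.mono_neutral_cong_right) (auto simp: coef)
  also have "\<dots> = (\<Sum>k\<le>n-j. smult (real ((n - j) choose k)) ([:0, 1:] ^ (k + j) * [:1, -1:] ^ (n - j - k)))"
    using assms by (intro sum.reindex_bij_witness[of _ "\<lambda>k. k + j" "\<lambda>k. k - j"]) auto
  also have "\<dots> = [:0, 1:] ^ j * (\<Sum>k\<le>n-j. of_nat ((n - j) choose k) * [:0, 1:] ^ k * [:1, -1:] ^ (n - j - k))"
    by (simp add: sum_distrib_left power_add mult_ac of_nat_poly)
  also have "\<dots> = [:0, 1:] ^ j * ([:0, 1:] + [:1, -1:]) ^ (n - j)"
    unfolding binomial_ring ..
  also have "[:0, 1:] + [:1, -1:] = (1 :: real poly)" by (simp add: one_pCons)
  finally show ?thesis by simp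
qed

text \<open>
Both sides are products of \<open>j\<close> factors of absolute value at most 1 that differ pairwise by \<open>O(j / n)\<close>. The assumption
\<open>2 * j \<le> n\<close> also covers small \<open>k\<close>, where the factors may be negative.
\<close>
lemma falling_approx:
  assumes "k \<le> n" "2 * j \<le> n" "0 < n"
  shows "\<bar>(\<Prod>i<j. (real k - real i) / (real n - real i)) - (real k / real n) ^ j\<bar> \<le> 2 * real j * real j / real n"
proof -
  have "norm ((\<Prod>i<j. (real k - real i) / (real n - real i)) - (\<Prod>i<j. real k / real n))
      \<le> (\<Sum>i<j. norm ((real k - real i) / (real n - real i) - real k / real n))"
  proof (rule norm_prod_diff)
    fix i assume i: "i \<in> {..<j}"
    have "\<bar>real k - real i\<bar> \<le> real n - real i" "real n - real i > 0" using i assms by auto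
    then show "norm ((real k - real i) / (real n - real i)) \<le> 1" by simp
    show "norm (real k / real n) \<le> 1" using assms by simp
  qed
  also have "\<dots> \<le> (\<Sum>i<j. 2 * real j / real n)"
  proof (rule sum_mono)
    fix i assume i: "i \<in> {..<j}"
    have pos: "real n - real i > 0" "real n > 0" using i assms by auto
    have "(real k - real i) / (real n - real i) - real k / real n = - (real i * (real n - real k)) / (real n * (real n - real i))"
      using pos by (simp add: field_simps)
    then have "norm ((real k - real i) / (real n - real i) - real k / real n) = (real i * (real n - real k)) / (real n * (real n - real i))"
      using pos assms by simp
    also have "\<dots> \<le> (real j * real n) / (real n * (real n / 2))"
      using pos i assms by (intro frac_le mult_mono) auto
    also have "\<dots> = 2 * real j / real n" using pos by (simp add: field_simps)
    finally show "norm ((real k - real i) / (real n - real i) - real k / real n) \<le> 2 * real j / real n" .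
  qed
  finally show ?thesis by (simp add: mult_ac)
qed

section \<open>The Hausdorff moment problem\<close>

text \<open>
Positivity on the Bernstein basis makes \<open>w n\<close> a probability distribution on the points \<open>k / n\<close>, and its moments converge to \<open>c\<close>.
\<close>
lemma bernstein_moments:
  fixes c :: "nat \<Rightarrow> real"
  assumes "hausdorff_seq c"
  defines "w \<equiv> \<lambda>n k. real (n choose k) * moment_functional c ([:0, 1:] ^ k * [:1, -1:] ^ (n - k))"
  shows "w n k \<ge> 0" "(\<Sum>k\<le>n. w n k) = 1"
    "(\<lambda>n. \<Sum>k\<le>n. w n k * (real k / real n) ^ j) \<longlonglongrightarrow> c j"
proof -
  show nonneg: "w n k \<ge> 0" for n k
    unfolding w_def by (intro mult_nonneg_nonneg hausdorff_nonneg assms) simp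
  have ff: "(\<Sum>k\<le>n. w n k * (\<Prod>i<j. (real k - real i) / (real n - real i))) = c j" if "j \<le> n" for n j
  proof -
    have "moment_functional c ([:0, 1:] ^ j) = (\<Sum>k\<le>n. w n k * (\<Prod>i<j. (real k - real i) / (real n - real i)))"
      unfolding bernstein_falling[OF that, symmetric] moment_functional_sum moment_functional_smult w_def by (simp add: mult_ac)
    moreover have "[:0, 1:] ^ j = monom (1::real) j" by (simp add: monom_altdef)
    ultimately show ?thesis by (simp add: moment_functional_monom)
  qed
  show one: "(\<Sum>k\<le>n. w n k) = 1" for n
    using ff[of 0 n] assms(1) by (simp add: hausdorff_seq_def)
  have "(\<lambda>n. (\<Sum>k\<le>n. w n k * (real k / real n) ^ j) - c j) \<longlonglongrightarrow> 0"
  proof (rule Lim_null_comparison)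
    show "\<forall>\<^sub>F n in sequentially. norm ((\<Sum>k\<le>n. w n k * (real k / real n) ^ j) - c j) \<le> 2 * real j * real j / real n"
    proof (rule eventually_sequentiallyI[of "2 * j + 1"])
      fix n assume n: "2 * j + 1 \<le> n"
      let ?f = "\<lambda>k. \<Prod>i<j. (real k - real i) / (real n - real i)"
      have "norm ((\<Sum>k\<le>n. w n k * (real k / real n) ^ j) - c j)
          = \<bar>\<Sum>k\<le>n. w n k * ((real k / real n) ^ j - ?f k)\<bar>"
        using n by (simp add: ff[of j n, symmetric] sum_subtractf right_diff_distrib)
      also have "\<dots> \<le> (\<Sum>k\<le>n. w n k * (2 * real j * real j / real n))"
      proof (rule order.trans[OF sum_abs], rule sum_mono)
        fix k assume k: "k \<in> {..n}"
        have "\<bar>(real k / real n) ^ j - ?f k\<bar> \<le> 2 * real j * real j / real n"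
          using falling_approx[of k n j] n k by (simp add: abs_minus_commute)
        then show "\<bar>w n k * ((real k / real n) ^ j - ?f k)\<bar> \<le> w n k * (2 * real j * real j / real n)"
          by (simp only: abs_mult abs_of_nonneg[OF nonneg] mult_left_mono[OF _ nonneg])
      qed
      also have "\<dots> = 2 * real j * real j / real n"
        by (simp only: sum_distrib_right[symmetric] one mult_1_left)
      finally show "norm ((\<Sum>k\<le>n. w n k * (real k / real n) ^ j) - c j) \<le> 2 * real j * real j / real n" .
    qed
    show "(\<lambda>n. 2 * real j * real j / real n) \<longlonglongrightarrow> 0"
      by (rule tendsto_divide_0[OF tendsto_const]) (auto intro: filterlim_real_sequentially filterlim_at_top_imp_at_infinity)
  qed
  then show "(\<lambda>n. \<Sum>k\<le>n. w n k * (real k / real n) ^ j) \<longlonglongrightarrow> c j"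
    by (simp add: LIM_zero_iff)
qed

text \<open>
By Helly's theorem a subsequence of the discrete Bernstein distributions converges weakly. Its limit has the moments \<open>c\<close>, and it is
carried by the unit interval because a bounded continuous function that vanishes exactly there has integral 0.
\<close>
theorem hausdorff_moment_problem:
  assumes "hausdorff_seq c"
  obtains \<mu> :: "real measure" where "prob_space \<mu>" "sets \<mu> = sets (restrict_space borel {0..1})" "moments \<mu> = c"
proof -
  define w where "w n k = real (n choose k) * moment_functional c ([:0, 1:] ^ k * [:1, -1:] ^ (n - k))" for n k
  note w = bernstein_moments[OF assms, folded w_def]
  define M where "M n = distr (point_measure {..n} (\<lambda>k. ennreal (w n k))) borel (\<lambda>k. real k / real n)" for n
  have pP: "prob_space (point_measure {..n} (\<lambda>k. ennreal (w n k)))" for n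
    using w by (intro prob_space_point_measure) auto
  have rM: "real_distribution (M n)" for n
    unfolding M_def real_distribution_def real_distribution_axioms_def
    by (intro conjI prob_space.prob_space_distr pP) auto
  have intM: "integral\<^sup>L (M n) f = (\<Sum>k\<le>n. w n k * f (real k / real n))"
    if "f \<in> borel_measurable borel" for f :: "real \<Rightarrow> real" and n
    unfolding M_def using that w(1)
    by (subst integral_distr) (simp_all add: lebesgue_integral_point_measure_finite)
  have t: "tight M"
    unfolding tight_def
  proof (intro conjI allI impI rM)
    fix e :: real assume e: "e > 0"
    have "measure (M n) {-1<..2} = 1" for n
    proof -
      interpret P: prob_space "point_measure {..n} (\<lambda>k. ennreal (w n k))" by (rule pP)
      have "(\<lambda>k. real k / real n) -` {-1<..2} \<inter> space (point_measure {..n} (\<lambda>k. ennreal (w n k))) = space (point_measure {..n} (\<lambda>k. ennreal (w n k)))"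
        by (auto simp: space_point_measure divide_le_eq intro!: order.strict_trans2[OF _ divide_nonneg_nonneg])
      then show ?thesis unfolding M_def by (subst measure_distr) (simp_all add: P.prob_space)
    qed
    then show "\<exists>a b. a < b \<and> (\<forall>n. 1 - e < measure (M n) {a<..b})"
      using e by (intro exI[of _ "-1"] exI[of _ 2]) auto
  qed
  obtain r N where r: "strict_mono r" and N: "real_distribution N" and conv: "weak_conv_m (M \<circ> r) N"
    using tight_imp_convergent_subsubsequence[OF t strict_mono_id] by auto
  interpret N: real_distribution N by (rule N)
  have lim: "(\<lambda>n. integral\<^sup>L (M (r n)) f) \<longlonglongrightarrow> integral\<^sup>L N f"
    if "\<And>x. isCont f x" "\<And>x. norm (f x) \<le> B" for f :: "real \<Rightarrow> real" and B
    using weak_conv_imp_integral_bdd_continuous_conv[OF _ N conv that] rM by simp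
  \<comment> \<open>Weak convergence tests bounded functions only, so the powers are cut off outside the unit interval.\<close>
  define u where "u x = max 0 (min 1 x)" for x :: real
  have u: "u (real k / real n) = real k / real n" if "k \<le> n" for k n
    using that by (cases "n = 0") (auto simp: u_def min_def divide_le_eq)
  have ucont: "isCont u x" for x unfolding u_def by (intro continuous_intros)
  have um [measurable]: "u \<in> borel_measurable borel" unfolding u_def[abs_def] by measurable
  have ub: "0 \<le> u x" "u x \<le> 1" for x by (auto simp: u_def)
  have mN: "(LINT x|N. u x ^ j) = c j" for j
  proof (rule LIMSEQ_unique)
    show "(\<lambda>n. LINT x|M (r n). u x ^ j) \<longlonglongrightarrow> (LINT x|N. u x ^ j)"
      by (rule lim[of _ 1]) (auto intro!: continuous_intros ucont simp: power_abs ub power_le_one)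
    have "(LINT x|M n. u x ^ j) = (\<Sum>k\<le>n. w n k * (real k / real n) ^ j)" for n
      by (subst intM) (simp_all add: u)
    then show "(\<lambda>n. LINT x|M (r n). u x ^ j) \<longlonglongrightarrow> c j"
      using LIMSEQ_subseq_LIMSEQ[OF w(3) r] by (simp add: comp_def)
  qed
  have "AE x in N. x \<in> {0..1}"
  proof -
    define h where "h x = min 1 \<bar>x - u x\<bar>" for x
    have hb: "norm (h x) \<le> 1" for x by (auto simp: h_def)
    have hm[measurable]: "h \<in> borel_measurable borel" unfolding h_def[abs_def] by measurable
    have "(\<lambda>n. integral\<^sup>L (M (r n)) h) \<longlonglongrightarrow> integral\<^sup>L N h"
      by (rule lim[OF _ hb]) (auto simp: h_def intro!: continuous_intros ucont)
    moreover have "integral\<^sup>L (M n) h = 0" for n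
      by (subst intM) (simp_all add: hm u h_def)
    ultimately have "integral\<^sup>L N h = 0" by (simp add: LIMSEQ_const_iff)
    moreover have "integrable N h"
      by (rule N.integrable_const_bound[of _ 1]) (use hb in auto)
    ultimately have "AE x in N. h x = 0"
      by (subst (asm) integral_nonneg_eq_0_iff_AE) (auto simp: h_def)
    then show ?thesis by eventually_elim (auto simp: h_def u_def split: if_splits)
  qed
  then have AE01: "AE x in N. x \<in> {0..1}" .
  have e1: "emeasure N {0..1} = 1"
    using N.prob_eq_1[of "{0..1}"] AE01 by (simp add: N.emeasure_eq_measure)
  show thesis
  proof (rule that[of "restrict_space N {0..1}"])
    show "prob_space (restrict_space N {0..1})" using e1 by (intro prob_space_restrict_space) auto
    show "sets (restrict_space N {0..1}) = sets (restrict_space borel {0..1})"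
      by (simp add: sets_restrict_space)
    show "moments (restrict_space N {0..1}) = c"
    proof
      fix j
      have "moments (restrict_space N {0..1}) j = (LINT x|N. indicator {0..1} x *\<^sub>R x ^ j)"
        unfolding moments_def by (rule integral_restrict_space) simp
      also have "\<dots> = (LINT x|N. u x ^ j)"
      proof (rule integral_cong_AE)
        show "AE x in N. indicator {0..1} x *\<^sub>R x ^ j = u x ^ j"
          using AE01 by eventually_elim (auto simp: u_def)
      qed auto
      finally show "moments (restrict_space N {0..1}) j = c j" by (simp add: mN)
    qed
  qed
qed

section \<open>Slices of the moment space\<close>

lemma fps_inverse_rec:
  fixes F :: "real fps"
  assumes "fps_nth F 0 = 1"
  shows "fps_nth (inverse F) 0 = 1"
    "fps_nth (inverse F) (Suc n) = - (\<Sum>i\<le>n. fps_nth (inverse F) i * fps_nth F (Suc n - i))"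
proof -
  show "fps_nth (inverse F) 0 = 1" using assms by simp
  have "0 = fps_nth (inverse F * F) (Suc n)" using assms by (simp add: inverse_mult_eq_1)
  also have "\<dots> = (\<Sum>i\<le>n. fps_nth (inverse F) i * fps_nth F (Suc n - i)) + fps_nth (inverse F) (Suc n)"
    by (simp only: fps_mult_nth atLeast0AtMost sum.atMost_Suc diff_self_eq_0 assms mult_1_right)
  finally show "fps_nth (inverse F) (Suc n) = - (\<Sum>i\<le>n. fps_nth (inverse F) i * fps_nth F (Suc n - i))"
    by linarith
qed

lemma fps_inverse_cong_below:
  fixes F G :: "real fps"
  assumes "fps_nth F 0 = 1" "fps_nth G 0 = 1" "\<And>i. i \<le> k \<Longrightarrow> fps_nth F i = fps_nth G i"
  shows "fps_nth (inverse F) k = fps_nth (inverse G) k"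
  using assms(3)
proof (induction k rule: less_induct)
  case (less k)
  show ?case
  proof (cases k)
    case 0
    then show ?thesis using assms by simp
  next
    case (Suc n)
    have "fps_nth (inverse F) i * fps_nth F (Suc n - i) = fps_nth (inverse G) i * fps_nth G (Suc n - i)"
      if "i \<le> n" for i
      using less.IH[of i] less.prems that Suc by simp
    then show ?thesis unfolding Suc fps_inverse_rec(2)[OF assms(1)] fps_inverse_rec(2)[OF assms(2)]
      by (intro arg_cong[where f=uminus] sum.cong refl) simp
  qed
qed

text \<open>
The highest coefficient enters the inverse linearly with slope \<open>-1\<close>. This makes the Moebius map triangular and affine in
its last argument.
\<close>
lemma fps_inverse_top:
  fixes F G :: "real fps"
  assumes "fps_nth F 0 = 1" "fps_nth G 0 = 1" "\<And>i. i \<le> k \<Longrightarrow> fps_nth F i = fps_nth G i"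
  shows "fps_nth (inverse F) (Suc k) - fps_nth (inverse G) (Suc k) = fps_nth G (Suc k) - fps_nth F (Suc k)"
proof -
  have *: "fps_nth (inverse H) (Suc k) = - fps_nth H (Suc k) - (\<Sum>i=1..k. fps_nth (inverse H) i * fps_nth H (Suc k - i))"
    if "fps_nth H 0 = 1" for H :: "real fps"
  proof -
    have "{..k} = insert 0 {1..k}" by auto
    then show ?thesis unfolding fps_inverse_rec(2)[OF that] by (simp add: that)
  qed
  have "(\<Sum>i=1..k. fps_nth (inverse F) i * fps_nth F (Suc k - i)) = (\<Sum>i=1..k. fps_nth (inverse G) i * fps_nth G (Suc k - i))"
    using assms fps_inverse_cong_below[OF assms(1,2)] by (intro sum.cong refl) auto
  then show ?thesis unfolding *[OF assms(1)] *[OF assms(2)] by simp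
qed

lemma fps_inverse_measurable:
  fixes F :: "'a \<Rightarrow> real fps"
  assumes "\<And>x. fps_nth (F x) 0 = 1" "\<And>i. i \<le> k \<Longrightarrow> (\<lambda>x. fps_nth (F x) i) \<in> borel_measurable M"
  shows "(\<lambda>x. fps_nth (inverse (F x)) k) \<in> borel_measurable M"
  using assms(2)
proof (induction k rule: less_induct)
  case (less k)
  show ?case
  proof (cases k)
    case 0
    then show ?thesis using assms(1) by simp
  next
    case (Suc n)
    have "(\<lambda>x. - (\<Sum>i\<le>n. fps_nth (inverse (F x)) i * fps_nth (F x) (Suc n - i))) \<in> borel_measurable M"
      using less Suc by (intro borel_measurable_uminus borel_measurable_sum borel_measurable_times) auto
    then show ?thesis unfolding Suc fps_inverse_rec(2)[OF assms(1)] .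
  qed
qed

text \<open>
\<open>(1 - p) + p * (1 - X) * D\<close>, the denominator of the Moebius transformation of \<open>D\<close>, for a series \<open>D\<close> with constant coefficient
1. The constant coefficient is set separately, which makes the denominator invertible for any \<open>d\<close>.
\<close>
definition moebius_denom :: "real \<Rightarrow> (nat \<Rightarrow> real) \<Rightarrow> real fps" where
  "moebius_denom p d = Abs_fps (\<lambda>i. if i = 0 then 1 else p * (d i - d (i - 1)))"

text \<open>
\<open>(1 - (1 - X) * C) / ((1 - p) * X)\<close>, which is the inverse of the denominator \<open>moebius_denom\<close> when \<open>C\<close> is the transform
of \<open>D\<close>.
\<close>
definition moebius_quot :: "real \<Rightarrow> (nat \<Rightarrow> real) \<Rightarrow> real fps" where
  "moebius_quot p c = Abs_fps (\<lambda>i. if i = 0 then 1 else (c i - c (Suc i)) / (1 - p))"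

text \<open>
The coefficients of the Moebius transform \<open>(p D + 1 - p) / (p (1 - X) D + 1 - p)\<close> of a series \<open>D\<close> with constant
coefficient 1.
\<close>
definition moebius :: "real \<Rightarrow> (nat \<Rightarrow> real) \<Rightarrow> nat \<Rightarrow> real" where
  "moebius p d k = 1 - (1 - p) * (\<Sum>i<k. fps_nth (inverse (moebius_denom p d)) i)"

definition moebius_inv :: "real \<Rightarrow> (nat \<Rightarrow> real) \<Rightarrow> nat \<Rightarrow> real" where
  "moebius_inv p c k = 1 + (\<Sum>i<k. fps_nth (inverse (moebius_quot p c)) (Suc i)) / p"

lemma moebius_denom_0 [simp]: "fps_nth (moebius_denom p d) 0 = 1" and moebius_quot_0 [simp]: "fps_nth (moebius_quot p c) 0 = 1"
  by (simp_all add: moebius_denom_def moebius_quot_def)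

lemma moebius_0 [simp]: "moebius p d 0 = 1" and moebius_1 [simp]: "moebius p d (Suc 0) = p"
  by (simp_all add: moebius_def)

lemma moebius_inv_0 [simp]: "moebius_inv p c 0 = 1" by (simp add: moebius_inv_def)

lemma moebius_cong:
  assumes "\<And>i. i < k \<Longrightarrow> d i = d' i"
  shows "moebius p d k = moebius p d' k"
proof -
  have "fps_nth (inverse (moebius_denom p d)) i = fps_nth (inverse (moebius_denom p d')) i" if "i < k" for i
    using that assms by (intro fps_inverse_cong_below) (auto simp: moebius_denom_def)
  then show ?thesis by (simp add: moebius_def)
qed

lemma moebius_inv_cong:
  assumes "\<And>i. i \<le> Suc k \<Longrightarrow> c i = c' i"
  shows "moebius_inv p c k = moebius_inv p c' k"
proof -
  have "fps_nth (inverse (moebius_quot p c)) (Suc i) = fps_nth (inverse (moebius_quot p c')) (Suc i)" if "i < k" for i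
    using that assms by (intro fps_inverse_cong_below) (auto simp: moebius_quot_def)
  then show ?thesis by (simp add: moebius_inv_def)
qed

text \<open>
The source of the Jacobian: the coefficient of index \<open>k + 2\<close> depends on the last entry \<open>d (k + 1)\<close> with
slope \<open>p * (1 - p)\<close>.
\<close>
lemma moebius_affine:
  "moebius p d (Suc (Suc k)) = p * (1 - p) * d (Suc k) + moebius p (d(Suc k := 0)) (Suc (Suc k))"
proof -
  let ?d = "d(Suc k := 0)"
  have b: "fps_nth (moebius_denom p d) i = fps_nth (moebius_denom p ?d) i" if "i \<le> k" for i
    using that by (simp add: moebius_denom_def)
  have "fps_nth (inverse (moebius_denom p d)) i = fps_nth (inverse (moebius_denom p ?d)) i" if "i < Suc k" for i
    using that b by (intro fps_inverse_cong_below) auto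
  then have s: "(\<Sum>i<Suc k. fps_nth (inverse (moebius_denom p d)) i) = (\<Sum>i<Suc k. fps_nth (inverse (moebius_denom p ?d)) i)"
    by (intro sum.cong) auto
  have "fps_nth (inverse (moebius_denom p d)) (Suc k) - fps_nth (inverse (moebius_denom p ?d)) (Suc k) = - p * d (Suc k)"
    by (subst fps_inverse_top[OF moebius_denom_0 moebius_denom_0 b]) (auto simp: moebius_denom_def algebra_simps)
  then have t: "fps_nth (inverse (moebius_denom p d)) (Suc k) = fps_nth (inverse (moebius_denom p ?d)) (Suc k) - p * d (Suc k)" by simp
  show ?thesis unfolding moebius_def sum.lessThan_Suc[of _ "Suc k"] s t by (simp add: algebra_simps)
qed

lemma moebius_moebius_inv:
  assumes "p \<noteq> 0" "p \<noteq> 1" "c 0 = 1" "c (Suc 0) = p"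
  shows "moebius p (moebius_inv p c) = c"
proof
  fix k
  have "moebius_denom p (moebius_inv p c) = inverse (moebius_quot p c)"
  proof (rule fps_ext)
    fix i show "fps_nth (moebius_denom p (moebius_inv p c)) i = fps_nth (inverse (moebius_quot p c)) i"
      using assms by (cases i) (auto simp: moebius_denom_def moebius_inv_def add_divide_distrib)
  qed
  then have "inverse (moebius_denom p (moebius_inv p c)) = moebius_quot p c" by (simp add: fps_inverse_idempotent)
  then have "moebius p (moebius_inv p c) k = 1 - (1 - p) * (\<Sum>i<k. (c i - c (Suc i)) / (1 - p))"
    unfolding moebius_def using assms by (auto simp: moebius_quot_def intro!: sum.cong)
  also have "\<dots> = 1 - (\<Sum>i<k. c i - c (Suc i))"
    using assms by (simp add: sum_divide_distrib[symmetric])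
  also have "\<dots> = c k" using assms by (simp add: sum_lessThan_telescope')
  finally show "moebius p (moebius_inv p c) k = c k" .
qed

lemma moebius_inv_moebius:
  assumes "p \<noteq> 0" "p \<noteq> 1" "d 0 = 1"
  shows "moebius_inv p (moebius p d) = d"
proof
  fix k
  have "moebius_quot p (moebius p d) = inverse (moebius_denom p d)"
  proof (rule fps_ext)
    fix i show "fps_nth (moebius_quot p (moebius p d)) i = fps_nth (inverse (moebius_denom p d)) i"
      using assms by (cases i) (auto simp: moebius_quot_def moebius_def field_simps)
  qed
  then have "inverse (moebius_quot p (moebius p d)) = moebius_denom p d" by (simp add: fps_inverse_idempotent)
  then have "moebius_inv p (moebius p d) k = 1 + (\<Sum>i<k. p * (d (Suc i) - d i)) / p"
    unfolding moebius_inv_def by (simp add: moebius_denom_def)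
  also have "\<dots> = 1 + (\<Sum>i<k. d (Suc i) - d i)"
    using assms by (simp add: sum_distrib_left[symmetric])
  also have "\<dots> = d k" using assms by (simp add: sum_lessThan_telescope)
  finally show "moebius_inv p (moebius p d) k = d k" .
qed

lemma hausdorff_moebius_iff:
  assumes "0 < p" "p < 1" "d 0 = 1"
  shows "hausdorff_seq (moebius p d) \<longleftrightarrow> hausdorff_seq d"
proof -
  have g: "fps_const (1 - p) + fps_const p * (1 - fps_X) * Abs_fps d = moebius_denom p d"
  proof (rule fps_ext)
    fix i show "fps_nth (fps_const (1 - p) + fps_const p * (1 - fps_X) * Abs_fps d) i = fps_nth (moebius_denom p d) i"
      using assms by (cases i) (simp_all add: moebius_denom_def mult.assoc left_diff_distrib right_diff_distrib)
  qed
  have c: "1 - (1 - fps_X) * Abs_fps (moebius p d) = fps_const (1 - p) * fps_X * inverse (moebius_denom p d)"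
  proof (rule fps_ext)
    fix i show "fps_nth (1 - (1 - fps_X) * Abs_fps (moebius p d)) i = fps_nth (fps_const (1 - p) * fps_X * inverse (moebius_denom p d)) i"
      by (cases i) (simp_all add: moebius_def mult.assoc left_diff_distrib algebra_simps)
  qed
  have "moebius_denom p d * inverse (moebius_denom p d) = 1" by (rule inverse_mult_eq_1') simp
  then have "moebius_denom p d * (fps_const (1 - p) * fps_X * inverse (moebius_denom p d)) = fps_const (1 - p) * fps_X"
    by (metis mult.left_commute mult.right_neutral)
  then have "hausdorff_seq (fps_nth (Abs_fps (moebius p d))) \<longleftrightarrow> hausdorff_seq (fps_nth (Abs_fps d))"
    using assms by (intro hausdorff_moebius[of p]) (simp_all add: g c)
  moreover have "fps_nth (Abs_fps f) = f" for f :: "nat \<Rightarrow> real" by auto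
  ultimately show ?thesis by (simp only:)
qed

text \<open>
The moments of order 1 to \<open>n\<close> on the index set \<open>{a..<a + n}\<close>. With a movable offset, the slices of the
moment space are again of this form without any renaming of coordinates.
\<close>
definition moment_points :: "nat \<Rightarrow> nat \<Rightarrow> (nat \<Rightarrow> real) set" where
  "moment_points a n = (\<lambda>c. \<lambda>i\<in>{a..<a+n}. c (i + 1 - a)) ` {c. hausdorff_seq c}"

lemma moment_space_eq: "moment_space n = moment_points 1 n"
proof -
  have ivl: "{1..<1 + n} = {1..n}" by auto
  have "moment_space n = (\<lambda>c. restrict c {1..n}) ` (moments ` {\<mu>. prob_space \<mu> \<and> sets \<mu> = sets (restrict_space borel {0..1})})"
    unfolding moment_space_def moments_def[abs_def] setcompr_eq_image image_image ..
  also have "moments ` {\<mu>. prob_space \<mu> \<and> sets \<mu> = sets (restrict_space borel {0..1})} = {c. hausdorff_seq c}"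
  proof (intro set_eqI iffI)
    fix c assume "c \<in> {c. hausdorff_seq c}"
    then obtain \<mu> where "prob_space \<mu>" "sets \<mu> = sets (restrict_space borel {0..1})" "moments \<mu> = c"
      using hausdorff_moment_problem by blast
    then show "c \<in> moments ` {\<mu>. prob_space \<mu> \<and> sets \<mu> = sets (restrict_space borel {0..1})}" by blast
  qed (auto intro: hausdorff_moments)
  finally show ?thesis unfolding moment_points_def ivl by (simp only: add_diff_cancel_right')
qed

definition prepend_1 :: "nat \<Rightarrow> (nat \<Rightarrow> real) \<Rightarrow> nat \<Rightarrow> real" where
  "prepend_1 a e k = (if k = 0 then 1 else e (a + k - 1))"

lemma hausdorff_differences:
  assumes "hausdorff_seq c"
  shows "0 \<le> c k" "c (Suc k) \<le> c k" "c (Suc k) - c (Suc (Suc k)) \<le> c k - c (Suc k)"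
proof -
  have m: "[:0, 1:] ^ k = monom (1::real) k" by (simp add: monom_altdef)
  have s: "moment_functional c (monom 1 k * [:1, -1:]) = c k - c (Suc k)" for k
  proof -
    have "monom 1 k * [:1, -1:] = monom 1 k + monom (-1::real) (Suc k)" by (simp add: monom_Suc minus_monom)
    then show ?thesis by (simp only: moment_functional_add moment_functional_monom)
  qed
  show "0 \<le> c k" using hausdorff_nonneg[OF assms, of k 0] by (simp add: m moment_functional_monom)
  show "c (Suc k) \<le> c k" using hausdorff_nonneg[OF assms, of k 1] by (simp only: m s power_one_right)
  have "[:1, -1:] ^ 2 = [:1, -1:] + smult (-1) ([:0, 1:] * [:1, -1 :: real:])"
    by (simp add: power2_eq_square)
  moreover have "monom (1::real) (Suc k) = [:0, 1:] * monom 1 k" by (simp add: monom_Suc)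
  ultimately have "monom 1 k * [:1, -1:] ^ 2 = monom 1 k * [:1, -1:] + smult (-1) (monom (1::real) (Suc k) * [:1, -1:])"
    by (simp only: distrib_left mult_smult_right mult_ac)
  then show "c (Suc k) - c (Suc (Suc k)) \<le> c k - c (Suc k)"
    using hausdorff_nonneg[OF assms, of k 2] by (simp only: m moment_functional_add moment_functional_smult s) simp
qed

text \<open>
A first moment 0 or 1 forces the point mass at 0 or 1. So the part of the moment space not covered by the slices
\<open>0 < p < 1\<close> has at most two points.
\<close>
lemma hausdorff_degenerate:
  assumes c: "hausdorff_seq c"
  shows "c (Suc 0) \<in> {0..1}" "c (Suc 0) = 0 \<Longrightarrow> c (Suc k) = 0" "c (Suc 0) = 1 \<Longrightarrow> c k = 1"
proof -
  have c0: "c 0 = 1" using c by (simp add: hausdorff_seq_def)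
  note d = hausdorff_differences[OF c]
  show "c (Suc 0) \<in> {0..1}" using d(1)[of "Suc 0"] d(2)[of 0] c0 by simp
  show "c (Suc k) = 0" if "c (Suc 0) = 0"
  proof (induction k)
    case (Suc k)
    then show ?case using d(1)[of "Suc (Suc k)"] d(2)[of "Suc k"] by simp
  qed (rule that)
  show "c k = 1" if "c (Suc 0) = 1"
  proof -
    have z: "c k - c (Suc k) = 0" for k
    proof (induction k)
      case (Suc k)
      then show ?case using d(2)[of "Suc k"] d(3)[of k] by simp
    qed (simp add: that c0)
    show ?thesis
    proof (induction k)
      case (Suc k)
      then show ?case using z[of k] by simp
    qed (rule c0)
  qed
qed

text \<open>
The inverse of the slice parametrisation: the first coordinate of \<open>e\<close> is the parameter \<open>p\<close>, and the transformed moments are placed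
on the remaining coordinates.
\<close>
definition slice_inverse :: "nat \<Rightarrow> nat \<Rightarrow> (nat \<Rightarrow> real) \<Rightarrow> nat \<Rightarrow> real" where
  "slice_inverse a n e = (\<lambda>i\<in>{Suc a..<Suc a + n}. moebius_inv (e a) (prepend_1 a e) (i - a))"

text \<open>
A point of the moment space is a truncated moment sequence. A full sequence extending it can be transformed, and
truncation is compatible with the Moebius transformation because the latter is triangular.
\<close>
lemma moment_points_slice_iff:
  assumes p: "0 < e a" "e a < 1" and e: "e \<in> extensional {a..<a + Suc n}"
  shows "e \<in> moment_points a (Suc n) \<longleftrightarrow> slice_inverse a n e \<in> moment_points (Suc a) n"
proof
  assume "e \<in> moment_points a (Suc n)"
  then obtain c where ec: "e = (\<lambda>i\<in>{a..<a + Suc n}. c (i + 1 - a))" and "c \<in> {c. hausdorff_seq c}"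
    unfolding moment_points_def by (rule imageE)
  then have c: "hausdorff_seq c" by simp
  have c1: "c (Suc 0) = e a" "c 0 = 1" using c unfolding ec hausdorff_seq_def by simp_all
  define d where "d = moebius_inv (e a) c"
  have d0: "d 0 = 1" by (simp add: d_def)
  have "moebius (e a) d = c" unfolding d_def using p c1 by (intro moebius_moebius_inv) auto
  then have hd: "hausdorff_seq d" using hausdorff_moebius_iff[of "e a" d, OF p d0] c by simp
  have eq: "slice_inverse a n e = (\<lambda>i\<in>{Suc a..<Suc a + n}. d (i + 1 - Suc a))"
    unfolding slice_inverse_def d_def
  proof (rule restrict_ext)
    fix i assume i: "i \<in> {Suc a..<Suc a + n}"
    have s: "prepend_1 a e j = c j" if "j \<le> Suc (i - a)" for j
      using that i c1(2) by (cases j) (auto simp: prepend_1_def ec)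
    have "i + 1 - Suc a = i - a" by simp
    then show "moebius_inv (e a) (prepend_1 a e) (i - a) = moebius_inv (e a) c (i + 1 - Suc a)"
      by (simp only:) (rule moebius_inv_cong, rule s)
  qed
  show "slice_inverse a n e \<in> moment_points (Suc a) n"
    unfolding moment_points_def by (rule image_eqI[where x = d], rule eq, rule CollectI, rule hd)
next
  assume "slice_inverse a n e \<in> moment_points (Suc a) n"
  then obtain d where ed: "slice_inverse a n e = (\<lambda>i\<in>{Suc a..<Suc a + n}. d (i + 1 - Suc a))" and "d \<in> {c. hausdorff_seq c}"
    unfolding moment_points_def by (rule imageE)
  then have d: "hausdorff_seq d" by simp
  have d0: "d 0 = 1" using d by (simp add: hausdorff_seq_def)
  have hc: "hausdorff_seq (moebius (e a) d)" using hausdorff_moebius_iff[of "e a" d, OF p d0] d by simp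
  have dk: "moebius_inv (e a) (prepend_1 a e) k = d k" if "k \<le> n" for k
  proof (cases k)
    case 0
    then show ?thesis by (simp add: d0)
  next
    case (Suc j)
    then show ?thesis using fun_cong[OF ed, of "a + k"] that by (simp add: slice_inverse_def)
  qed
  have m: "moebius (e a) (moebius_inv (e a) (prepend_1 a e)) = prepend_1 a e"
    using p by (intro moebius_moebius_inv) (auto simp: prepend_1_def)
  have eq: "e = (\<lambda>i\<in>{a..<a + Suc n}. moebius (e a) d (i + 1 - a))"
  proof
    fix i
    show "e i = (\<lambda>i\<in>{a..<a + Suc n}. moebius (e a) d (i + 1 - a)) i"
    proof (cases "i \<in> {a..<a + Suc n}")
      case True
      have "moebius (e a) d (i + 1 - a) = moebius (e a) (moebius_inv (e a) (prepend_1 a e)) (i + 1 - a)"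
        using True dk by (intro moebius_cong) auto
      also have "\<dots> = e i" unfolding m using True by (simp add: prepend_1_def)
      finally show ?thesis using True by simp
    next
      case False
      then have "e i = undefined" using e by (auto simp: extensional_def)
      then show ?thesis using False by (auto simp: restrict_def)
    qed
  qed
  show "e \<in> moment_points a (Suc n)"
    unfolding moment_points_def by (rule image_eqI[where x = "moebius (e a) d"], rule eq, rule CollectI, rule hc)
qed

lemma prepend_1_measurable:
  assumes "k \<le> n"
  shows "(\<lambda>e. prepend_1 a e k) \<in> borel_measurable (lborel_prod {a..<a + n})"
  using assms by (cases k) (auto simp: prepend_1_def intro!: measurable_component_singleton[THEN measurable_compose])

lemma slice_inverse_measurable: "slice_inverse a n \<in> measurable (lborel_prod {a..<a + Suc n}) (lborel_prod {Suc a..<Suc a + n})"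
  unfolding slice_inverse_def
proof (rule measurable_restrict)
  fix i assume i: "i \<in> {Suc a..<Suc a + n}"
  have ea: "(\<lambda>e. e a) \<in> borel_measurable (lborel_prod {a..<a + Suc n})"
    by (rule measurable_compose[OF measurable_component_singleton]) auto
  have "(\<lambda>e. moebius_inv (e a) (prepend_1 a e) (i - a)) \<in> borel_measurable (lborel_prod {a..<a + Suc n})"
    unfolding moebius_inv_def
  proof (intro borel_measurable_add borel_measurable_const borel_measurable_divide borel_measurable_sum ea fps_inverse_measurable)
    fix j l assume "j \<in> {..<i - a}" "l \<le> Suc j"
    then have "l \<le> Suc n" "Suc l \<le> Suc n" using i by auto
    then show "(\<lambda>e. fps_nth (moebius_quot (e a) (prepend_1 a e)) l) \<in> borel_measurable (lborel_prod {a..<a + Suc n})"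
      unfolding moebius_quot_def using ea prepend_1_measurable[of l "Suc n" a] prepend_1_measurable[of "Suc l" "Suc n" a]
      by simp
  qed simp
  then show "(\<lambda>e. moebius_inv (e a) (prepend_1 a e) (i - a)) \<in> measurable (lborel_prod {a..<a + Suc n}) lborel" by simp
qed

lemma moment_points_subset_space: "moment_points a n \<subseteq> space (lborel_prod {a..<a + n})"
  by (auto simp: moment_points_def space_PiM)

text \<open>
By induction along the slices: the preimage of a measurable set under the inverse parametrisation, plus at most two points.
\<close>
lemma moment_points_sets: "moment_points a n \<in> sets (lborel_prod {a..<a + n})"
proof (induction n arbitrary: a)
  case 0
  have "moment_points a 0 \<subseteq> {\<lambda>_. undefined}" by (auto simp: moment_points_def)
  then have "moment_points a 0 = {} \<or> moment_points a 0 = {\<lambda>_. undefined}" by (rule subset_singletonD)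
  then show ?case by (auto simp: sets_PiM_empty)
next
  case (Suc n)
  let ?M = "lborel_prod {a..<a + Suc n}"
  let ?int = "{e \<in> space ?M. 0 < e a \<and> e a < 1 \<and> slice_inverse a n e \<in> moment_points (Suc a) n}"
  let ?c = "\<lambda>x :: real. \<lambda>i\<in>{a..<a + Suc n}. x"
  have ea [measurable]: "(\<lambda>e. e a) \<in> borel_measurable ?M"
    by (rule measurable_compose[OF measurable_component_singleton]) auto
  note [measurable] = slice_inverse_measurable[of a n] Suc.IH[of "Suc a"]
  have int: "?int \<in> sets ?M" by measurable
  have "e \<in> {?c 0, ?c 1}" if "e \<in> moment_points a (Suc n)" "e \<notin> ?int" for e
  proof -
    from that(1) obtain c where ec: "e = (\<lambda>i\<in>{a..<a + Suc n}. c (i + 1 - a))" and "c \<in> {c. hausdorff_seq c}"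
      unfolding moment_points_def by (rule imageE)
    then have c: "hausdorff_seq c" by simp
    have ea: "e a = c (Suc 0)" by (simp add: ec)
    have "e \<in> space ?M" using that(1) moment_points_subset_space by blast
    then have "e \<in> extensional {a..<a + Suc n}" by (simp add: space_PiM PiE_def)
    then have "\<not> (0 < e a \<and> e a < 1)" using that moment_points_slice_iff[of e a n] \<open>e \<in> space ?M\<close> by blast
    then have "c (Suc 0) = 0 \<or> c (Suc 0) = 1" using hausdorff_degenerate(1)[OF c] ea by auto
    then show ?thesis
    proof
      assume z: "c (Suc 0) = 0"
      have "e = ?c 0" unfolding ec
        by (rule restrict_ext) (use hausdorff_degenerate(2)[OF c z] in \<open>auto simp: Suc_diff_le\<close>)
      then show ?thesis by blast
    next
      assume z: "c (Suc 0) = 1"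
      have "e = ?c 1" unfolding ec by (rule restrict_ext) (rule hausdorff_degenerate(3)[OF c z])
      then show ?thesis by blast
    qed
  qed
  then have sub: "moment_points a (Suc n) - ?int \<subseteq> {?c 0, ?c 1}" by blast
  have sing: "{?c x} \<in> sets ?M" for x
  proof -
    have s: "{?c x} = Pi\<^sub>E {a..<a + Suc n} (\<lambda>_. {x})" by (auto simp: PiE_iff extensional_def fun_eq_iff)
    show ?thesis unfolding s by (rule sets_PiM_I_finite) auto
  qed
  have diff: "moment_points a (Suc n) - ?int \<in> sets ?M"
  proof -
    have pair: "X \<in> sets ?M" if "X \<subseteq> {u, v}" "{u} \<in> sets ?M" "{v} \<in> sets ?M" for X u v
    proof -
      have "X \<inter> {u} \<in> sets ?M" "X \<inter> {v} \<in> sets ?M"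
        using that by (cases "u \<in> X"; cases "v \<in> X"; simp)+
      moreover have "X = (X \<inter> {u}) \<union> (X \<inter> {v})" using that(1) by blast
      ultimately show ?thesis by (metis sets.Un)
    qed
    show ?thesis by (rule pair[OF sub sing sing])
  qed
  have "?int \<subseteq> moment_points a (Suc n)"
    using moment_points_slice_iff[of _ a n] by (auto simp: space_PiM PiE_def)
  then have eq: "(moment_points a (Suc n) - ?int) \<union> ?int = moment_points a (Suc n)" by blast
  from sets.Un[OF diff int] show ?case unfolding eq .
qed

section \<open>The volume of the moment space\<close>

text \<open>
Substitution \<open>c i = \<alpha> i e * e i + g i e\<close>, where \<open>\<alpha> i\<close> and \<open>g i\<close> depend only on earlier coordinates. Integrating over the last
coordinate first, each step is an affine substitution on the line.
\<close>
lemma triangular_substitution: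
  fixes \<alpha> g :: "nat \<Rightarrow> (nat \<Rightarrow> real) \<Rightarrow> real"
  assumes nz: "\<And>i e. \<alpha> i e \<noteq> 0"
    and loc\<alpha>: "\<And>i e e'. (\<And>j. j \<in> {a..<i} \<Longrightarrow> e j = e' j) \<Longrightarrow> \<alpha> i e = \<alpha> i e'"
    and locg: "\<And>i e e'. (\<And>j. j \<in> {a..<i} \<Longrightarrow> e j = e' j) \<Longrightarrow> g i e = g i e'"
    and meas\<alpha>: "\<And>i. i \<in> {a..<a + n} \<Longrightarrow> \<alpha> i \<in> borel_measurable (lborel_prod {a..<i})"
    and measg: "\<And>i. i \<in> {a..<a + n} \<Longrightarrow> g i \<in> borel_measurable (lborel_prod {a..<i})"
    and F: "F \<in> borel_measurable (lborel_prod {a..<a + n})"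
  shows "(\<integral>\<^sup>+ c. F c \<partial>lborel_prod {a..<a + n})
    = (\<integral>\<^sup>+ e. F (\<lambda>i\<in>{a..<a + n}. \<alpha> i e * e i + g i e) * ennreal (\<Prod>i\<in>{a..<a + n}. \<bar>\<alpha> i e\<bar>) \<partial>lborel_prod {a..<a + n})"
  using meas\<alpha> measg F
proof (induction n arbitrary: F)
  case 0
  have "restrict f {} = (\<lambda>_. undefined)" for f :: "nat \<Rightarrow> real" by auto
  then show ?case by (simp add: PiM_empty nn_integral_count_space_finite)
next
  case (Suc n)
  let ?I = "{a..<a + n}" and ?b = "a + n" and ?J = "{a..<a + Suc n}"
  let ?P = "\<lambda>e. \<lambda>i\<in>?I. \<alpha> i e * e i + g i e"
  let ?A = "\<lambda>e. \<Prod>i\<in>?I. \<bar>\<alpha> i e\<bar>"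
  let ?P' = "\<lambda>e. \<lambda>i\<in>?J. \<alpha> i e * e i + g i e"
  let ?A' = "\<lambda>e. \<Prod>i\<in>?J. \<bar>\<alpha> i e\<bar>"
  have ins: "?J = insert ?b ?I" and nin: "?b \<notin> ?I" and fin: "finite ?I" by auto
  have extend: "h i \<in> borel_measurable (lborel_prod ?J)"
    if i: "i \<in> ?J" and m: "h i \<in> borel_measurable (lborel_prod {a..<i})"
      and l: "\<And>e e'. (\<And>j. j \<in> {a..<i} \<Longrightarrow> e j = e' j) \<Longrightarrow> h i e = h i e'"
    for i and h :: "nat \<Rightarrow> (nat \<Rightarrow> real) \<Rightarrow> real"
  proof -
    have "(\<lambda>e. restrict e {a..<i}) \<in> measurable (lborel_prod ?J) (lborel_prod {a..<i})"
      using i by (intro measurable_restrict_subset) auto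
    from measurable_compose[OF this m] have "(\<lambda>e. h i (restrict e {a..<i})) \<in> borel_measurable (lborel_prod ?J)" .
    moreover have "h i (restrict e {a..<i}) = h i e" for e by (rule l) simp
    ultimately show ?thesis by simp
  qed
  have m\<alpha>: "\<alpha> i \<in> borel_measurable (lborel_prod ?J)" and mg: "g i \<in> borel_measurable (lborel_prod ?J)" if "i \<in> ?J" for i
    using extend[OF that, of \<alpha>] extend[OF that, of g] Suc.prems(1,2) that loc\<alpha>[of i] locg[of i] by blast+
  have mc: "(\<lambda>e. e i) \<in> borel_measurable (lborel_prod ?J)" if "i \<in> ?J" for i
    using measurable_component_singleton[OF that, of "\<lambda>_. lborel"] by simp
  have mP': "?P' \<in> measurable (lborel_prod ?J) (lborel_prod ?J)"
    using m\<alpha> mg mc by (intro measurable_restrict) (auto intro!: borel_measurable_add borel_measurable_times)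
  have mA': "?A' \<in> borel_measurable (lborel_prod ?J)"
    using m\<alpha> by (intro borel_measurable_prod borel_measurable_abs) auto
  have mF': "(\<lambda>e. F (?P' e) * ennreal (?A' e)) \<in> borel_measurable (lborel_prod ?J)"
    using measurable_compose[OF mP' Suc.prems(3)] mA' by measurable
  have F2: "(\<lambda>(c, x). F (c(?b := x))) \<in> borel_measurable (lborel_prod ?I \<Otimes>\<^sub>M lborel)"
    using measurable_compose[OF measurable_add_dim[of ?b ?I "\<lambda>_. lborel"] Suc.prems(3)[unfolded ins]]
    by (simp add: case_prod_unfold del: fun_upd_apply)
  define G where "G c = (\<integral>\<^sup>+ x. F (c(?b := x)) \<partial>lborel)" for c
  have mG: "G \<in> borel_measurable (lborel_prod ?I)"
    unfolding G_def[abs_def] by (rule lborel.borel_measurable_nn_integral) (rule F2)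
  have step: "G (?P e) * ennreal (?A e) = (\<integral>\<^sup>+ x. F (?P' (e(?b := x))) * ennreal (?A' (e(?b := x))) \<partial>lborel)" for e
  proof -
    have fm: "(\<lambda>x. F ((?P e)(?b := x))) \<in> borel_measurable borel"
    proof -
      have "?P e \<in> space (lborel_prod ?I)" by (simp add: space_PiM)
      from measurable_compose[OF measurable_Pair1'[OF this] F2] show ?thesis by simp
    qed
    have locb: "\<alpha> i (e(?b := x)) = \<alpha> i e" "g i (e(?b := x)) = g i e" if "i \<in> ?J" for i x
      using that by (auto intro!: loc\<alpha> locg)
    have P': "?P' (e(?b := x)) = (?P e)(?b := g ?b e + \<alpha> ?b e * x)" for x
      by (rule ext) (use locb in auto)
    have A': "?A' (e(?b := x)) = \<bar>\<alpha> ?b e\<bar> * ?A e" for x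
    proof -
      have "?A' (e(?b := x)) = ?A' e" using locb by (intro prod.cong) auto
      then show ?thesis unfolding ins using nin fin by simp
    qed
    have A0: "0 \<le> ?A e" by (intro prod_nonneg) auto
    have "G (?P e) * ennreal (?A e)
        = (ennreal \<bar>\<alpha> ?b e\<bar> * (\<integral>\<^sup>+ x. F ((?P e)(?b := g ?b e + \<alpha> ?b e * x)) \<partial>lborel)) * ennreal (?A e)"
      unfolding G_def by (subst nn_integral_real_affine[OF fm nz[of ?b e], of "g ?b e"]) (rule refl)
    also have "\<dots> = (\<integral>\<^sup>+ x. F ((?P e)(?b := g ?b e + \<alpha> ?b e * x)) \<partial>lborel) * ennreal (\<bar>\<alpha> ?b e\<bar> * ?A e)"
      using A0 by (simp add: ennreal_mult mult_ac)
    also have "\<dots> = (\<integral>\<^sup>+ x. F ((?P e)(?b := g ?b e + \<alpha> ?b e * x)) * ennreal (\<bar>\<alpha> ?b e\<bar> * ?A e) \<partial>lborel)"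
    proof (rule nn_integral_multc[symmetric])
      have "(\<lambda>x. g ?b e + \<alpha> ?b e * x) \<in> borel_measurable lborel" by measurable
      from measurable_compose[OF this fm]
      show "(\<lambda>x. F ((?P e)(?b := g ?b e + \<alpha> ?b e * x))) \<in> borel_measurable lborel" .
    qed
    finally show ?thesis by (simp only: P' A')
  qed
  have "(\<integral>\<^sup>+ c. F c \<partial>lborel_prod ?J) = (\<integral>\<^sup>+ c. G c \<partial>lborel_prod ?I)"
    unfolding ins G_def by (rule lborel_prod.product_nn_integral_insert[OF fin nin Suc.prems(3)[unfolded ins]])
  also have "\<dots> = (\<integral>\<^sup>+ e. G (?P e) * ennreal (?A e) \<partial>lborel_prod ?I)"
    by (rule Suc.IH) (use Suc.prems(1,2) mG in auto)
  also have "\<dots> = (\<integral>\<^sup>+ e. (\<integral>\<^sup>+ x. F (?P' (e(?b := x))) * ennreal (?A' (e(?b := x))) \<partial>lborel) \<partial>lborel_prod ?I)"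
    by (simp only: step)
  also have "\<dots> = (\<integral>\<^sup>+ e. F (?P' e) * ennreal (?A' e) \<partial>lborel_prod ?J)"
    using lborel_prod.product_nn_integral_insert[OF fin nin mF'[unfolded ins]] unfolding ins by simp
  finally show ?case .
qed

lemma moebius_measurable:
  assumes p: "p \<in> borel_measurable M" and d: "\<And>i. i < k \<Longrightarrow> (\<lambda>x. d x i) \<in> borel_measurable M"
  shows "(\<lambda>x. moebius (p x) (d x) k) \<in> borel_measurable M"
  unfolding moebius_def
proof (intro borel_measurable_diff borel_measurable_times borel_measurable_const borel_measurable_sum p fps_inverse_measurable)
  fix i l assume "i \<in> {..<k}" "l \<le> i"
  then have "l < k" "l - 1 < k" by auto
  then show "(\<lambda>x. fps_nth (moebius_denom (p x) (d x)) l) \<in> borel_measurable M"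
    unfolding moebius_denom_def using p d by (cases l) auto
qed simp

text \<open>
The slice parametrisation, with the parameter \<open>p\<close> as an additional first coordinate.
\<close>
definition slice_map :: "nat \<Rightarrow> nat \<Rightarrow> (nat \<Rightarrow> real) \<Rightarrow> nat \<Rightarrow> real" where
  "slice_map a n e = (\<lambda>i\<in>{a..<a + Suc n}. moebius (e a) (prepend_1 (Suc a) e) (Suc (i - a)))"

lemma slice_inverse_slice_map:
  assumes p: "e a \<noteq> 0" "e a \<noteq> 1"
  shows "slice_inverse a n (slice_map a n e) = restrict e {Suc a..<Suc a + n}"
  unfolding slice_inverse_def
proof (rule restrict_ext)
  fix i assume i: "i \<in> {Suc a..<Suc a + n}"
  have a: "slice_map a n e a = e a" by (simp add: slice_map_def)
  have s: "prepend_1 a (slice_map a n e) j = moebius (e a) (prepend_1 (Suc a) e) j" if "j \<le> Suc (i - a)" for j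
    using that i by (cases j) (auto simp: prepend_1_def slice_map_def)
  have "moebius_inv (slice_map a n e a) (prepend_1 a (slice_map a n e)) (i - a) = moebius_inv (e a) (moebius (e a) (prepend_1 (Suc a) e)) (i - a)"
    unfolding a by (rule moebius_inv_cong) (rule s)
  also have "\<dots> = prepend_1 (Suc a) e (i - a)"
    by (subst moebius_inv_moebius[OF p]) (simp_all add: prepend_1_def)
  also have "\<dots> = e i" using i by (auto simp: prepend_1_def)
  finally show "moebius_inv (slice_map a n e a) (prepend_1 a (slice_map a n e)) (i - a) = e i" .
qed

lemma slice_map_in_moment_points_iff:
  assumes p: "e a \<noteq> 0" "e a \<noteq> 1"
  shows "slice_map a n e \<in> moment_points a (Suc n) \<longleftrightarrow> 0 < e a \<and> e a < 1 \<and> restrict e {Suc a..<Suc a + n} \<in> moment_points (Suc a) n"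
proof (cases "0 < e a \<and> e a < 1")
  case True
  have a: "slice_map a n e a = e a" by (simp add: slice_map_def)
  have "slice_map a n e \<in> extensional {a..<a + Suc n}" by (simp add: slice_map_def)
  then have "slice_map a n e \<in> moment_points a (Suc n) \<longleftrightarrow> slice_inverse a n (slice_map a n e) \<in> moment_points (Suc a) n"
    using True by (intro moment_points_slice_iff) (simp_all add: a)
  then show ?thesis unfolding slice_inverse_slice_map[of e a n, OF p] using True by blast
next
  case False
  have "e a \<in> {0..1}" if "slice_map a n e \<in> moment_points a (Suc n)"
  proof -
    from that obtain c where c: "slice_map a n e = (\<lambda>i\<in>{a..<a + Suc n}. c (i + 1 - a))" and "c \<in> {c. hausdorff_seq c}"
      unfolding moment_points_def by (rule imageE)
    then have "c (Suc 0) \<in> {0..1}" using hausdorff_degenerate(1)[of c] by simp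
    moreover have "slice_map a n e a = c (Suc 0)" unfolding c by simp
    ultimately show ?thesis by (simp add: slice_map_def)
  qed
  then show ?thesis using False p by auto
qed

lemma nn_integral_slice_weight:
  "(\<integral>\<^sup>+ x. ennreal (indicator {0<..<1} x * (x * (1 - x)) ^ n) \<partial>lborel) = ennreal (beta_value n)"
proof -
  let ?f = "\<lambda>x :: real. indicator {0..1} x *\<^sub>R poly ([:0, 1, -1:] ^ n) x"
  have int: "set_integrable lborel {0..1} (poly ([:0, 1, -1 :: real:] ^ n))"
    by (rule borel_integrable_atLeastAtMost') (intro continuous_intros)
  have eq: "indicator {0<..<1} x * (x * (1 - x)) ^ n = ?f x" if "x \<noteq> 0" "x \<noteq> 1" for x :: real
    using that by (auto simp: indicator_def poly_power algebra_simps)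
  have "(\<integral>\<^sup>+ x. ennreal (indicator {0<..<1} x * (x * (1 - x)) ^ n) \<partial>lborel) = (\<integral>\<^sup>+ x. ennreal (?f x) \<partial>lborel)"
  proof (rule nn_integral_cong_AE)
    show "AE x in lborel. ennreal (indicator {0<..<1} x * (x * (1 - x)) ^ n) = ennreal (?f x)"
      using AE_lborel_singleton[of 0] AE_lborel_singleton[of 1] by eventually_elim (subst eq, assumption, assumption, rule refl)
  qed
  also have "\<dots> = ennreal (\<integral>x. ?f x \<partial>lborel)"
    using int unfolding set_integrable_def
    by (rule nn_integral_eq_integral) (auto simp: indicator_def poly_power intro!: AE_I2 zero_le_power)
  also have "(\<integral>x. ?f x \<partial>lborel) = beta_value n"
    unfolding poly_integral_weight[symmetric] poly_integral_def set_lebesgue_integral_def ..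
  finally show ?thesis .
qed

text \<open>
In the coordinates given by the slice parametrisation, the set becomes, up to a null set, the product of the open unit interval and the moment points of
order \<open>n - 1\<close>, with density \<open>(p * (1 - p)) ^ (n - 1)\<close>.
\<close>
theorem emeasure_moment_points: "emeasure (lborel_prod {a..<a + n}) (moment_points a n) = ennreal (\<Prod>k<n. beta_value k)"
proof (induction n arbitrary: a)
  case 0
  have "psd_hankel (\<lambda>_. 1)" unfolding psd_hankel_def
  proof (intro allI)
    fix n and x :: "nat \<Rightarrow> real"
    have "(\<Sum>i\<le>n. \<Sum>j\<le>n. 1 * x i * x j) = (\<Sum>i\<le>n. x i)\<^sup>2" by (simp add: power2_eq_square sum_product)
    then show "0 \<le> (\<Sum>i\<le>n. \<Sum>j\<le>n. 1 * x i * x j)" by simp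
  qed
  then have "hausdorff_seq (\<lambda>_. 1)" by (simp add: hausdorff_seq_def) (simp add: psd_hankel_def)
  then have "moment_points a 0 = {\<lambda>_. undefined}" by (auto simp: moment_points_def restrict_def)
  then show ?case by simp
next
  case (Suc n)
  let ?J = "{a..<a + Suc n}" and ?K = "{Suc a..<Suc a + n}"
  \<comment> \<open>On the null set where \<open>e a\<close> is 0 or 1 the slope is replaced by 1, because it must not vanish.\<close>
  define \<alpha> where "\<alpha> i e = (if a < i \<and> e a \<noteq> 0 \<and> e a \<noteq> 1 then e a * (1 - e a) else 1)" for i and e :: "nat \<Rightarrow> real"
  define g where "g i e = (if a < i then moebius (e a) ((prepend_1 (Suc a) e)(i - a := 0)) (Suc (i - a)) else 0)" for i e
  have ins: "?J = insert a ?K" and nin: "a \<notin> ?K" and fin: "finite ?K" by auto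
  have comp: "(\<lambda>e. e l) \<in> borel_measurable (lborel_prod L)" if "l \<in> L" for l L
    using measurable_component_singleton[OF that, of "\<lambda>_. lborel"] by simp
  have sub: "emeasure (lborel_prod ?J) (moment_points a (Suc n)) = (\<integral>\<^sup>+ c. indicator (moment_points a (Suc n)) c \<partial>lborel_prod ?J)"
    using moment_points_sets[of a "Suc n"] by simp
  also have "\<dots> = (\<integral>\<^sup>+ e. indicator (moment_points a (Suc n)) (\<lambda>i\<in>?J. \<alpha> i e * e i + g i e) * ennreal (\<Prod>i\<in>?J. \<bar>\<alpha> i e\<bar>) \<partial>lborel_prod ?J)"
  proof (rule triangular_substitution)
    show "\<alpha> i e \<noteq> 0" for i e by (simp add: \<alpha>_def)
    show "\<alpha> i e = \<alpha> i e'" if "\<And>j. j \<in> {a..<i} \<Longrightarrow> e j = e' j" for i e e'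
      using that[of a] by (auto simp: \<alpha>_def)
    show "g i e = g i e'" if "\<And>j. j \<in> {a..<i} \<Longrightarrow> e j = e' j" for i e e'
    proof (cases "a < i")
      case True
      have "moebius (e a) ((prepend_1 (Suc a) e)(i - a := 0)) (Suc (i - a))
          = moebius (e' a) ((prepend_1 (Suc a) e')(i - a := 0)) (Suc (i - a))"
        using True that[of a] that by (auto intro!: moebius_cong simp: prepend_1_def)
      then show ?thesis by (simp add: g_def)
    qed (simp add: g_def)
    fix i assume i: "i \<in> ?J"
    show "\<alpha> i \<in> borel_measurable (lborel_prod {a..<i})"
    proof (cases "a < i")
      case True
      then show ?thesis unfolding \<alpha>_def[abs_def] using comp[of a "{a..<i}"] by simp
    qed (simp add: \<alpha>_def[abs_def])
    show "g i \<in> borel_measurable (lborel_prod {a..<i})"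
    proof (cases "a < i")
      case True
      have "(\<lambda>e. ((prepend_1 (Suc a) e)(i - a := 0)) l) \<in> borel_measurable (lborel_prod {a..<i})" if "l < Suc (i - a)" for l
      proof (cases "l = 0 \<or> l = i - a")
        case True
        then show ?thesis by (cases "l = i - a") (simp_all add: prepend_1_def)
      next
        case False
        then have "a + l \<in> {a..<i}" using that by auto
        then show ?thesis using comp[of "a + l" "{a..<i}"] False by (simp add: prepend_1_def)
      qed
      then have "(\<lambda>e. moebius (e a) ((prepend_1 (Suc a) e)(i - a := 0)) (Suc (i - a))) \<in> borel_measurable (lborel_prod {a..<i})"
        using True by (intro moebius_measurable comp) auto
      moreover have "g i = (\<lambda>e. moebius (e a) ((prepend_1 (Suc a) e)(i - a := 0)) (Suc (i - a)))"
        using True by (simp add: g_def[abs_def])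
      ultimately show ?thesis by (simp only:)
    qed (simp add: g_def[abs_def])
  next
    show "indicator (moment_points a (Suc n)) \<in> borel_measurable (lborel_prod ?J)"
      using moment_points_sets[of a "Suc n"] by (rule borel_measurable_indicator)
  qed
  also have "\<dots> = (\<integral>\<^sup>+ e. indicator (moment_points (Suc a) n) (restrict e ?K) * ennreal (indicator {0<..<1} (e a) * (e a * (1 - e a)) ^ n) \<partial>lborel_prod ?J)"
  proof (rule nn_integral_cong_AE)
    have "AE e in lborel_prod ?J. \<forall>j\<in>?J. e j \<noteq> 0" "AE e in lborel_prod ?J. \<forall>j\<in>?J. e j \<noteq> 1"
      by (intro AE_component_neq; simp)+
    then show "AE e in lborel_prod ?J. indicator (moment_points a (Suc n)) (\<lambda>i\<in>?J. \<alpha> i e * e i + g i e) * ennreal (\<Prod>i\<in>?J. \<bar>\<alpha> i e\<bar>)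
        = indicator (moment_points (Suc a) n) (restrict e ?K) * ennreal (indicator {0<..<1} (e a) * (e a * (1 - e a)) ^ n)"
    proof eventually_elim
      case (elim e)
      then have p: "e a \<noteq> 0" "e a \<noteq> 1" by auto
      have "(\<lambda>i\<in>?J. \<alpha> i e * e i + g i e) = slice_map a n e"
        unfolding slice_map_def
      proof (rule restrict_ext)
        fix i assume i: "i \<in> ?J"
        show "\<alpha> i e * e i + g i e = moebius (e a) (prepend_1 (Suc a) e) (Suc (i - a))"
        proof (cases "a < i")
          case True
          then obtain k where k: "i - a = Suc k" by (cases "i - a") auto
          then have "i = Suc (a + k)" using True by simp
          then have "prepend_1 (Suc a) e (Suc k) = e i" by (simp add: prepend_1_def)
          then show ?thesis using p True by (simp add: \<alpha>_def g_def k moebius_affine[of "e a" "prepend_1 (Suc a) e" k])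
        next
          case False
          then show ?thesis using i by (simp add: \<alpha>_def g_def)
        qed
      qed
      moreover have "(\<Prod>i\<in>?J. \<bar>\<alpha> i e\<bar>) = \<bar>e a * (1 - e a)\<bar> ^ n"
      proof -
        have "(\<Prod>i\<in>?K. \<bar>\<alpha> i e\<bar>) = (\<Prod>i\<in>?K. \<bar>e a * (1 - e a)\<bar>)" using p by (intro prod.cong) (auto simp: \<alpha>_def)
        then show ?thesis unfolding ins using nin fin by (simp add: \<alpha>_def)
      qed
      ultimately show ?case
        using slice_map_in_moment_points_iff[of e a n, OF p] by (auto simp: indicator_def)
    qed
  qed
  also have "\<dots> = (\<integral>\<^sup>+ e. (\<integral>\<^sup>+ x. indicator (moment_points (Suc a) n) (restrict (e(a := x)) ?K)
      * ennreal (indicator {0<..<1} ((e(a := x)) a) * ((e(a := x)) a * (1 - (e(a := x)) a)) ^ n) \<partial>lborel) \<partial>lborel_prod ?K)"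
  proof -
    have "(\<lambda>e. restrict e ?K) \<in> measurable (lborel_prod ?J) (lborel_prod ?K)" by (intro measurable_restrict_subset) auto
    from measurable_compose[OF this borel_measurable_indicator[OF moment_points_sets]]
    have 1: "(\<lambda>e. indicator (moment_points (Suc a) n) (restrict e ?K) :: ennreal) \<in> borel_measurable (lborel_prod ?J)" .
    have "(\<lambda>x. ennreal (indicator {0<..<1} x * (x * (1 - x)) ^ n)) \<in> borel_measurable borel" by measurable
    from measurable_compose[OF comp[of a ?J] this]
    have 2: "(\<lambda>e. ennreal (indicator {0<..<1} (e a) * (e a * (1 - e a)) ^ n)) \<in> borel_measurable (lborel_prod ?J)" by simp
    have 3: "(\<lambda>e. indicator (moment_points (Suc a) n) (restrict e ?K) * ennreal (indicator {0<..<1} (e a) * (e a * (1 - e a)) ^ n)) \<in> borel_measurable (lborel_prod ?J)"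
      using 1 2 by measurable
    show ?thesis unfolding ins
      by (rule lborel_prod.product_nn_integral_insert[OF fin nin]) (use 3 in \<open>simp only: ins\<close>)
  qed
  also have "\<dots> = (\<integral>\<^sup>+ e. indicator (moment_points (Suc a) n) e * ennreal (beta_value n) \<partial>lborel_prod ?K)"
  proof (rule nn_integral_cong)
    fix e assume "e \<in> space (lborel_prod ?K)"
    then have r: "restrict (e(a := x)) ?K = e" for x
      by (auto simp: space_PiM PiE_def extensional_def fun_eq_iff)
    show "(\<integral>\<^sup>+ x. indicator (moment_points (Suc a) n) (restrict (e(a := x)) ?K)
      * ennreal (indicator {0<..<1} ((e(a := x)) a) * ((e(a := x)) a * (1 - (e(a := x)) a)) ^ n) \<partial>lborel)
      = indicator (moment_points (Suc a) n) e * ennreal (beta_value n)"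
      unfolding r fun_upd_same by (subst nn_integral_cmult) (simp_all add: nn_integral_slice_weight)
  qed
  also have "\<dots> = emeasure (lborel_prod ?K) (moment_points (Suc a) n) * ennreal (beta_value n)"
    using moment_points_sets[of "Suc a" n] by (subst nn_integral_multc) simp_all
  also have "\<dots> = ennreal (\<Prod>k<Suc n. beta_value k)"
  proof -
    have "0 \<le> beta_value k" for k by (simp add: beta_value_def)
    then show ?thesis unfolding Suc.IH by (simp add: ennreal_mult prod_nonneg)
  qed
  finally show ?case .
qed

theorem Vol_moment_space: "Vol n (moment_space n) = (\<Prod>k<n. beta_value k)"
proof -
  have "{1..<1 + n} = {1..n}" by auto
  then have "emeasure (lborel_prod {1..n}) (moment_points 1 n) = ennreal (\<Prod>k<n. beta_value k)"
    using emeasure_moment_points[of 1 n] by simp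
  moreover have "0 \<le> (\<Prod>k<n. beta_value k)" by (intro prod_nonneg) (simp add: beta_value_def)
  ultimately show ?thesis by (simp add: Vol_def lborel_dim_def moment_space_eq measure_def)
qed

section \<open>The biorthogonal system\<close>

lemma vandermonde4_vandermonde: "vandermonde4 {1..N} t = vandermonde_prod N t ^ 4"
proof (induction N)
  case 0
  show ?case by (simp add: vandermonde4_def vandermonde_prod_def)
next
  case (Suc N)
  have e: "{1..Suc N} - {Suc N} = {1..N}" and l: "{1..<Suc N} = {1..N}" by auto
  have "vandermonde4 {1..Suc N} t = vandermonde4 {1..N} t * (\<Prod>k\<in>{1..N}. (t (Suc N) - t k)\<^sup>2)\<^sup>2"
    using vandermonde4_remove[of "{1..Suc N}" "Suc N" t] by (simp only: e finite_atLeastAtMost) simp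
  also have "(\<Prod>k\<in>{1..N}. (t (Suc N) - t k)\<^sup>2)\<^sup>2 = (\<Prod>k\<in>{1..N}. t (Suc N) - t k) ^ 4"
    by (simp add: prod_power_distrib power_mult[symmetric])
  moreover have "vandermonde_prod (Suc N) t = vandermonde_prod N t * (\<Prod>k\<in>{1..N}. t (Suc N) - t k)"
    unfolding vandermonde_prod_def prod.cl_ivl_Suc l by simp
  ultimately show ?case by (simp only: Suc.IH power_mult_distrib)
qed

lemma H_kernel_eq:
  "H_kernel m s t = principal_weight {1..m-1} t - kernel_with_0 {1..m-1} s t - kernel_with_1 {1..m-1} s t"
  unfolding H_kernel_def J_p_ou_def J_c_ol_def J_c_ou_def principal_weight_def kernel_with_0_def kernel_with_1_def vandermonde4_vandermonde
  by (simp add: power2_commute)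

definition normalisation :: "nat \<Rightarrow> real" where
  "normalisation m = 1 / Vol (2*m-1) (moment_space (2*m-1)) * (2 / (fact (2*m-1) * fact (m-1)))"

text \<open>
The values of Selberg's integral and of the volume agree up to the factorials, which is the reason for the normalisation of the kernel.
\<close>
lemma normalisation_integral:
  assumes "m \<ge> 1"
  shows "normalisation m * cube_integral {1..m-1} (principal_weight {1..m-1}) = 2"
proof -
  define V where "V = (\<Prod>k<2*m-1. beta_value k)"
  have "2 * card {1..m-1} + 1 = 2*m-1" using assms by simp
  then have c: "cube_integral {1..m-1} (principal_weight {1..m-1}) = fact (m-1) * fact (2*m-1) * V"
    using selberg_integral[of "{1..m-1}"] by (simp only: V_def finite_atLeastAtMost simp_thms) simp
  have "V > 0" unfolding V_def by (intro prod_pos) (simp add: beta_value_def)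
  then show ?thesis unfolding normalisation_def Vol_moment_space V_def[symmetric] c by simp
qed

text \<open>
The scaled kernel as a polynomial in its first argument.
\<close>
definition kernel_poly :: "nat \<Rightarrow> (nat \<Rightarrow> real) \<Rightarrow> real poly" where
  "kernel_poly m t = [:normalisation m * principal_weight {1..m-1} t:]
     + ([:0, - (normalisation m * ((\<Prod>j\<in>{1..m-1}. (t j)\<^sup>2) * vandermonde4 {1..m-1} t)):]
        + [:- (normalisation m * ((\<Prod>j\<in>{1..m-1}. (1 - t j)\<^sup>2) * vandermonde4 {1..m-1} t)),
           normalisation m * ((\<Prod>j\<in>{1..m-1}. (1 - t j)\<^sup>2) * vandermonde4 {1..m-1} t):]) * double_nodes {1..m-1} t"

lemma poly_kernel_poly: "poly (kernel_poly m t) s = H_hat m s t"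
  unfolding kernel_poly_def H_hat_def normalisation_def[symmetric] H_kernel_eq kernel_with_0_def kernel_with_1_def
  by (simp add: poly_double_nodes) (simp add: algebra_simps)

lemma kernel_poly_Pi0:
  assumes "m \<ge> 1"
  shows "kernel_poly m t \<in> Pi0 (2*m-1)"
proof -
  have l: "degree (([:0, a:] + [:b, c:]) * double_nodes {1..m-1} t) \<le> 2*m-1" for a b c :: real
  proof (rule order.trans[OF degree_mult_le])
    have "degree ([:0, a:] + [:b, c:]) \<le> 1" by (intro degree_add_le) (auto intro!: order.trans[OF degree_pCons_le])
    then show "degree ([:0, a:] + [:b, c:]) + degree (double_nodes {1..m-1} t) \<le> 2*m-1"
      using degree_double_nodes[of "{1..m-1}" t] assms by simp
  qed
  have "degree (kernel_poly m t) \<le> 2*m-1"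
    unfolding kernel_poly_def by (intro degree_add_le l) simp
  moreover have "poly (kernel_poly m t) 0 = 0" "poly (kernel_poly m t) 1 = 0"
    unfolding poly_kernel_poly H_hat_def H_kernel_eq kernel_with_0_def kernel_with_1_def principal_weight_def
    by (simp_all add: prod.distrib power2_commute[of 1])
  ultimately show ?thesis by (simp add: Pi0_def)
qed

lemma cube_bounded_poly_add:
  assumes "cube_bounded_poly I R" "cube_bounded_poly I S"
  shows "cube_bounded_poly I (\<lambda>t. R t + S t)"
proof -
  obtain d e where "\<And>t. degree (R t) \<le> d" "\<And>t. degree (S t) \<le> e"
    using assms by (auto simp: cube_bounded_poly_def)
  then have "degree (R t + S t) \<le> max d e" for t
    by (intro degree_add_le) (auto intro: max.coboundedI1 max.coboundedI2)
  moreover have "cube_bounded I (\<lambda>t. coeff (R t + S t) i)" for i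
    unfolding coeff_add using assms by (auto simp: cube_bounded_poly_def)
  ultimately show ?thesis unfolding cube_bounded_poly_def by blast
qed

lemma cube_bounded_kernel_poly: "cube_bounded_poly {1..m-1} (kernel_poly m)"
  unfolding kernel_poly_def[abs_def]
  by (intro cube_bounded_poly_add cube_bounded_poly_mult cube_bounded_poly_pCons cube_bounded_double_nodes cube_bounded_intros cube_bounded_minus order_refl; simp)

lemma reproducing_property:
  assumes m: "m \<ge> 1" and \<phi>: "\<phi> \<in> Pi0 (2*m-1)"
  shows "cube_integral {1..m-1} (\<lambda>t. H_hat m s t * Sigma_op m (poly \<phi>) t) = poly \<phi> s"
proof -
  let ?I = "{1..m-1}"
  have d: "degree \<phi> \<le> 2 * card ?I + 1" using \<phi> m by (auto simp: Pi0_def)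
  have "cube_integral ?I (\<lambda>t. H_hat m s t * Sigma_op m (poly \<phi>) t)
      = cube_integral ?I (\<lambda>t. normalisation m * ((principal_weight ?I t - kernel_with_0 ?I s t - kernel_with_1 ?I s t) * (\<Sum>i\<in>?I. poly \<phi> (t i))))"
    by (simp only: H_hat_def normalisation_def H_kernel_eq Sigma_op_def mult.assoc)
  also have "\<dots> = normalisation m * (poly \<phi> s / 2 * cube_integral ?I (principal_weight ?I))"
    unfolding cube_integral_cmult by (subst reproducing_identity[OF _ d]) (use \<phi> in \<open>auto simp: Pi0_def\<close>)
  also have "\<dots> = poly \<phi> s / 2 * (normalisation m * cube_integral ?I (principal_weight ?I))" by simp
  finally show ?thesis unfolding normalisation_integral[OF m] by simp
qed

lemma poly_eq_on_unit_interval: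
  fixes P Q :: "real poly"
  assumes "\<And>x. x \<in> {0..1} \<Longrightarrow> poly P x = poly Q x"
  shows "P = Q"
proof (rule ccontr)
  assume "P \<noteq> Q"
  then have "finite {x. poly (P - Q) x = 0}" by (intro poly_roots_finite) simp
  moreover have "{0..1} \<subseteq> {x. poly (P - Q) x = 0}" using assms by auto
  ultimately have "finite {0..1::real}" by (rule finite_subset[rotated])
  then show False using infinite_Icc[of 0 "1::real"] by simp
qed

locale Pi0_basis =
  fixes n :: nat and A :: "nat set" and p :: "nat \<Rightarrow> real poly"
  assumes finite_A: "finite A" and inj: "inj_on p A" and indep: "poly_vs.independent (p ` A)"
    and span: "poly_vs.span (p ` A) = Pi0 n" and n1: "n \<ge> 1"
begin

lemma coordinates: "q \<in> Pi0 n \<Longrightarrow> \<exists>a. q = (\<Sum>j\<in>A. smult (a j) (p j))"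
proof -
  assume "q \<in> Pi0 n"
  then have "q \<in> range (\<lambda>u. \<Sum>v\<in>p ` A. smult (u v) v)"
    unfolding span[symmetric] by (subst (asm) poly_vs.span_finite) (use finite_A in auto)
  then obtain u where "q = (\<Sum>v\<in>p ` A. smult (u v) v)" by blast
  then have "q = (\<Sum>j\<in>A. smult (u (p j)) (p j))" by (simp add: sum.reindex[OF inj])
  then show ?thesis by (intro exI[of _ "\<lambda>j. u (p j)"])
qed

lemma coordinates_unique:
  assumes "(\<Sum>j\<in>A. smult (a j) (p j)) = (\<Sum>j\<in>A. smult (b j) (p j))" "j \<in> A"
  shows "a j = b j"
proof -
  define u where "u v = (a (inv_into A p v) - b (inv_into A p v))" for v
  have u: "u (p j) = a j - b j" if "j \<in> A" for j using that by (simp add: u_def inv_into_f_f[OF inj])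
  have "(\<Sum>v\<in>p ` A. smult (u v) v) = (\<Sum>j\<in>A. smult (a j - b j) (p j))"
    by (simp add: sum.reindex[OF inj] u)
  also have "\<dots> = 0" using assms(1) by (simp add: smult_diff_left sum_subtractf)
  finally have "u (p j) = 0"
    using poly_vs.independentD[OF indep, of "p ` A" u "p j"] finite_A assms(2) by simp
  then show ?thesis using u[OF assms(2)] by simp
qed

text \<open>
The coordinates are linear in the polynomial coefficients. This gives regularity of the coordinate
functions \<open>h j\<close>, which are determined only pointwise. Any \<open>q\<close> vanishing at 0 and 1 is the combination
of the \<open>x\<^sup>i - x\<close> with its own coefficients.
\<close>
lemma coordinates_from_coeffs:
  "\<exists>\<Lambda>. \<forall>q\<in>Pi0 n. q = (\<Sum>j\<in>A. smult (\<Sum>i\<le>n. \<Lambda> i j * coeff q i) (p j))"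
proof -
  \<comment> \<open>The polynomials \<open>x\<^sup>i - x\<close>, with 0 as a default for \<open>i = 0\<close>, where the coefficient of \<open>q\<close> is 0.\<close>
  define r :: "nat \<Rightarrow> real poly" where "r i = (if i = 0 then 0 else monom 1 i - monom 1 1)" for i
  have "r i \<in> Pi0 n" if "i \<le> n" for i
    using that n1 by (auto simp: r_def Pi0_def poly_monom intro!: degree_diff_le order.trans[OF degree_monom_le])
  then have "\<forall>i. \<exists>a. i \<le> n \<longrightarrow> r i = (\<Sum>j\<in>A. smult (a j) (p j))" using coordinates by blast
  then obtain \<Lambda> where \<Lambda>: "\<And>i. i \<le> n \<Longrightarrow> r i = (\<Sum>j\<in>A. smult (\<Lambda> i j) (p j))" by metis
  have "q = (\<Sum>j\<in>A. smult (\<Sum>i\<le>n. \<Lambda> i j * coeff q i) (p j))" if q: "q \<in> Pi0 n" for q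
  proof -
    have q0: "coeff q 0 = 0" using q by (simp add: Pi0_def poly_0_coeff_0)
    have dq: "degree q \<le> n" using q by (simp add: Pi0_def)
    have q1: "(\<Sum>i\<le>n. coeff q i) = 0"
    proof -
      have "(\<Sum>i\<le>n. coeff q i) = (\<Sum>i\<le>degree q. coeff q i)"
        using dq by (intro sum.mono_neutral_right) (auto simp: coeff_eq_0)
      also have "\<dots> = poly q 1" by (simp add: poly_altdef)
      finally show ?thesis using q by (simp add: Pi0_def)
    qed
    have "(\<Sum>i\<le>n. smult (coeff q i) (r i)) = (\<Sum>i\<le>n. monom (coeff q i) i - monom (coeff q i) 1)"
      by (intro sum.cong refl) (auto simp: r_def q0 smult_diff_right smult_monom)
    also have "\<dots> = (\<Sum>i\<le>n. monom (coeff q i) i) - monom (\<Sum>i\<le>n. coeff q i) 1"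
      by (simp add: sum_subtractf monom_sum)
    also have "\<dots> = q" unfolding q1 using poly_as_sum_of_monoms'[OF dq] by simp
    finally have "q = (\<Sum>i\<le>n. smult (coeff q i) (r i))" ..
    also have "\<dots> = (\<Sum>i\<le>n. \<Sum>j\<in>A. smult (\<Lambda> i j * coeff q i) (p j))"
      by (intro sum.cong refl) (simp add: \<Lambda> poly_vs.scale_sum_right mult.commute)
    also have "\<dots> = (\<Sum>j\<in>A. \<Sum>i\<le>n. smult (\<Lambda> i j * coeff q i) (p j))" by (rule sum.swap)
    finally show ?thesis by (simp add: poly_vs.scale_sum_left)
  qed
  then show ?thesis by blast
qed

end

lemma cube_bounded_square_integrable:
  assumes "finite I" "cube_bounded I f" "\<And>t. t \<in> unit_box I \<Longrightarrow> g t = f t"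
  shows "square_integrable_on (lborel_prod I) (unit_box I) g"
proof -
  have i: "(\<lambda>t. indicator (unit_box I) t *\<^sub>R g t) = (\<lambda>t. indicator (unit_box I) t *\<^sub>R f t)"
    "(\<lambda>t. indicator (unit_box I) t *\<^sub>R (g t)\<^sup>2) = (\<lambda>t. indicator (unit_box I) t *\<^sub>R (f t)\<^sup>2)"
    using assms(3) by (auto simp: indicator_def fun_eq_iff)
  have "integrable (lborel_prod I) (\<lambda>t. indicator (unit_box I) t *\<^sub>R f t)" "integrable (lborel_prod I) (\<lambda>t. indicator (unit_box I) t *\<^sub>R (f t)\<^sup>2)"
    using cube_bounded_set_integrable[OF assms(1,2)] cube_bounded_set_integrable[OF assms(1) cube_bounded_power[OF assms(2), of 2]]
    by (simp_all only: set_integrable_def)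
  then show ?thesis
    unfolding square_integrable_on_def set_borel_measurable_def set_integrable_def i by (blast intro: borel_measurable_integrable)
qed

theorem theorem8p2:
  fixes m :: nat
  assumes "m \<ge> 2"
  shows "(\<forall>t \<in> unit_cube (m-1). \<exists>q \<in> Pi0 (2*m-1). \<forall>s \<in> {0..1}. H_hat m s t = poly q s) \<and>
    (\<forall>p :: nat \<Rightarrow> real poly.
       inj_on p {1..2*m-2} \<and> poly_vs.independent (p ` {1..2*m-2}) \<and>
       poly_vs.span (p ` {1..2*m-2}) = Pi0 (2*m-1) \<longrightarrow>
       (\<exists>h :: nat \<Rightarrow> (nat \<Rightarrow> real) \<Rightarrow> real. \<forall>s \<in> {0..1}. \<forall>t \<in> unit_cube (m-1).
          H_hat m s t = (\<Sum>j=1..2*m-2. h j t * poly (p j) s)) \<and>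
       (\<forall>h :: nat \<Rightarrow> (nat \<Rightarrow> real) \<Rightarrow> real.
          (\<forall>s \<in> {0..1}. \<forall>t \<in> unit_cube (m-1).
             H_hat m s t = (\<Sum>j=1..2*m-2. h j t * poly (p j) s)) \<longrightarrow>
          (\<forall>j \<in> {1..2*m-2}.
             square_integrable_on (lborel_dim (m-1)) (unit_cube (m-1)) (h j) \<and>
             square_integrable_on (lborel_dim (m-1)) (unit_cube (m-1))
               (Sigma_op m (poly (p j)))) \<and>
          (\<forall>j \<in> {1..2*m-2}. \<forall>k \<in> {1..2*m-2}.
             (LINT t:unit_cube (m-1)|lborel_dim (m-1). h j t * Sigma_op m (poly (p k)) t)
               = (if j = k then 1 else 0))))"
proof (intro conjI allI impI)
  have m1: "m \<ge> 1" using assms by simp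
  show "\<forall>t \<in> unit_cube (m-1). \<exists>q \<in> Pi0 (2*m-1). \<forall>s \<in> {0..1}. H_hat m s t = poly q s"
    using kernel_poly_Pi0[OF m1] poly_kernel_poly by metis
  let ?A = "{1..2*m-2}" and ?I = "{1..m-1}"
  fix p :: "nat \<Rightarrow> real poly"
  assume "inj_on p ?A \<and> poly_vs.independent (p ` ?A) \<and> poly_vs.span (p ` ?A) = Pi0 (2*m-1)"
  then interpret B: Pi0_basis "2*m-1" ?A p using m1 by unfold_locales auto
  obtain \<Lambda> where \<Lambda>: "\<And>q. q \<in> Pi0 (2*m-1) \<Longrightarrow> q = (\<Sum>j\<in>?A. smult (\<Sum>i\<le>2*m-1. \<Lambda> i j * coeff q i) (p j))"
    using B.coordinates_from_coeffs by blast
  \<comment> \<open>A version of the coordinates that is polynomial in \<open>t\<close>; the given \<open>h\<close> may differ from it outside the cube.\<close>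
  define k where "k j t = (\<Sum>i\<le>2*m-1. \<Lambda> i j * coeff (kernel_poly m t) i)" for j t
  have Hk: "kernel_poly m t = (\<Sum>j\<in>?A. smult (k j t) (p j))" for t
    unfolding k_def by (rule \<Lambda>[OF kernel_poly_Pi0[OF m1]])
  have Hhat: "H_hat m s t = (\<Sum>j\<in>?A. k j t * poly (p j) s)" for s t
    unfolding poly_kernel_poly[symmetric] by (subst Hk) (simp add: poly_sum)
  have nk: "cube_bounded ?I (k j)" for j
    unfolding k_def[abs_def] using cube_bounded_kernel_poly[of m] by (intro cube_bounded_intros) (simp add: cube_bounded_poly_def)
  have nS: "cube_bounded ?I (Sigma_op m \<phi>)" if "\<phi> = poly q" for \<phi> q
    unfolding Sigma_op_def[abs_def] that by (intro cube_bounded_intros) auto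
  have pPi: "p j \<in> Pi0 (2*m-1)" if "j \<in> ?A" for j
    unfolding B.span[symmetric] using that by (intro poly_vs.span_base) auto
  show "\<exists>h :: nat \<Rightarrow> (nat \<Rightarrow> real) \<Rightarrow> real. \<forall>s \<in> {0..1}. \<forall>t \<in> unit_cube (m-1).
          H_hat m s t = (\<Sum>j=1..2*m-2. h j t * poly (p j) s)"
    by (intro exI[of _ k] ballI Hhat)
  fix h :: "nat \<Rightarrow> (nat \<Rightarrow> real) \<Rightarrow> real"
  assume h: "\<forall>s \<in> {0..1}. \<forall>t \<in> unit_cube (m-1). H_hat m s t = (\<Sum>j=1..2*m-2. h j t * poly (p j) s)"
  have hk: "h j t = k j t" if "t \<in> unit_cube (m-1)" "j \<in> ?A" for j t
  proof (rule B.coordinates_unique[OF _ that(2)])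
    have "(\<Sum>j\<in>?A. smult (h j t) (p j)) = kernel_poly m t"
      by (rule poly_eq_on_unit_interval) (use h that(1) in \<open>simp add: poly_sum poly_kernel_poly\<close>)
    then show "(\<Sum>j\<in>?A. smult (h j t) (p j)) = (\<Sum>j\<in>?A. smult (k j t) (p j))" using Hk by simp
  qed
  note sets = unit_cube_def lborel_dim_def
  show "\<forall>j \<in> ?A. square_integrable_on (lborel_dim (m-1)) (unit_cube (m-1)) (h j) \<and>
             square_integrable_on (lborel_dim (m-1)) (unit_cube (m-1)) (Sigma_op m (poly (p j)))"
    unfolding sets using hk[unfolded sets] nk nS
    by (intro ballI conjI cube_bounded_square_integrable) auto
  show "\<forall>j \<in> ?A. \<forall>l \<in> ?A.
             (LINT t:unit_cube (m-1)|lborel_dim (m-1). h j t * Sigma_op m (poly (p l)) t)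
               = (if j = l then 1 else 0)"
  proof (intro ballI)
    fix j l assume j: "j \<in> ?A" and l: "l \<in> ?A"
    define c where "c i = cube_integral ?I (\<lambda>t. k i t * Sigma_op m (poly (p l)) t)" for i
    have "p l = (\<Sum>i\<in>?A. smult (c i) (p i))"
    proof (rule poly_eq_on_unit_interval)
      fix s :: real
      have "poly (p l) s = cube_integral ?I (\<lambda>t. H_hat m s t * Sigma_op m (poly (p l)) t)"
        by (rule reproducing_property[OF m1 pPi[OF l], symmetric])
      also have "\<dots> = cube_integral ?I (\<lambda>t. \<Sum>i\<in>?A. poly (p i) s * (k i t * Sigma_op m (poly (p l)) t))"
        unfolding Hhat by (simp add: sum_distrib_left sum_distrib_right mult_ac)
      also have "\<dots> = (\<Sum>i\<in>?A. poly (p i) s * c i)"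
        unfolding c_def cube_integral_cmult[symmetric]
        by (rule cube_integral_sum, rule finite_atLeastAtMost, intro cube_bounded_mult cube_bounded_const nk nS, rule refl)
      finally show "poly (p l) s = poly (\<Sum>i\<in>?A. smult (c i) (p i)) s" by (simp add: poly_sum mult.commute)
    qed
    also have "p l = (\<Sum>i\<in>?A. smult (if i = l then 1 else 0) (p i))"
    proof -
      have "(\<Sum>i\<in>?A. smult (if i = l then 1 else 0) (p i)) = (\<Sum>i\<in>?A. if i = l then p i else 0)"
        by (intro sum.cong) auto
      then show ?thesis using l by simp
    qed
    finally have "c j = (if j = l then 1 else 0)"
      using B.coordinates_unique[of "\<lambda>i. if i = l then 1 else 0" c j] j by simp
    moreover have "(LINT t:unit_cube (m-1)|lborel_dim (m-1). h j t * Sigma_op m (poly (p l)) t) = c j"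
      unfolding c_def cube_integral_def sets set_lebesgue_integral_def
      by (intro Bochner_Integration.integral_cong refl) (use hk[unfolded sets] j in \<open>auto simp: indicator_def\<close>)
    ultimately show "(LINT t:unit_cube (m-1)|lborel_dim (m-1). h j t * Sigma_op m (poly (p l)) t)
               = (if j = l then 1 else 0)" by simp
  qed
qed

end
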